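(* Let $n\ge2$ and fix $(p,q)\in\mathcal P_n=\{(1,n-1),(n-1,1)\}\cup\{2,\ldots,n-1\}^2$. Let $\mathcal A$ be the set of symmetric oscillatory matrices $A$ of order $n$ with $(\operatorname{bw}A,\operatorname{bw}A^{-1})=(p,q)$. (1) When $p+q\le n$, $\displaystyle\max_{A\in\mathcal A}\sum_{k=1}^{n-1}e_k(A)=\binom n2$. (2) When $p+q\ge n$, put $$h=\max\left\{\left\lfloor\frac n2\right\rfloor,\ n-\min\{p,q\}\right\}.$$ Then $$\max_{A\in\mathcal A} e(A)=h,\qquad \max_{A\in\mathcal A}\sum_{k=1}^{n-1}e_k(A)=h(n-h)+\binom{n-p}{2}+\binom{n-q}{2}.$$ These two maxima are attained simultaneously by the matrices $U(w)^T\Delta U(w)$ with $w=(n-1,n-2,\ldots,n-q+1,\ 1,2,\ldots,p)$ (first segment empty for $q=1$), arbitrary positive parameters (the same in both factors) and arbitrary positive diagonal $\Delta$. Every maximum sum in (1) and (2) is attained by an integer matrix in $\mathcal A$ of determinant one. At $p+q=n$, both sum formulas agree.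
   Context: All matrices are real. A matrix is totally nonnegative (TN) if all its minors are nonnegative and totally positive (TP) if all its minors are positive. A square TN matrix is oscillatory if some positive integer power of it is TP. For an oscillatory matrix $A$ of order $n$ and $1\le k\le n$, $e_k(A)=\min\{m\ge1:\text{all minors of order }k\text{ of }A^m\text{ are positive}\}$ and $e(A)=\min\{m\ge1:A^m\text{ is TP}\}=\max_{1\le k\le n}e_k(A)$. For a square matrix $M=(m_{ij})$, $\operatorname{bw}M=\max(\{0\}\cup\{|i-j|:m_{ij}\ne0\})$ (half-bandwidth). For $1\le i<n$ and $a>0$, $x_i(a)=I+aE_{i,i+1}$, where $E_{ij}$ is the $n\times n$ matrix with single nonzero entry one in position $(i,j)$. For a finite sequence $w=(i_1,\ldots,i_L)$ of indices in $\{1,\ldots,n-1\}$ and positive parameters $a_1,\ldots,a_L$ (different occurrences may have different parameters), $U(w)=x_{i_1}(a_1)\cdots x_{i_L}(a_L)$. A positive diagonal matrix is a diagonal matrix with positive diagonal entries. For $n=2$, $\mathcal P_2=\{(1,1)\}$. *)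

theory Defs
  imports
    Complex_Main
    "Jordan_Normal_Form.Determinant"
    "Jordan_Normal_Form.DL_Submatrix"
    "Jordan_Normal_Form.Gauss_Jordan_Elimination"
begin

definition minors :: "nat \<Rightarrow> real mat \<Rightarrow> real set" where
  "minors k A = {det (submatrix A I J) | I J.
     I \<subseteq> {..<dim_row A} \<and> J \<subseteq> {..<dim_col A} \<and> card I = k \<and> card J = k}"

definition totally_nonnegative :: "real mat \<Rightarrow> bool" where
  "totally_nonnegative A \<longleftrightarrow> (\<forall>k\<ge>1. \<forall>x\<in>minors k A. x \<ge> 0)"

definition totally_positive :: "real mat \<Rightarrow> bool" where
  "totally_positive A \<longleftrightarrow> (\<forall>k\<ge>1. \<forall>x\<in>minors k A. x > 0)"

definition oscillatory :: "real mat \<Rightarrow> bool" where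
  "oscillatory A \<longleftrightarrow> square_mat A \<and> totally_nonnegative A \<and>
     (\<exists>m\<ge>1. totally_positive (A ^\<^sub>m m))"

text \<open>The two exponents below are meaningful for oscillatory matrices only, where the sets over
  which the least element is taken are nonempty.\<close>

definition minor_exponent :: "nat \<Rightarrow> real mat \<Rightarrow> nat" where
  "minor_exponent k A = (LEAST m. m \<ge> 1 \<and> (\<forall>x\<in>minors k (A ^\<^sub>m m). x > 0))"

definition exponent :: "real mat \<Rightarrow> nat" where
  "exponent A = (LEAST m. m \<ge> 1 \<and> totally_positive (A ^\<^sub>m m))"

text \<open>The sum stops at \<open>n - 1\<close>: the determinant (order \<open>n\<close>) is not counted.\<close>

definition exponent_sum :: "real mat \<Rightarrow> nat" where
  "exponent_sum A = (\<Sum>k = 1..dim_row A - 1. minor_exponent k A)"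

definition bandwidth :: "real mat \<Rightarrow> nat" where
  "bandwidth M = Max ({0} \<union>
     {nat \<bar>int i - int j\<bar> | i j. i < dim_row M \<and> j < dim_col M \<and> M $$ (i, j) \<noteq> 0})"

definition bandwidth_pairs :: "nat \<Rightarrow> (nat \<times> nat) set" where
  "bandwidth_pairs n = {(1, n - 1), (n - 1, 1)} \<union> {2..n - 1} \<times> {2..n - 1}"

text \<open>Oscillatory matrices are nonsingular, so \<^const>\<open>mat_inverse\<close> returns \<^const>\<open>Some\<close> of
  the inverse here.\<close>

definition sym_oscillatory :: "nat \<Rightarrow> nat \<Rightarrow> nat \<Rightarrow> real mat set" where
  "sym_oscillatory n p q = {A \<in> carrier_mat n n. A\<^sup>T = A \<and> oscillatory A \<and>
     bandwidth A = p \<and> bandwidth (the (mat_inverse A)) = q}"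

text \<open>Rows and columns of matrices are numbered from 0, whereas the arguments \<open>i\<close>, \<open>j\<close> of the
  matrix units and of the elementary factors are numbered from 1.\<close>

definition matrix_unit :: "nat \<Rightarrow> nat \<Rightarrow> nat \<Rightarrow> real mat" where
  "matrix_unit n i j = mat n n (\<lambda>(r, c). if r + 1 = i \<and> c + 1 = j then 1 else 0)"

definition elem_upper :: "nat \<Rightarrow> nat \<Rightarrow> real \<Rightarrow> real mat" where
  "elem_upper n i a = 1\<^sub>m n + a \<cdot>\<^sub>m matrix_unit n i (i + 1)"

definition word_upper :: "nat \<Rightarrow> nat list \<Rightarrow> real list \<Rightarrow> real mat" where
  "word_upper n w as = foldr (*) (map2 (elem_upper n) w as) (1\<^sub>m n)"

definition positive_diagonal :: "nat \<Rightarrow> real mat \<Rightarrow> bool" where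
  "positive_diagonal n D \<longleftrightarrow>
     D \<in> carrier_mat n n \<and> diagonal_mat D \<and> (\<forall>i<n. D $$ (i, i) > 0)"

text \<open>The word \<open>(n-1, n-2, \<dots>, n-q+1, 1, 2, \<dots>, p)\<close>.\<close>

definition extremal_word :: "nat \<Rightarrow> nat \<Rightarrow> nat \<Rightarrow> nat list" where
  "extremal_word n p q = rev [n - q + 1..<n] @ [1..<p + 1]"

text \<open>\<open>v\<close> is the maximum of \<open>f\<close> over a possibly infinite set \<open>S\<close>; in particular it is
  attained.\<close>

definition is_maximum :: "('a \<Rightarrow> nat) \<Rightarrow> 'a set \<Rightarrow> nat \<Rightarrow> bool" where
  "is_maximum f S v \<longleftrightarrow> v \<in> f ` S \<and> (\<forall>x\<in>S. f x \<le> v)"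

end

theory Submission
  imports Defs "HOL-Library.Sublist"
begin

text \<open>
  By Whitney reduction a symmetric nonsingular totally nonnegative matrix factors as
  \<open>U\<^sup>T * D * U\<close> with \<open>U\<close> a product of elementary factors along a word \<open>w\<close>.  Positivity of
  the minors of its powers then only depends on \<open>w\<close>: the minor with rows \<open>I\<close> and columns \<open>J\<close> of the
  \<open>m\<close>-th power is positive iff particles sitting at \<open>I\<close> can reach \<open>J\<close> in \<open>m\<close> rounds, where the letter \<open>i\<close>
  lets a particle hop between the \<open>i\<close>-th and the next position if the target is free; in every round the
  particles first move down along the reversed word and then up along the word.  Choosing one
  occurrence of every letter in \<open>w\<close> and letting \<open>H(l)\<close> count the letters \<open>2 \<le> j \<le> l\<close> that occur before
  their predecessors \<open>j - 1\<close>, the greedy motion gives \<open>e\<^sub>k \<le> k + H(n - k) - H(k)\<close>, with equality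
  if every letter occurs only once.  The \<open>H\<close>-terms cancel in the sum over \<open>k\<close>, which yields \<open>n choose 2\<close>.
  The bandwidths \<open>p\<close>, \<open>q\<close> are the largest distances that a single particle, respectively a single hole,
  covers in one round; hence \<open>w\<close> contains an ascending run of \<open>p\<close> and a descending run of \<open>q\<close> letters,
  and these force \<open>e\<^sub>k \<le> min (max k (n - p)) (max (n - k) (n - q))\<close>.  For the extremal word this is an
  equality: beyond position \<open>p + 1\<close> the leading particle advances one step per round, the leading hole
  is slow in the same way, and letter \<open>k\<close> acts at most once per round on the \<open>k\<close> lowest particles.
\<close>

subsection \<open>Minors\<close>

text \<open>An elementary factor adds a multiple of a column to its neighbour, and replacing one
  index of a minor by an adjacent free one keeps the order. So every minor becomes a sum of minors
  with nonnegative coefficients, nothing cancels, and the parameters cannot influence positivity.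
  The word of a given matrix may repeat letters; upper bounds survive because any choice of one
  occurrence per letter is allowed, and a run forced by a bandwidth is exploited by choosing its
  occurrences. The inverse enters through its adjugate: up to sign and a scalar its entries are
  minors of order \<open>n - 1\<close>, that is, configurations with a single hole. Since a round
  goes down and then up, only climbs from the packed configuration on the \<open>k\<close> lowest
  positions have to be timed. Such a climb ensures the value \<open>m + H(k) - H(l)\<close> at
  \<open>l\<close> after \<open>m\<close> rounds unless the target is already reached there. A
  target of \<open>k\<close> particles has value at most \<open>min k (n - l)\<close>; the two caps
  meet at \<open>l = n - k\<close>, which is the origin of
  \<open>k + H(n - k) - H(k)\<close>.\<close>

definition mdet :: "real mat \<Rightarrow> nat \<Rightarrow> (nat \<Rightarrow> nat) \<Rightarrow> (nat \<Rightarrow> nat) \<Rightarrow> real" where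
  "mdet M k r c = det (mat k k (\<lambda>(a, b). M $$ (r a, c b)))"

text \<open>Index maps are plain functions so that exchanging one column of a minor is an update
  \<open>c(b := x)\<close>, even when the result repeats an index or is out of order;
  \<open>idx\<close> singles out the increasing ones and ignores arguments from \<open>k\<close>
  on.\<close>

definition idx :: "nat \<Rightarrow> nat \<Rightarrow> (nat \<Rightarrow> nat) \<Rightarrow> bool" where
  "idx n k c \<longleftrightarrow> strict_mono_on {..<k} c \<and> c ` {..<k} \<subseteq> {..<n}"

definition minor :: "real mat \<Rightarrow> nat set \<Rightarrow> nat set \<Rightarrow> real" where
  "minor M I J = mdet M (card I) (pick I) (pick J)"

lemma mdet_cong:
  assumes "\<And>a b. a < k \<Longrightarrow> b < k \<Longrightarrow> M $$ (r a, c b) = M' $$ (r' a, c' b)"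
  shows "mdet M k r c = mdet M' k r' c'"
  unfolding mdet_def by (rule arg_cong[where f = det]) (auto simp: assms)

lemma idx_less: "idx n k c \<Longrightarrow> a < b \<Longrightarrow> b < k \<Longrightarrow> c a < c b"
  by (auto simp: idx_def strict_mono_on_def)

lemma idx_bound: "idx n k c \<Longrightarrow> a < k \<Longrightarrow> c a < n"
  by (auto simp: idx_def)

lemma idx_inj: "idx n k c \<Longrightarrow> inj_on c {..<k}"
  by (auto simp: idx_def strict_mono_on_imp_inj_on)

lemma idxI:
  assumes "\<And>a b. a < b \<Longrightarrow> b < k \<Longrightarrow> c a < c b" "\<And>a. a < k \<Longrightarrow> c a < n"
  shows "idx n k c"
  using assms by (auto simp: idx_def strict_mono_on_def)

lemma pick_image:
  assumes "idx n k c" "b < k"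
  shows "pick (c ` {..<k}) b = c b"
proof -
  have "{a \<in> c ` {..<k}. a < c b} = c ` {..<b}"
  proof (intro equalityI subsetI)
    fix x assume "x \<in> {a \<in> c ` {..<k}. a < c b}"
    then obtain a where a: "a < k" "x = c a" "c a < c b" by auto
    have "a < b"
    proof (rule ccontr)
      assume "\<not> a < b"
      then have "b = a \<or> b < a" by auto
      with a idx_less[OF assms(1), of b a] show False by auto
    qed
    with a show "x \<in> c ` {..<b}" by auto
  next
    fix x assume "x \<in> c ` {..<b}"
    with assms show "x \<in> {a \<in> c ` {..<k}. a < c b}" by (auto intro: idx_less)
  qed
  moreover have "card (c ` {..<b}) = b"
    using idx_inj[OF assms(1)] assms(2) by (subst card_image) (auto intro: inj_on_subset)
  ultimately show ?thesis
    using pick_card_in_set[of "c b" "c ` {..<k}"] assms(2) by auto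
qed

lemma idx_pick:
  assumes "J \<subseteq> {..<n}"
  shows "idx n (card J) (pick J)"
proof (rule idxI)
  fix a b assume "a < b" "b < card J"
  then show "pick J a < pick J b" by (rule pick_mono_le[rotated])
next
  fix a assume "a < card J"
  then show "pick J a < n" using assms pick_in_set_le by blast
qed

lemma pick_onto:
  assumes "J \<subseteq> {..<n}"
  shows "pick J ` {..<card J} = J"
proof -
  have "card (pick J ` {..<card J}) = card J"
    by (simp add: card_image idx_inj[OF idx_pick[OF assms]])
  moreover have "pick J ` {..<card J} \<subseteq> J" using pick_in_set_le by blast
  ultimately show ?thesis using assms by (meson card_subset_eq finite_lessThan finite_subset)
qed

lemma card_image_idx: "idx n k c \<Longrightarrow> card (c ` {..<k}) = k"
  by (simp add: card_image idx_inj)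

lemma minor_image:
  assumes "idx n k r" "idx n k c"
  shows "minor M (r ` {..<k}) (c ` {..<k}) = mdet M k r c"
  unfolding minor_def card_image_idx[OF assms(1)]
  using assms by (intro mdet_cong) (simp add: pick_image)

lemma minor_submatrix:
  assumes "M \<in> carrier_mat n n" "I \<subseteq> {..<n}" "J \<subseteq> {..<n}" "card J = card I"
  shows "det (submatrix M I J) = minor M I J"
proof -
  have "{i. i < n \<and> i \<in> I} = I" "{i. i < n \<and> i \<in> J} = J" using assms by auto
  with assms show ?thesis by (simp add: submatrix_def minor_def mdet_def)
qed

section \<open>Elementary and diagonal factors acting on minors\<close>

lemma det_col_linear:
  fixes F G H :: "nat \<Rightarrow> nat \<Rightarrow> real"
  assumes b: "b < k"
    and "\<And>i j. i < k \<Longrightarrow> j < k \<Longrightarrow> j \<noteq> b \<Longrightarrow> G i j = F i j"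
    and "\<And>i j. i < k \<Longrightarrow> j < k \<Longrightarrow> j \<noteq> b \<Longrightarrow> H i j = F i j"
    and "\<And>i. i < k \<Longrightarrow> F i b = G i b + x * H i b"
  shows "det (mat k k (\<lambda>(i, j). F i j)) =
    det (mat k k (\<lambda>(i, j). G i j)) + x * det (mat k k (\<lambda>(i, j). H i j))"
proof -
  have 1: "mat_delete (mat k k (\<lambda>(i, j). G i j)) i b = mat_delete (mat k k (\<lambda>(i, j). F i j)) i b"
    "mat_delete (mat k k (\<lambda>(i, j). H i j)) i b = mat_delete (mat k k (\<lambda>(i, j). F i j)) i b"
    if "i < k" for i
    using that b assms(2,3) by (auto simp: mat_delete_def intro!: eq_matI)
  show ?thesis
    by (simp add: laplace_expansion_column[OF _ b] cofactor_def 1 assms(4) b algebra_simps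
        sum.distrib sum_distrib_left)
qed

lemma mdet_col_repeated:
  assumes "a < k" "b < k" "a \<noteq> b" "c a = c b"
  shows "mdet M k r c = 0"
  unfolding mdet_def
  by (rule det_identical_columns[of _ k a b]) (use assms in \<open>auto intro!: eq_vecI\<close>)

text \<open>\<open>y = Suc x\<close> gives the upper factors and \<open>x = Suc y\<close> their
  transposes, so one computation serves both triangular parts. Positions count from 0, hence
  \<open>elem_upper n i a\<close> is \<open>eadd n (i - 1) i a\<close>.\<close>

definition eadd :: "nat \<Rightarrow> nat \<Rightarrow> nat \<Rightarrow> real \<Rightarrow> real mat" where
  "eadd n x y a = mat n n (\<lambda>(r, c). (if r = c then 1 else 0) + (if r = x \<and> c = y then a else 0))"

lemma eadd_carrier[simp]: "eadd n x y a \<in> carrier_mat n n"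
  by (simp add: eadd_def)

lemma mult_eadd_index:
  assumes "M \<in> carrier_mat n n" "x < n" "y < n" "r < n" "c < n"
  shows "(M * eadd n x y a) $$ (r, c) = M $$ (r, c) + (if c = y then a * M $$ (r, x) else 0)"
proof -
  have "(M * eadd n x y a) $$ (r, c) = (\<Sum>i\<in>{0..<n}. M $$ (r, i) *
      ((if i = c then 1 else 0) + (if i = x \<and> c = y then a else 0)))"
    using assms by (simp add: scalar_prod_def eadd_def)
  also have "\<dots> = (\<Sum>i\<in>{0..<n}. (if i = c then M $$ (r, i) else 0) +
      (if i = x then (if c = y then M $$ (r, i) * a else 0) else 0))"
    by (intro sum.cong) (auto simp: algebra_simps)
  also have "\<dots> = M $$ (r, c) + (if c = y then a * M $$ (r, x) else 0)"
    using assms by (auto simp: sum.distrib)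
  finally show ?thesis .
qed

lemma transpose_eadd: "(eadd n x y a)\<^sup>T = eadd n y x a"
  by (auto simp: eadd_def intro!: eq_matI)

lemma mdet_eadd_other:
  assumes "M \<in> carrier_mat n n" "x < n" "y < n" "idx n k r" "idx n k c" "y \<notin> c ` {..<k}"
  shows "mdet (M * eadd n x y a) k r c = mdet M k r c"
  using assms by (intro mdet_cong) (auto simp: mult_eadd_index idx_bound simp del: index_mult_mat)

lemma mdet_eadd:
  assumes "M \<in> carrier_mat n n" "x < n" "y < n" "idx n k r" "idx n k c" "b < k" "c b = y"
  shows "mdet (M * eadd n x y a) k r c = mdet M k r c + a * mdet M k r (c(b := x))"
proof -
  have "c j \<noteq> y" if "j < k" "j \<noteq> b" for j
    using inj_onD[OF idx_inj[OF assms(5)], of j b] assms(6,7) that by auto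
  then show ?thesis
    unfolding mdet_def
    by (intro det_col_linear[OF assms(6)])
      (use assms in \<open>auto simp: mult_eadd_index idx_bound simp del: index_mult_mat\<close>)
qed

lemma idx_upd:
  assumes "idx n k c" "b < k" "x < n" "\<And>a. a < b \<Longrightarrow> c a < x" "\<And>a. b < a \<Longrightarrow> a < k \<Longrightarrow> x < c a"
  shows "idx n k (c(b := x))"
  using assms by (intro idxI) (auto simp: idx_less idx_bound)

lemma idx_upd_adjacent:
  assumes "idx n k c" "b < k" "c b = y" "y = Suc x \<or> x = Suc y" "x < n" "x \<notin> c ` {..<k}"
  shows "idx n k (c(b := x))"
proof (rule idx_upd[OF assms(1,2,5)])
  fix a assume "a < b"
  with assms(2) have "c a < y" "c a \<noteq> x" using idx_less[OF assms(1)] assms(3,6) by auto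
  with assms(4) show "c a < x" by auto
next
  fix a assume "b < a" "a < k"
  then have "y < c a" "c a \<noteq> x" using idx_less[OF assms(1)] assms(3,6) by auto
  with assms(4) show "x < c a" by auto
qed

text \<open>Multilinearity in column \<open>y\<close> leaves one extra determinant, with
  \<open>y\<close> replaced by \<open>x\<close>. It has a repeated column if \<open>x\<close> is
  chosen too; otherwise adjacency of \<open>x\<close> and \<open>y\<close> keeps the columns sorted,
  so no sign appears. This is the hop of a particle.\<close>

lemma minor_eadd:
  assumes "M \<in> carrier_mat n n" "x < n" "y < n" "y = Suc x \<or> x = Suc y"
    "I \<subseteq> {..<n}" "J \<subseteq> {..<n}" "card I = card J"
  shows "minor (M * eadd n x y a) I J =
    minor M I J + (if y \<in> J \<and> x \<notin> J then a * minor M I (insert x (J - {y})) else 0)"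
proof -
  define k where "k = card J"
  define r where "r = pick I"
  define c where "c = pick J"
  have r: "idx n k r" and c: "idx n k c"
    using idx_pick[OF assms(5)] idx_pick[OF assms(6)] by (auto simp: k_def r_def c_def assms(7))
  have cJ: "c ` {..<k} = J" using pick_onto[OF assms(6)] by (simp add: c_def k_def)
  have rI: "r ` {..<k} = I" using pick_onto[OF assms(5)] by (simp add: r_def k_def assms(7))
  have M: "minor N I J = mdet N k r c" for N by (simp add: minor_def k_def r_def c_def assms(7))
  show ?thesis
  proof (cases "y \<in> J")
    case False
    then show ?thesis using mdet_eadd_other[OF assms(1-3) r c] by (simp add: M cJ)
  next
    case True
    then obtain b where b: "b < k" "c b = y" using cJ by auto
    note E = mdet_eadd[OF assms(1-3) r c b]
    show ?thesis
    proof (cases "x \<in> J")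
      case True
      then obtain a where "a < k" "c a = x" using cJ by auto
      then have "mdet M k r (c(b := x)) = 0"
        using b assms(4) by (intro mdet_col_repeated[of a k b]) auto
      with True E show ?thesis by (simp add: M)
    next
      case False
      have i: "idx n k (c(b := x))"
        by (rule idx_upd_adjacent[OF c b assms(4,2)]) (use False cJ in auto)
      have "(c(b := x)) ` {..<k} = insert x (J - {y})"
        using b idx_inj[OF c] by (auto simp: cJ[symmetric] inj_on_def image_iff)
      then have "mdet M k r (c(b := x)) = minor M I (insert x (J - {y}))"
        using minor_image[OF r i, of M] by (simp add: rI)
      with False True E show ?thesis by (simp add: M)
    qed
  qed
qed

lemma minor_diagonal:
  assumes "M \<in> carrier_mat n n" "positive_diagonal n D" "I \<subseteq> {..<n}" "J \<subseteq> {..<n}" "card I = card J"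
  obtains d where "d > 0" "minor (M * D) I J = d * minor M I J"
proof
  define k where "k = card J"
  define c where "c = pick J"
  have r: "idx n k (pick I)" and c: "idx n k c"
    using idx_pick[OF assms(3)] idx_pick[OF assms(4)] by (auto simp: k_def c_def assms(5))
  have D: "D \<in> carrier_mat n n" "\<And>i j. i < n \<Longrightarrow> j < n \<Longrightarrow> i \<noteq> j \<Longrightarrow> D $$ (i, j) = 0"
    "\<And>i. i < n \<Longrightarrow> D $$ (i, i) > 0"
    using assms(2) by (auto simp: positive_diagonal_def diagonal_mat_def)
  define E :: "real mat" where "E = mat k k (\<lambda>(i, j). if i = j then D $$ (c j, c j) else 0)"
  have MD: "(M * D) $$ (i, j) = M $$ (i, j) * D $$ (j, j)" if "i < n" "j < n" for i j
  proof -
    have "(M * D) $$ (i, j) = (\<Sum>l\<in>{0..<n}. M $$ (i, l) * D $$ (l, j))"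
      using that assms(1) D(1) by (simp add: scalar_prod_def)
    also have "\<dots> = (\<Sum>l\<in>{0..<n}. if l = j then M $$ (i, l) * D $$ (l, j) else 0)"
      using D(2) that by (intro sum.cong) auto
    finally show ?thesis using that by simp
  qed
  have *: "mat k k (\<lambda>(a, b). (M * D) $$ (pick I a, c b)) = mat k k (\<lambda>(a, b). M $$ (pick I a, c b)) * E"
  proof (rule eq_matI)
    fix i j assume "i < dim_row (mat k k (\<lambda>(a, b). M $$ (pick I a, c b)) * E)"
      "j < dim_col (mat k k (\<lambda>(a, b). M $$ (pick I a, c b)) * E)"
    then have ij: "i < k" "j < k" by (auto simp: E_def)
    have "(mat k k (\<lambda>(a, b). M $$ (pick I a, c b)) * E) $$ (i, j) =
        (\<Sum>l\<in>{0..<k}. M $$ (pick I i, c l) * (if l = j then D $$ (c j, c j) else 0))"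
      using ij by (simp add: scalar_prod_def E_def)
    also have "\<dots> = (\<Sum>l\<in>{0..<k}. if l = j then M $$ (pick I i, c l) * D $$ (c j, c j) else 0)"
      by (intro sum.cong) auto
    finally show "mat k k (\<lambda>(a, b). (M * D) $$ (pick I a, c b)) $$ (i, j) =
        (mat k k (\<lambda>(a, b). M $$ (pick I a, c b)) * E) $$ (i, j)"
      using ij r c by (simp add: MD idx_bound del: index_mult_mat)
  qed (auto simp: E_def)
  have E: "det E = prod_list (diag_mat E)"
    by (rule det_upper_triangular[of _ k]) (auto simp: E_def)
  show "minor (M * D) I J = det E * minor M I J"
    unfolding minor_def mdet_def c_def[symmetric] assms(5) k_def[symmetric] *
    by (subst det_mult[of _ k]) (auto simp: E_def)
  show "det E > 0" unfolding E prod_list_diag_prod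
    by (rule prod_pos) (auto simp: E_def intro!: D(3) idx_bound[OF c])
qed

lemma minor_one:
  assumes "I \<subseteq> {..<n}" "J \<subseteq> {..<n}" "card I = card J"
  shows "minor (1\<^sub>m n) I J = (if I = J then 1 else 0)"
proof -
  define k where "k = card J"
  have r: "idx n k (pick I)" and c: "idx n k (pick J)"
    using idx_pick[OF assms(1)] idx_pick[OF assms(2)] by (auto simp: k_def assms(3))
  show ?thesis
  proof (cases "I = J")
    case True
    have "mat k k (\<lambda>(a, b). 1\<^sub>m n $$ (pick I a, pick J b)) = (1\<^sub>m k :: real mat)"
      using inj_onD[OF idx_inj[OF c]] by (auto intro!: eq_matI simp: True idx_bound[OF c])
    then show ?thesis using True by (simp add: minor_def mdet_def k_def)
  next
    case False
    have "finite J" using assms(2) finite_subset by blast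
    with False assms(3) have "\<not> I \<subseteq> J" using card_subset_eq by blast
    then obtain i where i: "i \<in> I" "i \<notin> J" by auto
    then obtain a where a: "a < k" "pick I a = i"
      using pick_onto[OF assms(1)] by (metis assms(3) image_iff k_def lessThan_iff)
    have "1\<^sub>m n $$ (i, pick J b) = (0 :: real)" if "b < k" for b
      using that i pick_onto[OF assms(2)] idx_bound[OF c] idx_bound[OF r a(1)] a k_def by auto
    then have "mdet (1\<^sub>m n) k (pick I) (pick J) = 0"
      unfolding mdet_def by (subst laplace_expansion_row[of _ k a]) (use a in auto)
    then show ?thesis using False by (simp add: minor_def k_def assms(3))
  qed
qed

lemma minor_transpose:
  assumes "M \<in> carrier_mat n n" "I \<subseteq> {..<n}" "J \<subseteq> {..<n}" "card I = card J"
  shows "minor M\<^sup>T I J = minor M J I"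
proof -
  define k where "k = card J"
  have r: "idx n k (pick I)" and c: "idx n k (pick J)"
    using idx_pick[OF assms(2)] idx_pick[OF assms(3)] by (auto simp: k_def assms(4))
  have "mat k k (\<lambda>(a, b). M\<^sup>T $$ (pick I a, pick J b)) =
    (mat k k (\<lambda>(a, b). M $$ (pick J a, pick I b)))\<^sup>T"
    using assms(1) by (auto intro!: eq_matI simp: idx_bound[OF c] idx_bound[OF r])
  then show ?thesis
    by (simp add: minor_def mdet_def assms(4) k_def det_transpose[of _ k])
qed

subsection \<open>Whitney reduction\<close>

definition TN :: "nat \<Rightarrow> real mat \<Rightarrow> bool" where
  "TN n M \<longleftrightarrow> M \<in> carrier_mat n n \<and>
     (\<forall>k r c. idx n k r \<longrightarrow> idx n k c \<longrightarrow> mdet M k r c \<ge> 0)"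

lemma TN_carrier: "TN n M \<Longrightarrow> M \<in> carrier_mat n n"
  by (simp add: TN_def)

lemma TN_mdet: "TN n M \<Longrightarrow> idx n k r \<Longrightarrow> idx n k c \<Longrightarrow> mdet M k r c \<ge> 0"
  by (simp add: TN_def)

lemma mdet_col_expand:
  assumes "b < Suc l"
  shows "mdet M (Suc l) r c = (\<Sum>a<Suc l. M $$ (r a, c b) * ((-1) ^ (a + b) *
    mdet M l (r \<circ> insert_index a) (c \<circ> insert_index b)))"
proof -
  have "det (mat_delete (mat (Suc l) (Suc l) (\<lambda>(a, b). M $$ (r a, c b))) a b) =
    mdet M l (r \<circ> insert_index a) (c \<circ> insert_index b)" if "a < Suc l" for a
    unfolding mdet_def by (rule arg_cong[where f = det])
      (use assms that in \<open>auto simp: mat_delete_def insert_index_def\<close>)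
  with assms show ?thesis
    unfolding mdet_def[of M "Suc l"]
    by (subst laplace_expansion_column[OF _ assms]) (auto simp: cofactor_def intro!: sum.cong)
qed

lemma mdet_row_expand:
  assumes "a < Suc l"
  shows "mdet M (Suc l) r c = (\<Sum>b<Suc l. M $$ (r a, c b) * ((-1) ^ (a + b) *
    mdet M l (r \<circ> insert_index a) (c \<circ> insert_index b)))"
proof -
  have "det (mat_delete (mat (Suc l) (Suc l) (\<lambda>(a, b). M $$ (r a, c b))) a b) =
    mdet M l (r \<circ> insert_index a) (c \<circ> insert_index b)" if "b < Suc l" for b
    unfolding mdet_def by (rule arg_cong[where f = det])
      (use assms that in \<open>auto simp: mat_delete_def insert_index_def\<close>)
  with assms show ?thesis
    unfolding mdet_def[of M "Suc l"]
    by (subst laplace_expansion_row[OF _ assms]) (auto simp: cofactor_def intro!: sum.cong)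
qed

lemma mdet_col_sum:
  assumes b: "b < k" and j: "\<And>a. a < k \<Longrightarrow> M $$ (r a, j) = (\<Sum>m\<in>S. x m * M $$ (r a, d m))"
  shows "mdet M k r (c(b := j)) = (\<Sum>m\<in>S. x m * mdet M k r (c(b := d m)))"
proof -
  obtain l where k: "k = Suc l" using b by (cases k) auto
  have *: "mdet M l r' (c(b := y) \<circ> insert_index b) = mdet M l r' (c \<circ> insert_index b)" for r' y
    by (rule mdet_cong) (simp add: insert_index_def)
  have e: "mdet M k r (c(b := y)) = (\<Sum>a<k. M $$ (r a, y) * ((-1) ^ (a + b) *
      mdet M l (r \<circ> insert_index a) (c \<circ> insert_index b)))" for y
    using b unfolding k by (simp add: mdet_col_expand * del: sum.lessThan_Suc)
  have "mdet M k r (c(b := j)) = (\<Sum>a<k. \<Sum>m\<in>S. x m * (M $$ (r a, d m) * ((-1) ^ (a + b) *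
      mdet M l (r \<circ> insert_index a) (c \<circ> insert_index b))))"
    unfolding e by (intro sum.cong) (auto simp: j sum_distrib_right mult.assoc)
  also have "\<dots> = (\<Sum>m\<in>S. x m * mdet M k r (c(b := d m)))"
    by (subst sum.swap) (simp add: e sum_distrib_left)
  finally show ?thesis .
qed

lemma mdet_swap_cols:
  assumes "a < k" "b < k" "a \<noteq> b"
  shows "mdet M k r (c(a := x, b := y)) = - mdet M k r (c(a := y, b := x))"
proof -
  have "mat k k (\<lambda>(i, j). M $$ (r i, (c(a := x, b := y)) j)) =
    swapcols a b (mat k k (\<lambda>(i, j). M $$ (r i, (c(a := y, b := x)) j)))"
    using assms by (auto simp: mat_swapcols_def intro!: eq_matI)
  then show ?thesis
    unfolding mdet_def using assms by (simp add: det_swapcols[of _ k])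
qed

text \<open>The selected square block is invertible, so its adjugate yields the coefficients that
  express column \<open>j\<close>, restricted to the selected rows, through the selected
  columns.\<close>

lemma mdet_solve:
  assumes "mdet M k r c \<noteq> 0"
  obtains x where "\<And>a. a < k \<Longrightarrow> M $$ (r a, j) = (\<Sum>m<k. x m * M $$ (r a, c m))"
proof -
  define N where "N = mat k k (\<lambda>(a, b). M $$ (r a, c b))"
  define v where "v = vec k (\<lambda>a. M $$ (r a, j))"
  define y where "y = (1 / det N) \<cdot>\<^sub>v (adj_mat N *\<^sub>v v)"
  have N: "N \<in> carrier_mat k k" and v: "v \<in> carrier_vec k" by (auto simp: N_def v_def)
  note adj = adj_mat[OF N]
  have y: "y \<in> carrier_vec k" using adj(1) v by (auto simp: y_def)
  have "N *\<^sub>v y = (1 / det N) \<cdot>\<^sub>v (N *\<^sub>v (adj_mat N *\<^sub>v v))"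
    unfolding y_def using N adj(1) v by (intro mult_mat_vec) auto
  also have "N *\<^sub>v (adj_mat N *\<^sub>v v) = (N * adj_mat N) *\<^sub>v v"
    using N adj(1) v by simp
  also have "\<dots> = det N \<cdot>\<^sub>v v" unfolding adj(2) using v by auto
  finally have "N *\<^sub>v y = v"
    using assms v by (simp add: N_def[symmetric] mdet_def smult_smult_assoc)
  then have "M $$ (r a, j) = (\<Sum>m<k. y $ m * M $$ (r a, c m))" if "a < k" for a
  proof -
    have "M $$ (r a, j) = (N *\<^sub>v y) $ a" using \<open>N *\<^sub>v y = v\<close> that by (simp add: v_def)
    also have "\<dots> = (\<Sum>m\<in>{0..<k}. N $$ (a, m) * y $ m)"
      using that N y by (simp add: scalar_prod_def)
    also have "\<dots> = (\<Sum>m<k. y $ m * M $$ (r a, c m))"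
      unfolding atLeast0LessThan by (intro sum.cong) (use that in \<open>auto simp: N_def\<close>)
    finally show ?thesis .
  qed
  then show thesis by (rule that)
qed

lemma idx_insert_index:
  assumes "idx n (Suc l) c"
  shows "idx n l (c \<circ> insert_index a)"
  using assms by (intro idxI) (auto simp: insert_index_def idx_less idx_bound)

text \<open>Subtracting a multiple of column \<open>i\<close> from column \<open>i + 1\<close> so as to kill the last nonzero entry
  of row \<open>\<rho>\<close> keeps all minors nonnegative.  Induction on the slot \<open>b\<close> of column \<open>i\<close>: deleting slot
  \<open>b - 1\<close> and a suitable row keeps the minor positive, and expressing column \<open>i + 1\<close> in terms of the
  columns of the minor compares the two quotients.\<close>

lemma whitney_inequality:
  assumes A: "TN n A" and i: "\<rho> \<le> i" "Suc i < n"
    and z: "\<And>t. Suc i < t \<Longrightarrow> t < n \<Longrightarrow> A $$ (\<rho>, t) = 0"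
    and z': "\<And>s t. s < \<rho> \<Longrightarrow> s < t \<Longrightarrow> t < n \<Longrightarrow> A $$ (s, t) = 0"
    and pos: "A $$ (\<rho>, i) > 0"
    and "idx n k r" "idx n k c" "b < k" "c b = i" "idx n k (c(b := Suc i))"
  shows "A $$ (\<rho>, Suc i) / A $$ (\<rho>, i) * mdet A k r c \<le> mdet A k r (c(b := Suc i))"
  using assms(7-11)
proof (induction b arbitrary: k r c)
  case 0
  note r = 0(1) and c = 0(2) and cj = 0(5)
  obtain l where k: "k = Suc l" using 0 by (cases k) auto
  have gt: "c m > Suc i" "c m < n" if "m < k" "m > 0" for m
    using idx_less[OF cj, of 0 m] idx_bound[OF c, of m] that by auto
  \<comment> \<open>Every other selected column lies beyond \<open>i + 1\<close>. A row above
    \<open>\<rho>\<close> vanishes on all selected columns. Row \<open>\<rho>\<close> itself has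
    only its first selected entry, so both minors share a cofactor. If all rows lie below
    \<open>\<rho>\<close>, row \<open>\<rho>\<close> and column \<open>i\<close> are adjoined, and
    the larger minor has only two terms along row \<open>\<rho>\<close>.\<close>
  consider "r 0 < \<rho>" | "r 0 = \<rho>" | "r 0 > \<rho>" by linarith
  then show ?case
  proof cases
    case 1
    have "A $$ (r 0, c m) = 0" if "m < k" for m
    proof (cases "m = 0")
      case True
      then show ?thesis using 1 0(4) i z'[of "r 0" i] by auto
    next
      case False
      then show ?thesis using 1 gt[OF that] i z'[of "r 0" "c m"] by auto
    qed
    then have "mdet A k r c = 0"
      unfolding k by (subst mdet_row_expand[of 0]) (auto simp del: sum.lessThan_Suc)
    then show ?thesis using TN_mdet[OF A r cj] by simp
  next
    case 2
    have *: "mdet A k r d = A $$ (\<rho>, d 0) * mdet A l (r \<circ> Suc) (c \<circ> Suc)"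
      if "\<And>m. m > 0 \<Longrightarrow> d m = c m" for d
    proof -
      have "mdet A k r d = (\<Sum>b<Suc l. A $$ (r 0, d b) * ((-1) ^ (0 + b) *
          mdet A l (r \<circ> insert_index 0) (d \<circ> insert_index b)))"
        unfolding k by (rule mdet_row_expand) simp
      also have "\<dots> = (\<Sum>b\<in>{0}. A $$ (r 0, d b) * ((-1) ^ (0 + b) *
          mdet A l (r \<circ> insert_index 0) (d \<circ> insert_index b)))"
        by (rule sum.mono_neutral_right) (use 2 that gt z k in auto)
      also have "\<dots> = A $$ (\<rho>, d 0) * mdet A l (r \<circ> Suc) (c \<circ> Suc)"
        using 2 that by (simp add: insert_index_def o_def)
      finally show ?thesis .
    qed
    have "mdet A k r c = A $$ (\<rho>, i) * mdet A l (r \<circ> Suc) (c \<circ> Suc)"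
      using *[of c] 0(4) by simp
    moreover have "mdet A k r (c(0 := Suc i)) = A $$ (\<rho>, Suc i) * mdet A l (r \<circ> Suc) (c \<circ> Suc)"
      by (subst *) auto
    ultimately show ?thesis using pos by (simp del: fun_upd_apply)
  next
    case 3
    define r' where "r' = case_nat \<rho> r"
    define c' where "c' = case_nat i (c(0 := Suc i))"
    have r': "idx n (Suc k) r'"
    proof (rule idxI)
      fix a b assume "a < b" "b < Suc k"
      moreover have "\<rho> < r m" if "m < k" for m using idx_less[OF r, of 0 m] 3 that by (cases m) auto
      ultimately show "r' a < r' b" using idx_less[OF r]
        by (auto simp: r'_def split: nat.split)
    next
      fix a assume "a < Suc k"
      then show "r' a < n" using idx_bound[OF r] i by (auto simp: r'_def split: nat.split)
    qed
    have c': "idx n (Suc k) c'"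
    proof (rule idxI)
      fix a b assume ab: "a < b" "b < Suc k"
      then obtain m where b: "b = Suc m" "m < k" by (cases b) auto
      have "i < (c(0 := Suc i)) m" using gt[OF b(2)] by auto
      with ab b show "c' a < c' b" using idx_less[OF cj, of _ m]
        by (cases a) (auto simp: c'_def simp del: fun_upd_apply)
    next
      fix a assume "a < Suc k"
      then show "c' a < n" using idx_bound[OF cj] i by (auto simp: c'_def split: nat.split)
    qed
    have "0 \<le> mdet A (Suc k) r' c'" by (rule TN_mdet[OF A r' c'])
    also have "\<dots> = (\<Sum>b<Suc k. A $$ (r' 0, c' b) * ((-1) ^ (0 + b) *
        mdet A k (r' \<circ> insert_index 0) (c' \<circ> insert_index b)))"
      by (rule mdet_row_expand) simp
    also have "\<dots> = (\<Sum>b\<in>{0, 1}. A $$ (r' 0, c' b) * ((-1) ^ (0 + b) *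
        mdet A k (r' \<circ> insert_index 0) (c' \<circ> insert_index b)))"
    proof (rule sum.mono_neutral_right)
      show "\<forall>b\<in>{..<Suc k} - {0, 1}. A $$ (r' 0, c' b) * ((-1) ^ (0 + b) *
        mdet A k (r' \<circ> insert_index 0) (c' \<circ> insert_index b)) = 0"
      proof
        fix b assume "b \<in> {..<Suc k} - {0, 1}"
        then obtain m where "b = Suc m" "m > 0" "m < k" by (cases b) auto
        then show "A $$ (r' 0, c' b) * ((-1) ^ (0 + b) *
          mdet A k (r' \<circ> insert_index 0) (c' \<circ> insert_index b)) = 0"
          using z[of "c m"] gt[of m] by (simp add: r'_def c'_def)
      qed
    qed (use k in auto)
    finally have "0 \<le> A $$ (\<rho>, i) * mdet A k (r' \<circ> insert_index 0) (c' \<circ> insert_index 0) -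
        A $$ (\<rho>, Suc i) * mdet A k (r' \<circ> insert_index 0) (c' \<circ> insert_index 1)"
      by (simp add: r'_def c'_def)
    moreover have "mdet A k (r' \<circ> insert_index 0) (c' \<circ> insert_index 0) = mdet A k r (c(0 := Suc i))"
      by (rule mdet_cong) (simp add: r'_def c'_def insert_index_def)
    moreover have "mdet A k (r' \<circ> insert_index 0) (c' \<circ> insert_index 1) = mdet A k r c"
      by (rule mdet_cong) (use 0(4) in \<open>auto simp: r'_def c'_def insert_index_def split: nat.split\<close>)
    ultimately show ?thesis using pos by (simp add: field_simps del: fun_upd_apply)
  qed
next
  case (Suc s)
  define P where "P = mdet A k r c"
  define \<gamma> where "\<gamma> = A $$ (\<rho>, Suc i) / A $$ (\<rho>, i)"
  note r = Suc(2) and c = Suc(3) and cj = Suc(6)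
  have P0: "P \<ge> 0" unfolding P_def by (rule TN_mdet[OF A r c])
  show ?case
  proof (cases "P = 0")
    case True
    then show ?thesis using TN_mdet[OF A r cj] by (simp add: P_def)
  next
    case False
    with P0 have P: "P > 0" by simp
    obtain l where k: "k = Suc l" using Suc(4) by (cases k) auto
    have s: "s < k" "s < l" "Suc s < k" using Suc(4) k by auto
    \<comment> \<open>Dropping slot \<open>s\<close> moves column \<open>i\<close> from slot
      \<open>Suc s\<close> to slot \<open>s\<close>, where the induction hypothesis applies; a row
      to drop exists because the expansion of \<open>P > 0\<close> along slot \<open>s\<close>
      cannot vanish termwise.\<close>
    define c' where "c' = c \<circ> insert_index s"
    have "\<exists>a<Suc l. mdet A l (r \<circ> insert_index a) c' \<noteq> 0"
    proof (rule ccontr)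
      assume "\<not> ?thesis"
      then have "P = 0" using s(1) unfolding P_def k c'_def
        by (subst mdet_col_expand[of s]) (auto simp del: sum.lessThan_Suc)
      with P show False by simp
    qed
    then obtain a where a: "a < Suc l" "mdet A l (r \<circ> insert_index a) c' \<noteq> 0" by auto
    define r' where "r' = r \<circ> insert_index a"
    have r': "idx n l r'" and c': "idx n l c'"
      using idx_insert_index r c unfolding r'_def c'_def k by auto
    define Q where "Q = mdet A l r' c'"
    have Q: "Q > 0" using a(2) TN_mdet[OF A r' c'] unfolding Q_def r'_def by simp
    have c's: "c' s = i" using Suc(5) by (simp add: c'_def insert_index_def)
    have u: "(c(Suc s := Suc i)) \<circ> insert_index s = c'(s := Suc i)"
      by (auto simp: c'_def insert_index_def)
    have c'j: "idx n l (c'(s := Suc i))"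
      using idx_insert_index[OF cj[unfolded k], of s] unfolding u .
    have IH: "\<gamma> * Q \<le> mdet A l r' (c'(s := Suc i))"
      unfolding \<gamma>_def Q_def by (rule Suc(1)[OF r' c' s(2) c's c'j])
    obtain x where x: "\<And>a. a < k \<Longrightarrow> A $$ (r a, Suc i) = (\<Sum>m<k. x m * A $$ (r a, c m))"
      using mdet_solve[of A k r c "Suc i"] P unfolding P_def by auto
    have cramer: "mdet A k r (c(b := Suc i)) = x b * P" if b: "b < k" for b
    proof -
      have "mdet A k r (c(b := Suc i)) = (\<Sum>m<k. x m * mdet A k r (c(b := c m)))"
        by (rule mdet_col_sum[OF b x])
      also have "\<dots> = (\<Sum>m<k. if m = b then x m * P else 0)"
      proof (rule sum.cong[OF refl])
        fix m assume "m \<in> {..<k}"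
        then show "x m * mdet A k r (c(b := c m)) = (if m = b then x m * P else 0)"
          using mdet_col_repeated[of m k b "c(b := c m)"] b by (auto simp: P_def)
      qed
      finally show ?thesis using b by simp
    qed
    \<comment> \<open>By Cramer's rule this minor carries the columns \<open>i + 1, i\<close> in
      adjacent slots, one transposition away from sorted order; this determines the sign of
      \<open>x s\<close>.\<close>
    have "x s * P = mdet A k r (c(s := Suc i, Suc s := i))"
      using cramer[OF s(1)] Suc(5) by (metis fun_upd_triv fun_upd_twist n_not_Suc_n)
    also have "\<dots> = - mdet A k r (c(s := i, Suc s := Suc i))"
      by (rule mdet_swap_cols) (use s in auto)
    also have "\<dots> \<le> 0"
    proof -
      have "idx n k ((c(Suc s := Suc i))(s := i))"
      proof (rule idx_upd[OF cj s(1)])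
        show "i < n" using i by simp
        fix m assume "m < s"
        then show "(c(Suc s := Suc i)) m < i" using idx_less[OF c, of m "Suc s"] s Suc(5) by auto
      next
        fix m assume "s < m" "m < k"
        then show "i < (c(Suc s := Suc i)) m" using idx_less[OF c, of "Suc s" m] Suc(5) by auto
      qed
      then have "idx n k (c(s := i, Suc s := Suc i))" by (simp add: fun_upd_twist)
      from TN_mdet[OF A r this] show ?thesis by simp
    qed
    finally have xs: "x s \<le> 0" using P by (simp add: mult_le_0_iff)
    define R where "R = mdet A l r' (c'(s := c s))"
    have R: "R \<ge> 0" unfolding R_def
    proof (rule TN_mdet[OF A r' idx_upd[OF c' s(2)]])
      show "c s < n" using idx_bound[OF c s(1)] .
    qed (use s k in \<open>auto simp: c'_def insert_index_def intro!: idx_less[OF c]\<close>)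
    \<comment> \<open>The same coefficients expand the smaller minor: every \<open>c m\<close> other
      than \<open>c s\<close> and \<open>c (Suc s)\<close> already occurs in \<open>c'\<close>
      outside slot \<open>s\<close>. Since \<open>x s * R \<le> 0\<close>, the induction hypothesis
      forces \<open>\<gamma> \<le> x (Suc s)\<close>, and \<open>x (Suc s)\<close> is the quotient
      of minors in question.\<close>
    have "mdet A l r' (c'(s := Suc i)) = (\<Sum>m<k. x m * mdet A l r' (c'(s := c m)))"
    proof (rule mdet_col_sum[OF s(2)])
      fix a' assume "a' < l"
      then show "A $$ (r' a', Suc i) = (\<Sum>m<k. x m * A $$ (r' a', c m))"
        unfolding r'_def o_def by (intro x) (auto simp: k insert_index_def)
    qed
    also have "\<dots> = (\<Sum>m\<in>{s, Suc s}. x m * mdet A l r' (c'(s := c m)))"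
    proof (rule sum.mono_neutral_right)
      show "\<forall>m\<in>{..<k} - {s, Suc s}. x m * mdet A l r' (c'(s := c m)) = 0"
      proof
        fix m assume m: "m \<in> {..<k} - {s, Suc s}"
        define m' where "m' = delete_index s m"
        have "m' < l" "m' \<noteq> s" "c' m' = c m"
          using m s k by (auto simp: m'_def delete_index_def c'_def insert_index_def)
        then have "mdet A l r' (c'(s := c m)) = 0"
          using s by (intro mdet_col_repeated[of m' l s]) auto
        then show "x m * mdet A l r' (c'(s := c m)) = 0" by simp
      qed
    qed (use s in auto)
    also have "\<dots> = x s * R + x (Suc s) * Q"
      using c's Suc(5) by (simp add: R_def Q_def)
        (metis fun_upd_triv)
    finally have Qj: "mdet A l r' (c'(s := Suc i)) = x s * R + x (Suc s) * Q" .
    have "\<gamma> * Q \<le> x (Suc s) * Q"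
      using IH Qj mult_nonpos_nonneg[OF xs R] by simp
    then have "\<gamma> \<le> x (Suc s)" using Q by simp
    then show ?thesis
      using P cramer[OF s(3)] unfolding \<gamma>_def[symmetric] P_def[symmetric] by (metis less_imp_le mult_right_mono)
  qed
qed

text \<open>A minor containing column \<open>i + 1\<close> but not \<open>i\<close> loses the
  multiple of its neighbour that \<open>whitney_inequality\<close> bounds; in all other minors the
  correction vanishes.\<close>

lemma whitney_step:
  assumes A: "TN n A" and i: "\<rho> \<le> i" "Suc i < n"
    and z: "\<And>t. Suc i < t \<Longrightarrow> t < n \<Longrightarrow> A $$ (\<rho>, t) = 0"
    and z': "\<And>s t. s < \<rho> \<Longrightarrow> s < t \<Longrightarrow> t < n \<Longrightarrow> A $$ (s, t) = 0"
    and pos: "A $$ (\<rho>, i) > 0"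
  shows "TN n (A * eadd n i (Suc i) (- (A $$ (\<rho>, Suc i) / A $$ (\<rho>, i))))"
    (is "TN n (A * ?E)")
  unfolding TN_def
proof (intro conjI allI impI)
  note cA = TN_carrier[OF A]
  show "A * ?E \<in> carrier_mat n n" using cA by auto
  fix k r c assume r: "idx n k r" and c: "idx n k c"
  show "mdet (A * ?E) k r c \<ge> 0"
  proof (cases "Suc i \<in> c ` {..<k}")
    case False
    then show ?thesis using mdet_eadd_other[OF cA _ i(2) r c] TN_mdet[OF A r c] i by simp
  next
    case True
    then obtain b where b: "b < k" "c b = Suc i" by auto
    have *: "mdet (A * ?E) k r c = mdet A k r c -
        A $$ (\<rho>, Suc i) / A $$ (\<rho>, i) * mdet A k r (c(b := i))"
      using mdet_eadd[OF cA _ i(2) r c b] i by simp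
    show ?thesis
    proof (cases "i \<in> c ` {..<k}")
      case True
      then obtain a where "a < k" "c a = i" by auto
      then have "mdet A k r (c(b := i)) = 0"
        using b by (intro mdet_col_repeated[of a k b]) auto
      then show ?thesis using * TN_mdet[OF A r c] by simp
    next
      case False
      have "idx n k (c(b := i))"
        by (rule idx_upd_adjacent[OF c b]) (use False i in auto)
      moreover have u: "c(b := i, b := Suc i) = c" using b by auto
      ultimately have "A $$ (\<rho>, Suc i) / A $$ (\<rho>, i) * mdet A k r (c(b := i)) \<le> mdet A k r c"
        using whitney_inequality[OF A i z z' pos r, of "c(b := i)" b] b c unfolding u by simp
      then show ?thesis using * by simp
    qed
  qed
qed


section \<open>Factorization of symmetric totally nonnegative matrices\<close>

lemma TN_transpose:
  assumes "TN n A"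
  shows "TN n A\<^sup>T"
  unfolding TN_def
proof (intro conjI allI impI)
  show "A\<^sup>T \<in> carrier_mat n n" using assms by (simp add: TN_carrier)
  fix k r c assume rc: "idx n k r" "idx n k c"
  have "minor A\<^sup>T (r ` {..<k}) (c ` {..<k}) = minor A (c ` {..<k}) (r ` {..<k})"
    using rc by (intro minor_transpose[OF TN_carrier[OF assms]])
      (auto simp: card_image_idx, auto simp: idx_def)
  then show "mdet A\<^sup>T k r c \<ge> 0" using rc TN_mdet[OF assms, of k c r] by (simp add: minor_image)
qed

lemma TN_index_nonneg:
  assumes "TN n A" "i < n" "j < n"
  shows "A $$ (i, j) \<ge> 0"
proof -
  have "mdet A 1 (\<lambda>_. i) (\<lambda>_. j) = A $$ (i, j)"
    by (simp add: mdet_def det_single)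
  moreover have "mdet A 1 (\<lambda>_. i) (\<lambda>_. j) \<ge> 0"
    using assms by (intro TN_mdet[OF assms(1)] idxI) auto
  ultimately show ?thesis by simp
qed

lemma TN_minor_2:
  assumes "TN n A" "i < i'" "i' < n" "j < j'" "j' < n"
  shows "A $$ (i, j) * A $$ (i', j') \<ge> A $$ (i, j') * A $$ (i', j)"
proof -
  have "mdet A (Suc 1) (case_nat i (\<lambda>_. i')) (case_nat j (\<lambda>_. j')) =
      A $$ (i, j) * A $$ (i', j') - A $$ (i, j') * A $$ (i', j)"
    by (subst mdet_row_expand[of 0])
      (auto simp: mdet_def det_single insert_index_def)
  moreover have "mdet A (Suc 1) (case_nat i (\<lambda>_. i')) (case_nat j (\<lambda>_. j')) \<ge> 0"
    by (intro TN_mdet[OF assms(1)] idxI) (use assms in \<open>auto split: nat.split\<close>)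
  ultimately show ?thesis by simp
qed

text \<open>If \<open>A $$ (i, i) = 0\<close>, the principal 2 by 2 minors through \<open>i\<close>
  and symmetry bound the square of \<open>A $$ (s, i)\<close> by 0, so column \<open>i\<close> is
  zero.\<close>

lemma TN_symmetric_diag_pos:
  assumes A: "TN n A" "A\<^sup>T = A" "det A \<noteq> 0" and i: "i < n"
  shows "A $$ (i, i) > 0"
proof (rule ccontr)
  note cA = TN_carrier[OF A(1)]
  assume "\<not> ?thesis"
  then have 0: "A $$ (i, i) = 0" using TN_index_nonneg[OF A(1) i i] by simp
  have sym: "A $$ (s, t) = A $$ (t, s)" if "s < n" "t < n" for s t
    using that cA A(2) by (metis carrier_matD index_transpose_mat(1))
  have "A $$ (s, i) = 0" if s: "s < n" for s
  proof (cases s i rule: linorder_cases)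
    case less
    then show ?thesis using TN_minor_2[OF A(1) less i less i] sym[OF s i] 0
      by (auto simp: mult_le_0_iff)
  next
    case greater
    then show ?thesis using TN_minor_2[OF A(1) greater s greater s] sym[OF s i] 0
      by (auto simp: mult_le_0_iff)
  qed (simp add: 0)
  then have "det A = 0" using i by (subst laplace_expansion_column[OF cA i]) auto
  with A(3) show False by simp
qed

lemma elem_upper_eadd:
  assumes "1 \<le> i" "i < n"
  shows "elem_upper n i a = eadd n (i - 1) i a"
  using assms by (auto simp: elem_upper_def matrix_unit_def eadd_def intro!: eq_matI)

lemma elem_upper_carrier[simp]: "elem_upper n i a \<in> carrier_mat n n"
  by (simp add: elem_upper_def matrix_unit_def)

lemma word_upper_Nil[simp]: "word_upper n [] as = 1\<^sub>m n"
  by (simp add: word_upper_def)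

lemma word_upper_Cons[simp]:
  "word_upper n (i # w) (a # as) = elem_upper n i a * word_upper n w as"
  by (simp add: word_upper_def)

lemma word_upper_carrier[simp]: "word_upper n w as \<in> carrier_mat n n"
proof (induction w arbitrary: as)
  case (Cons i w)
  then show ?case by (cases as) (auto simp: word_upper_def intro!: mult_carrier_mat[of _ n n])
qed simp

lemma word_upper_snoc:
  assumes "length as = length w"
  shows "word_upper n (w @ [i]) (as @ [a]) = word_upper n w as * elem_upper n i a"
  using assms
proof (induction as w rule: list_induct2)
  case Nil
  have "elem_upper n i a * 1\<^sub>m n = elem_upper n i a" "1\<^sub>m n * elem_upper n i a = elem_upper n i a"
    by (rule right_mult_one_mat left_mult_one_mat, rule elem_upper_carrier)+
  then show ?case by simp
next
  case (Cons x xs y ys)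
  then show ?case
    by (simp add: assoc_mult_mat[of _ n n _ n _ n])
qed

lemma det_eadd:
  assumes "x < y"
  shows "det (eadd n x y a) = 1"
proof -
  have "det (eadd n x y a) = prod_list (diag_mat (eadd n x y a))"
    by (rule det_upper_triangular[of _ n]) (use assms in \<open>auto simp: eadd_def\<close>)
  also have "\<dots> = 1" unfolding prod_list_diag_prod
    by (rule prod.neutral) (use assms in \<open>auto simp: eadd_def\<close>)
  finally show ?thesis .
qed

lemma eadd_cancel:
  assumes "x < n" "y < n" "x \<noteq> y"
  shows "eadd n x y (- a) * eadd n x y a = 1\<^sub>m n"
proof (rule eq_matI)
  fix r c assume "r < dim_row (1\<^sub>m n :: real mat)" "c < dim_col (1\<^sub>m n :: real mat)"
  then show "(eadd n x y (- a) * eadd n x y a) $$ (r, c) = 1\<^sub>m n $$ (r, c)"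
    using assms by (subst mult_eadd_index) (auto simp: eadd_def)
qed (auto simp: eadd_def)

text \<open>Induction on the number of nonzero off-diagonal entries. Each step clears the last such
  entry of the first row that has one by a column operation and performs the transposed row
  operation, so symmetry survives; the inverse operation appends a letter with positive parameter to
  the word.\<close>

theorem symmetric_TN_factorization:
  assumes "TN n A" "A\<^sup>T = A" "det A \<noteq> 0"
  obtains w as D where "set w \<subseteq> {1..<n}" "length as = length w" "\<forall>a\<in>set as. a > 0"
    "positive_diagonal n D" "A = (word_upper n w as)\<^sup>T * D * word_upper n w as"
proof -
  let ?S = "\<lambda>A :: real mat. {(s, t). s < n \<and> t < n \<and> s \<noteq> t \<and> A $$ (s, t) \<noteq> 0}"
  have "\<exists>w as D. set w \<subseteq> {1..<n} \<and> length as = length w \<and> (\<forall>a\<in>set as. a > 0) \<and>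
    positive_diagonal n D \<and> A = (word_upper n w as)\<^sup>T * D * word_upper n w as"
    using assms
  proof (induction "card (?S A)" arbitrary: A rule: less_induct)
    case less
    note A = less(2-4) and cA = TN_carrier[OF less(2)]
    have sym: "A $$ (s, t) = A $$ (t, s)" if "s < n" "t < n" for s t
      using that cA A(2) by (metis carrier_matD index_transpose_mat(1))
    note pos = TN_symmetric_diag_pos[OF A]
    show ?case
    proof (cases "?S A = {}")
      case True
      then have "positive_diagonal n A"
        using cA pos by (auto simp: positive_diagonal_def diagonal_mat_def)
      moreover have "A = (word_upper n [] [])\<^sup>T * A * word_upper n [] []"
        using cA by simp
      ultimately show ?thesis by (intro exI[of _ "[]"] exI[of _ A]) auto
    next
      case False
      then have ex: "\<exists>s t. s < n \<and> t < n \<and> s \<noteq> t \<and> A $$ (s, t) \<noteq> 0" by auto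
      define \<rho> where "\<rho> = (LEAST s. \<exists>t. s < n \<and> t < n \<and> s \<noteq> t \<and> A $$ (s, t) \<noteq> 0)"
      have \<rho>: "\<exists>t. \<rho> < n \<and> t < n \<and> \<rho> \<noteq> t \<and> A $$ (\<rho>, t) \<noteq> 0"
        unfolding \<rho>_def by (rule LeastI_ex) (use ex in blast)
      have z': "A $$ (s, t) = 0" if "s < \<rho>" "t < n" "s \<noteq> t" for s t
        using not_less_Least[OF that(1)[unfolded \<rho>_def]] that \<rho> by force
      define T where "T = {t. t < n \<and> \<rho> \<noteq> t \<and> A $$ (\<rho>, t) \<noteq> 0}"
      have T: "finite T" "T \<noteq> {}" using \<rho> by (auto simp: T_def)
      define j where "j = Max T"
      have j: "j < n" "\<rho> \<noteq> j" "A $$ (\<rho>, j) \<noteq> 0" using Max_in[OF T] by (auto simp: j_def T_def)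
      have \<rho>n: "\<rho> < n" using \<rho> by auto
      have z: "A $$ (\<rho>, t) = 0" if "j < t" "t < n" "\<rho> \<noteq> t" for t
      proof (rule ccontr)
        assume "A $$ (\<rho>, t) \<noteq> 0"
        then have "t \<in> T" using that by (simp add: T_def)
        then have "t \<le> j" unfolding j_def by (rule Max_ge[OF T(1)])
        with that show False by simp
      qed
      have "\<not> j < \<rho>" using z'[of j \<rho>] sym[of j \<rho>] j \<rho>n by auto
      then have \<rho>j: "\<rho> < j" using j by auto
      then obtain i where i: "j = Suc i" "\<rho> \<le> i" by (cases j) auto
      have in_n: "i < n" using i j by auto
      have Aj: "A $$ (\<rho>, j) > 0" using j TN_index_nonneg[OF A(1) \<rho>n j(1)] by simp
      \<comment> \<open>The elimination divides by this entry. It cannot vanish: for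
        \<open>\<rho> < i\<close> the minor with rows \<open>\<rho>, i\<close> and columns
        \<open>i, j\<close> bounds a positive product by a multiple of it.\<close>
      have Ai: "A $$ (\<rho>, i) > 0"
      proof (cases "\<rho> = i")
        case True then show ?thesis using pos[OF in_n] by simp
      next
        case False
        with i have "\<rho> < i" by simp
        from TN_minor_2[OF A(1) this in_n, of i j] i(1) j(1)
        have "A $$ (\<rho>, j) * A $$ (i, i) \<le> A $$ (\<rho>, i) * A $$ (i, j)" by simp
        moreover have "A $$ (\<rho>, j) * A $$ (i, i) > 0" using Aj pos[OF in_n] by simp
        ultimately have "A $$ (\<rho>, i) \<noteq> 0" by auto
        then show ?thesis using TN_index_nonneg[OF A(1) \<rho>n in_n] by simp
      qed
      define \<gamma> where "\<gamma> = A $$ (\<rho>, j) / A $$ (\<rho>, i)"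
      have \<gamma>: "\<gamma> > 0" using Ai Aj by (simp add: \<gamma>_def)
      define E where "E = eadd n i j (- \<gamma>)"
      define F where "F = eadd n i j \<gamma>"
      have cE: "E \<in> carrier_mat n n" and cF: "F \<in> carrier_mat n n" by (auto simp: E_def F_def)
      have EF: "E * F = 1\<^sub>m n" unfolding E_def F_def using in_n j i by (intro eadd_cancel) auto
      define B where "B = A * E"
      define C where "C = B\<^sup>T * E"
      have cB: "B \<in> carrier_mat n n" using cA cE by (simp add: B_def)
      have cC: "C \<in> carrier_mat n n" using cB cE by (simp add: C_def)
      have Bi: "B $$ (s, t) = A $$ (s, t) + (if t = j then - \<gamma> * A $$ (s, i) else 0)"
        if "s < n" "t < n" for s t
        unfolding B_def E_def using mult_eadd_index[OF cA in_n j(1) that] .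
      have Ci: "C $$ (s, t) = B $$ (t, s) + (if t = j then - \<gamma> * B $$ (i, s) else 0)"
        if "s < n" "t < n" for s t
        using that cB in_n j by (simp add: C_def E_def mult_eadd_index del: index_mult_mat)
      have TB: "TN n B"
        unfolding B_def E_def \<gamma>_def i(1)
        by (rule whitney_step[OF A(1) i(2)]) (use i j z z' Ai in auto)
      \<comment> \<open>The first operation changes column \<open>j\<close> only and
        \<open>\<rho> \<noteq> j\<close>; hence row \<open>\<rho>\<close> of the transpose of
        \<open>B\<close> is row \<open>\<rho>\<close> of \<open>A\<close>, and the same multiplier
        \<open>\<gamma>\<close> serves for the rows.\<close>
      have TC: "TN n C"
      proof -
        have "TN n (B\<^sup>T * eadd n i (Suc i) (- (B\<^sup>T $$ (\<rho>, Suc i) / B\<^sup>T $$ (\<rho>, i))))"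
        proof (rule whitney_step[OF TN_transpose[OF TB] i(2)])
          show "Suc i < n" using i j by simp
          show "B\<^sup>T $$ (\<rho>, t) = 0" if "Suc i < t" "t < n" for t
            using that \<rho>n \<rho>j cB i z[of t] sym[of t \<rho>] by (simp add: Bi)
          show "B\<^sup>T $$ (s, t) = 0" if "s < \<rho>" "s < t" "t < n" for s t
            using that \<rho>n \<rho>j cB i z'[of s t] sym[of t s] by (simp add: Bi)
          show "0 < B\<^sup>T $$ (\<rho>, i)"
            using \<rho>n \<rho>j cB in_n Ai sym[of i \<rho>] by (simp add: Bi)
        qed
        moreover have "B\<^sup>T $$ (\<rho>, Suc i) = A $$ (\<rho>, j)" "B\<^sup>T $$ (\<rho>, i) = A $$ (\<rho>, i)"
          using \<rho>n \<rho>j cB in_n j i sym[of i \<rho>] sym[of j \<rho>] by (simp_all add: Bi)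
        ultimately show ?thesis by (simp add: C_def E_def \<gamma>_def i(1))
      qed
      have BT: "B\<^sup>T = E\<^sup>T * A" unfolding B_def using transpose_mult[OF cA cE] A(2) by simp
      have CE: "C = E\<^sup>T * A * E" by (simp add: C_def BT)
      have symC: "C\<^sup>T = C"
      proof -
        have "C\<^sup>T = E\<^sup>T * B\<^sup>T\<^sup>T"
          unfolding C_def by (rule transpose_mult[of _ n n]) (use cB cE in auto)
        also have "\<dots> = E\<^sup>T * (A * E)" by (simp add: B_def)
        also have "\<dots> = C" unfolding CE
          by (rule assoc_mult_mat[symmetric, of _ n n _ n _ n]) (use cA cE in auto)
        finally show ?thesis .
      qed
      have dE: "det E = 1" unfolding E_def i(1) by (rule det_eadd) simp
      have dC: "det C \<noteq> 0"
        using A(3) dE cA cE by (simp add: CE det_mult[of _ n] det_transpose[OF cE])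
      \<comment> \<open>Both operations only decrease entries and keep them nonnegative, so no zero
        is refilled, while the entry at \<open>(\<rho>, j)\<close> disappears.\<close>
      have CA: "C $$ (s, t) \<le> A $$ (s, t)" if st: "s < n" "t < n" for s t
      proof -
        have "B $$ (i, s) \<ge> 0" "A $$ (t, i) \<ge> 0"
          using TN_index_nonneg TB A(1) st in_n by auto
        then have "\<gamma> * B $$ (i, s) \<ge> 0" "\<gamma> * A $$ (t, i) \<ge> 0" using \<gamma> by auto
        then have "C $$ (s, t) \<le> B $$ (t, s)" "B $$ (t, s) \<le> A $$ (t, s)"
          using Ci[OF st] Bi[OF st(2,1)] by auto
        with sym[OF st] show ?thesis by simp
      qed
      have "?S C \<subset> ?S A"
      proof
        show "?S C \<subseteq> ?S A"
          using CA TN_index_nonneg[OF TC] by clarify (metis order_antisym_conv)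
        have "C $$ (\<rho>, j) = 0"
          using Ci[OF \<rho>n j(1)] Bi[OF j(1) \<rho>n] Bi[OF in_n \<rho>n] \<rho>j Ai sym[of i \<rho>] sym[of j \<rho>] in_n j \<rho>n
          by (simp add: \<gamma>_def)
        then show "?S C \<noteq> ?S A" using j \<rho>n by blast
      qed
      moreover have "finite (?S A)"
        by (rule finite_subset[of _ "{..<n} \<times> {..<n}"]) auto
      ultimately have "card (?S C) < card (?S A)" by (rule psubset_card_mono[rotated])
      from less(1)[OF this TC symC dC] obtain w as D where
        w: "set w \<subseteq> {1..<n}" "length as = length w" "\<forall>a\<in>set as. a > 0" "positive_diagonal n D"
        "C = (word_upper n w as)\<^sup>T * D * word_upper n w as" by auto
      define U where "U = word_upper n w as"
      have cU: "U \<in> carrier_mat n n" and cD: "D \<in> carrier_mat n n"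
        using w(4) by (auto simp: U_def positive_diagonal_def)
      have UF: "word_upper n (w @ [j]) (as @ [\<gamma>]) = U * F"
        using word_upper_snoc[OF w(2), of n j \<gamma>] i j by (simp add: elem_upper_eadd U_def F_def)
      have FE: "F\<^sup>T * E\<^sup>T = 1\<^sub>m n"
        using transpose_mult[OF cE cF] EF by simp
      have "(U * F)\<^sup>T * D * (U * F) = F\<^sup>T * (U\<^sup>T * D * U) * F"
        using cU cF cD
        by (simp add: transpose_mult[of _ n n] assoc_mult_mat[of _ n n _ n _ n])
      also have "\<dots> = F\<^sup>T * (E\<^sup>T * A * E) * F"
        using w(5) CE by (simp add: U_def)
      also have "\<dots> = (F\<^sup>T * E\<^sup>T) * A * (E * F)"
        using cA cE cF by (simp add: assoc_mult_mat[of _ n n _ n _ n])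
      also have "\<dots> = A" using cA by (simp add: EF FE)
      finally have "A = (word_upper n (w @ [j]) (as @ [\<gamma>]))\<^sup>T * D * word_upper n (w @ [j]) (as @ [\<gamma>])"
        by (simp add: UF)
      then show ?thesis using w i j \<gamma>
        by (intro exI[of _ "w @ [j]"] exI[of _ "as @ [\<gamma>]"] exI[of _ D]) auto
    qed
  qed
  then show thesis using that by blast
qed

subsection \<open>Minors as particle configurations\<close>

text \<open>A set \<open>J\<close> of positions below \<open>n\<close> is encoded by the function counting the elements of \<open>J\<close> that
  are at least \<open>l\<close>.  Positions are numbered from 0, letters from 1: the letter \<open>i\<close> moves a particle
  from \<open>i - 1\<close> to \<open>i\<close>, which raises the value of the encoding at \<open>i\<close> by one and changes nothing else.\<close>

definition config :: "nat \<Rightarrow> (nat \<Rightarrow> nat) \<Rightarrow> bool" where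
  "config n f \<longleftrightarrow> (\<forall>l\<ge>n. f l = 0) \<and> (\<forall>l. f (Suc l) \<le> f l \<and> f l \<le> Suc (f (Suc l)))"

definition occ :: "(nat \<Rightarrow> nat) \<Rightarrow> nat set" where
  "occ f = {x. f (Suc x) < f x}"

definition count_from :: "nat set \<Rightarrow> nat \<Rightarrow> nat" where
  "count_from J l = card {x \<in> J. l \<le> x}"

text \<open>Letters are read from the left, and each is optional: skipping is the identity summand
  of its elementary factor. For \<open>0 < i < n\<close>, the raised function being a
  \<open>config\<close> says exactly that \<open>i - 1\<close> is occupied and \<open>i\<close> is
  free.\<close>

fun reach :: "nat \<Rightarrow> nat list \<Rightarrow> (nat \<Rightarrow> nat) \<Rightarrow> (nat \<Rightarrow> nat) \<Rightarrow> bool" where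
  "reach n [] f g \<longleftrightarrow> f = g"
| "reach n (i # w) f g \<longleftrightarrow> reach n w f g \<or>
     (config n (f(i := Suc (f i))) \<and> reach n w (f(i := Suc (f i))) g)"

text \<open>\<open>b\<close> is the state between the two halves. The descent from \<open>f\<close>
  to \<open>b\<close> along the reversed word is a climb from \<open>b\<close> to \<open>f\<close>
  read backwards, so one relation covers both halves.\<close>

definition round_step :: "nat \<Rightarrow> nat list \<Rightarrow> (nat \<Rightarrow> nat) \<Rightarrow> (nat \<Rightarrow> nat) \<Rightarrow> bool" where
  "round_step n w f g \<longleftrightarrow> (\<exists>b. config n b \<and> reach n w b f \<and> reach n w b g)"

lemma config_Suc: "config n f \<Longrightarrow> f (Suc l) \<le> f l \<and> f l \<le> Suc (f (Suc l))"
  by (simp add: config_def)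

lemma config_zero: "config n f \<Longrightarrow> n \<le> l \<Longrightarrow> f l = 0"
  by (simp add: config_def)

lemma occ_subset: "config n f \<Longrightarrow> occ f \<subseteq> {..<n}"
  by (auto simp: occ_def config_def) (metis less_zeroE not_le)

lemma count_from_Suc:
  assumes "finite J"
  shows "count_from J l = (if l \<in> J then 1 else 0) + count_from J (Suc l)"
proof -
  have "{x \<in> J. l \<le> x} = (if l \<in> J then {l} else {}) \<union> {x \<in> J. Suc l \<le> x}"
    by (auto simp: Suc_le_eq le_less)
  then show ?thesis using assms by (cases "l \<in> J") (simp_all add: count_from_def)
qed

lemma config_count_from:
  assumes "J \<subseteq> {..<n}"
  shows "config n (count_from J)"
  unfolding config_def
proof (intro conjI allI impI)
  have fin: "finite J" using assms finite_subset by blast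
  fix l
  show "count_from J (Suc l) \<le> count_from J l" "count_from J l \<le> Suc (count_from J (Suc l))"
    using count_from_Suc[OF fin, of l] by auto
next
  fix l assume "n \<le> l"
  then have "{x \<in> J. l \<le> x} = {}" using assms by auto
  then show "count_from J l = 0" unfolding count_from_def by (metis card.empty)
qed

lemma occ_count_from:
  assumes "finite J"
  shows "occ (count_from J) = J"
proof -
  have "x \<in> occ (count_from J) \<longleftrightarrow> x \<in> J" for x
    using count_from_Suc[OF assms, of x] by (auto simp: occ_def)
  then show ?thesis by blast
qed

lemma count_from_0: "count_from J 0 = card J"
  by (simp add: count_from_def)

lemma count_from_occ:
  assumes "config n f"
  shows "count_from (occ f) = f"
proof
  have fin: "finite (occ f)" using occ_subset[OF assms] finite_subset by blast
  fix l
  show "count_from (occ f) l = f l"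
  proof (cases "l \<le> n")
    case True
    then show ?thesis
    proof (induction rule: inc_induct)
      case base
      then show ?case
        using config_count_from[OF occ_subset[OF assms]] assms by (simp add: config_zero)
    next
      case (step l)
      then show ?case using config_Suc[OF assms, of l] count_from_Suc[OF fin, of l]
        by (auto simp: occ_def)
    qed
  next
    case False
    then show ?thesis
      using config_count_from[OF occ_subset[OF assms]] assms by (simp add: config_zero)
  qed
qed

lemma card_occ: "config n f \<Longrightarrow> card (occ f) = f 0"
  using count_from_occ count_from_0 by metis

lemma occ_inj: "config n f \<Longrightarrow> config n g \<Longrightarrow> occ f = occ g \<longleftrightarrow> f = g"
  using count_from_occ by metis

lemma config_raise_iff:
  assumes "config n f" "0 < i" "i < n"
  shows "config n (f(i := Suc (f i))) \<longleftrightarrow> i - 1 \<in> occ f \<and> i \<notin> occ f"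
proof -
  obtain j where j: "i = Suc j" using assms(2) by (cases i) auto
  have "config n (f(i := Suc (f i))) \<longleftrightarrow> Suc (f i) \<le> f j \<and> f i \<le> f (Suc i)"
  proof
    assume "config n (f(i := Suc (f i)))"
    from config_Suc[OF this, of j] config_Suc[OF this, of i]
    show "Suc (f i) \<le> f j \<and> f i \<le> f (Suc i)" using j by auto
  next
    assume a: "Suc (f i) \<le> f j \<and> f i \<le> f (Suc i)"
    have *: "f (Suc i) \<le> f i" "f j \<le> Suc (f i)" using config_Suc[OF assms(1), of i] config_Suc[OF assms(1), of j] j by auto
    show "config n (f(i := Suc (f i)))" unfolding config_def
    proof (intro conjI allI impI)
      fix l show "(f(i := Suc (f i))) (Suc l) \<le> (f(i := Suc (f i))) l"
        using a * config_Suc[OF assms(1), of l] j by auto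
      show "(f(i := Suc (f i))) l \<le> Suc ((f(i := Suc (f i))) (Suc l))"
        using a * config_Suc[OF assms(1), of l] j by auto
    qed (use assms in \<open>auto simp: config_zero\<close>)
  qed
  then show ?thesis using j config_Suc[OF assms(1), of i] by (auto simp: occ_def)
qed

lemma config_lower_iff:
  assumes "config n f" "0 < i" "i < n"
  shows "0 < f i \<and> config n (f(i := f i - 1)) \<longleftrightarrow> i \<in> occ f \<and> i - 1 \<notin> occ f"
proof -
  obtain j where j: "i = Suc j" using assms(2) by (cases i) auto
  have "0 < f i \<and> config n (f(i := f i - 1)) \<longleftrightarrow> f (Suc i) < f i \<and> f j \<le> f i"
  proof
    assume "0 < f i \<and> config n (f(i := f i - 1))"
    then show "f (Suc i) < f i \<and> f j \<le> f i"
      using config_Suc[of n "f(i := f i - 1)" j] config_Suc[of n "f(i := f i - 1)" i] j by auto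
  next
    assume a: "f (Suc i) < f i \<and> f j \<le> f i"
    have *: "f i \<le> Suc (f (Suc i))" "f i \<le> f j" using config_Suc[OF assms(1), of i] config_Suc[OF assms(1), of j] j by auto
    have "config n (f(i := f i - 1))" unfolding config_def
    proof (intro conjI allI impI)
      fix l show "(f(i := f i - 1)) (Suc l) \<le> (f(i := f i - 1)) l"
        using a * config_Suc[OF assms(1), of l] j by auto
      show "(f(i := f i - 1)) l \<le> Suc ((f(i := f i - 1)) (Suc l))"
        using a * config_Suc[OF assms(1), of l] j by auto
    qed (use assms in \<open>auto simp: config_zero\<close>)
    with a show "0 < f i \<and> config n (f(i := f i - 1))" by auto
  qed
  then show ?thesis using j by (auto simp: occ_def)
qed

lemma occ_raise:
  assumes "config n f" "0 < i" "i < n" "config n (f(i := Suc (f i)))"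
  shows "occ (f(i := Suc (f i))) = insert i (occ f - {i - 1})"
proof -
  obtain j where j: "i = Suc j" using assms(2) by (cases i) auto
  have "i - 1 \<in> occ f \<and> i \<notin> occ f" using config_raise_iff[OF assms(1-3)] assms(4) by simp
  then show ?thesis using j config_Suc[OF assms(1), of i] config_Suc[OF assms(1), of j]
    by (auto simp: occ_def)
qed

lemma occ_lower:
  assumes "config n f" "0 < i" "i < n" "0 < f i" "config n (f(i := f i - 1))"
  shows "occ (f(i := f i - 1)) = insert (i - 1) (occ f - {i})"
proof -
  obtain j where j: "i = Suc j" using assms(2) by (cases i) auto
  have "i \<in> occ f \<and> i - 1 \<notin> occ f" using config_lower_iff[OF assms(1-3)] assms(4,5) by simp
  then show ?thesis using j config_Suc[OF assms(1), of i] config_Suc[OF assms(1), of j] assms(4)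
    by (auto simp: occ_def)
qed

section \<open>Positive minors as transitions along the word\<close>

definition cminor :: "real mat \<Rightarrow> (nat \<Rightarrow> nat) \<Rightarrow> (nat \<Rightarrow> nat) \<Rightarrow> real" where
  "cminor M f g = minor M (occ f) (occ g)"

lemma cminor_elem_upper:
  assumes "M \<in> carrier_mat n n" "config n f" "config n g" "f 0 = g 0" "i \<in> {1..<n}"
  shows "cminor (M * elem_upper n i a) f g = cminor M f g +
    (if 0 < g i \<and> config n (g(i := g i - 1)) then a * cminor M f (g(i := g i - 1)) else 0)"
proof -
  have i: "0 < i" "i < n" using assms(5) by auto
  have "cminor (M * elem_upper n i a) f g = minor (M * eadd n (i - 1) i a) (occ f) (occ g)"
    using assms(5) by (simp add: elem_upper_eadd cminor_def)
  also have "\<dots> = cminor M f g + (if i \<in> occ g \<and> i - 1 \<notin> occ g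
      then a * minor M (occ f) (insert (i - 1) (occ g - {i})) else 0)"
    unfolding cminor_def
    by (rule minor_eadd[OF assms(1)])
      (use i assms in \<open>auto simp: card_occ dest: occ_subset\<close>)
  finally show ?thesis
    using config_lower_iff[OF assms(3) i] occ_lower[OF assms(3) i] by (auto simp: cminor_def)
qed

lemma cminor_elem_lower:
  assumes "M \<in> carrier_mat n n" "config n f" "config n g" "f 0 = g 0" "i \<in> {1..<n}"
  shows "cminor (M * (elem_upper n i a)\<^sup>T) f g = cminor M f g +
    (if config n (g(i := Suc (g i))) then a * cminor M f (g(i := Suc (g i))) else 0)"
proof -
  have i: "0 < i" "i < n" using assms(5) by auto
  have "cminor (M * (elem_upper n i a)\<^sup>T) f g = minor (M * eadd n i (i - 1) a) (occ f) (occ g)"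
    using assms(5) by (simp add: elem_upper_eadd cminor_def transpose_eadd)
  also have "\<dots> = cminor M f g + (if i - 1 \<in> occ g \<and> i \<notin> occ g
      then a * minor M (occ f) (insert i (occ g - {i - 1})) else 0)"
    unfolding cminor_def
    by (rule minor_eadd[OF assms(1)])
      (use i assms in \<open>auto simp: card_occ dest: occ_subset\<close>)
  finally show ?thesis
    using config_raise_iff[OF assms(3) i] occ_raise[OF assms(3) i] by (auto simp: cminor_def)
qed

lemma reach_config:
  assumes "reach n w f g" "config n f" "0 \<notin> set w"
  shows "config n g \<and> g 0 = f 0"
  using assms by (induction w arbitrary: f) (auto split: if_splits)

text \<open>Nonnegativity of the minors with fixed rows is carried along because it excludes
  cancellation: a sum of such minors is positive iff one of them is
  (\<open>add_pos_iff\<close>).\<close>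

definition nn_row :: "nat \<Rightarrow> real mat \<Rightarrow> (nat \<Rightarrow> nat) \<Rightarrow> bool" where
  "nn_row n M f \<longleftrightarrow> M \<in> carrier_mat n n \<and> config n f \<and>
    (\<forall>g. config n g \<longrightarrow> g 0 = f 0 \<longrightarrow> cminor M f g \<ge> 0)"

lemma add_pos_iff: "0 \<le> x \<Longrightarrow> 0 \<le> y \<Longrightarrow> 0 < x + y \<longleftrightarrow> 0 < x \<or> 0 < (y :: real)"
  by linarith

lemma nn_row_elem_upper:
  assumes "nn_row n M f" "i \<in> {1..<n}" "a > 0"
  shows "nn_row n (M * elem_upper n i a) f"
  using assms by (auto simp: nn_row_def cminor_elem_upper intro!: mult_carrier_mat[of _ n n])

lemma nn_row_elem_lower:
  assumes "nn_row n M f" "i \<in> {1..<n}" "a > 0"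
  shows "nn_row n (M * (elem_upper n i a)\<^sup>T) f"
  using assms by (auto simp: nn_row_def cminor_elem_lower intro!: mult_carrier_mat[of _ n n])

lemma cminor_word_upper:
  assumes "nn_row n M f" "length as = length w" "set w \<subseteq> {1..<n}" "\<forall>a\<in>set as. a > 0"
  shows "nn_row n (M * word_upper n w as) f \<and> (\<forall>g. config n g \<longrightarrow> g 0 = f 0 \<longrightarrow>
    (cminor (M * word_upper n w as) f g > 0 \<longleftrightarrow>
     (\<exists>h. config n h \<and> h 0 = f 0 \<and> cminor M f h > 0 \<and> reach n w h g)))"
  using assms(2,1,3,4)
proof (induction as w arbitrary: M rule: list_induct2)
  case Nil
  then show ?case by (auto simp: nn_row_def)
next
  case (Cons a as i w)
  have M: "M \<in> carrier_mat n n" "config n f" using Cons.prems(1) by (auto simp: nn_row_def)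
  have i: "i \<in> {1..<n}" "a > 0" "i > 0" using Cons.prems by auto
  have e: "M * word_upper n (i # w) (a # as) = (M * elem_upper n i a) * word_upper n w as"
    using M by (simp add: assoc_mult_mat[of _ n n _ n _ n])
  note N = nn_row_elem_upper[OF Cons.prems(1) i(1,2)]
  note IH = Cons.IH[OF N]
  have pos: "cminor (M * elem_upper n i a) f h > 0 \<longleftrightarrow> cminor M f h > 0 \<or>
      (0 < h i \<and> config n (h(i := h i - 1)) \<and> cminor M f (h(i := h i - 1)) > 0)"
    if "config n h" "h 0 = f 0" for h
    using that Cons.prems(1) i
    by (auto simp: cminor_elem_upper[OF M that(1) that(2)[symmetric] i(1)] nn_row_def add_pos_iff zero_less_mult_iff)
  have "(\<exists>h. config n h \<and> h 0 = f 0 \<and> cminor (M * elem_upper n i a) f h > 0 \<and> reach n w h g) \<longleftrightarrow>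
      (\<exists>h. config n h \<and> h 0 = f 0 \<and> cminor M f h > 0 \<and> reach n (i # w) h g)" (is "?L \<longleftrightarrow> ?R") for g
  proof
    assume ?L
    then obtain h where h: "config n h" "h 0 = f 0" "cminor (M * elem_upper n i a) f h > 0" "reach n w h g" by auto
    show ?R
    proof (cases "cminor M f h > 0")
      case True
      then show ?thesis using h by auto
    next
      case False
      then have *: "0 < h i" "config n (h(i := h i - 1))" "cminor M f (h(i := h i - 1)) > 0"
        using pos[OF h(1,2)] h(3) by auto
      then show ?thesis using h i
        by (intro exI[of _ "h(i := h i - 1)"]) auto
    qed
  next
    assume ?R
    then obtain h where h: "config n h" "h 0 = f 0" "cminor M f h > 0" "reach n (i # w) h g" by blast
    show ?L
    proof (cases "reach n w h g")
      case True
      then show ?thesis using h pos by auto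
    next
      case False
      then have *: "config n (h(i := Suc (h i)))" "reach n w (h(i := Suc (h i))) g" using h(4) by auto
      then have "cminor (M * elem_upper n i a) f (h(i := Suc (h i))) > 0"
        using pos[OF *(1)] h i by simp
      then show ?thesis using * h i by (intro exI[of _ "h(i := Suc (h i))"]) auto
    qed
  qed
  then show ?case using IH Cons.prems unfolding e by auto
qed

text \<open>Transposition reverses the product, so the head letter acts last, and each lower factor
  moves a particle down; therefore the climb runs from the new configuration \<open>g\<close> to the
  old one \<open>h\<close>.\<close>

lemma cminor_word_lower:
  assumes "nn_row n M f" "length as = length w" "set w \<subseteq> {1..<n}" "\<forall>a\<in>set as. a > 0"
  shows "nn_row n (M * (word_upper n w as)\<^sup>T) f \<and> (\<forall>g. config n g \<longrightarrow> g 0 = f 0 \<longrightarrow>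
    (cminor (M * (word_upper n w as)\<^sup>T) f g > 0 \<longleftrightarrow>
     (\<exists>h. config n h \<and> h 0 = f 0 \<and> cminor M f h > 0 \<and> reach n w g h)))"
  using assms(2,1,3,4)
proof (induction as w rule: list_induct2)
  case Nil
  then show ?case by (auto simp: nn_row_def)
next
  case (Cons a as i w)
  have M: "M \<in> carrier_mat n n" "config n f" using Cons.prems(1) by (auto simp: nn_row_def)
  have i: "i \<in> {1..<n}" "a > 0" "i > 0" using Cons.prems by auto
  let ?N = "M * (word_upper n w as)\<^sup>T"
  have e: "M * (word_upper n (i # w) (a # as))\<^sup>T = ?N * (elem_upper n i a)\<^sup>T"
    using M by (simp add: transpose_mult[OF elem_upper_carrier word_upper_carrier]
        assoc_mult_mat[of _ n n _ n _ n])
  have IH: "nn_row n ?N f" "\<And>g. config n g \<Longrightarrow> g 0 = f 0 \<Longrightarrow> (cminor ?N f g > 0 \<longleftrightarrow>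
     (\<exists>h. config n h \<and> h 0 = f 0 \<and> cminor M f h > 0 \<and> reach n w g h))"
    using Cons by auto
  have N: "?N \<in> carrier_mat n n" using IH(1) by (auto simp: nn_row_def)
  have pos: "cminor (?N * (elem_upper n i a)\<^sup>T) f h > 0 \<longleftrightarrow> cminor ?N f h > 0 \<or>
      (config n (h(i := Suc (h i))) \<and> cminor ?N f (h(i := Suc (h i))) > 0)"
    if "config n h" "h 0 = f 0" for h
    using that IH(1) i
    by (auto simp: cminor_elem_lower[OF N M(2) that(1) that(2)[symmetric] i(1)] nn_row_def add_pos_iff zero_less_mult_iff)
  show ?case unfolding e
    using nn_row_elem_lower[OF IH(1) i(1,2)] i by (auto simp: pos IH(2))
qed

lemma cminor_diagonal:
  assumes "nn_row n M f" "positive_diagonal n D"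
  shows "nn_row n (M * D) f \<and> (\<forall>g. config n g \<longrightarrow> g 0 = f 0 \<longrightarrow> (cminor (M * D) f g > 0 \<longleftrightarrow> cminor M f g > 0))"
proof -
  have M: "M \<in> carrier_mat n n" "config n f" using assms(1) by (auto simp: nn_row_def)
  have ex: "\<exists>d>0. cminor (M * D) f g = d * cminor M f g" if g: "config n g" "g 0 = f 0" for g
  proof -
    have "card (occ f) = card (occ g)" using M(2) g by (simp add: card_occ)
    from minor_diagonal[OF M(1) assms(2) occ_subset[OF M(2)] occ_subset[OF g(1)] this]
    show ?thesis unfolding cminor_def by blast
  qed
  have "M * D \<in> carrier_mat n n" using M assms(2) by (auto simp: positive_diagonal_def)
  moreover have "cminor (M * D) f g \<ge> 0 \<and> (cminor (M * D) f g > 0 \<longleftrightarrow> cminor M f g > 0)"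
    if g: "config n g" "g 0 = f 0" for g
  proof -
    obtain d where "d > 0" "cminor (M * D) f g = d * cminor M f g" using ex[OF g] by blast
    moreover have "cminor M f g \<ge> 0" using assms(1) g by (simp add: nn_row_def)
    ultimately show ?thesis by (simp add: zero_less_mult_iff)
  qed
  ultimately show ?thesis using M(2) by (simp add: nn_row_def)
qed

definition factored :: "nat \<Rightarrow> nat list \<Rightarrow> real mat \<Rightarrow> bool" where
  "factored n w A \<longleftrightarrow> set w \<subseteq> {1..<n} \<and> (\<exists>as D. length as = length w \<and> (\<forall>a\<in>set as. a > 0) \<and>
    positive_diagonal n D \<and> A = (word_upper n w as)\<^sup>T * D * word_upper n w as)"

lemma factored_carrier: "factored n w A \<Longrightarrow> A \<in> carrier_mat n n"
  by (auto simp: factored_def positive_diagonal_def intro!: mult_carrier_mat[of _ n n])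

lemma cminor_factored_mult:
  assumes "nn_row n M f" "factored n w A"
  shows "nn_row n (M * A) f \<and> (\<forall>g. config n g \<longrightarrow> g 0 = f 0 \<longrightarrow>
    (cminor (M * A) f g > 0 \<longleftrightarrow> (\<exists>h. config n h \<and> h 0 = f 0 \<and> cminor M f h > 0 \<and> round_step n w h g)))"
proof -
  obtain as D where A: "set w \<subseteq> {1..<n}" "length as = length w" "\<forall>a\<in>set as. a > 0"
    "positive_diagonal n D" "A = (word_upper n w as)\<^sup>T * D * word_upper n w as"
    using assms(2) by (auto simp: factored_def)
  define U where "U = word_upper n w as"
  have M: "M \<in> carrier_mat n n" "config n f" and D: "D \<in> carrier_mat n n" and U: "U \<in> carrier_mat n n"
    using assms(1) A(4) by (auto simp: nn_row_def positive_diagonal_def U_def)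
  have e: "M * A = (M * U\<^sup>T) * D * U"
    using M D U unfolding A(5) U_def[symmetric] by (simp add: assoc_mult_mat[of _ n n _ n _ n])
  note 1 = cminor_word_lower[OF assms(1) A(2,1,3), folded U_def]
  note 2 = cminor_diagonal[OF conjunct1[OF 1] A(4)]
  note 3 = cminor_word_upper[OF conjunct1[OF 2] A(2,1,3), folded U_def]
  have 0: "0 \<notin> set w" using A(1) by auto
  show ?thesis unfolding e
  proof (intro conjI allI impI)
    show "nn_row n (M * U\<^sup>T * D * U) f" using 3 by simp
    fix g assume g: "config n g" "g 0 = f 0"
    have "cminor (M * U\<^sup>T * D * U) f g > 0 \<longleftrightarrow>
      (\<exists>b. config n b \<and> b 0 = f 0 \<and> cminor (M * U\<^sup>T * D) f b > 0 \<and> reach n w b g)"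
      using 3 g by simp
    also have "\<dots> \<longleftrightarrow> (\<exists>b. config n b \<and> b 0 = f 0 \<and> (\<exists>h. config n h \<and> h 0 = f 0 \<and> cminor M f h > 0 \<and>
        reach n w b h) \<and> reach n w b g)"
      using 1 2 by auto
    also have "\<dots> \<longleftrightarrow> (\<exists>h. config n h \<and> h 0 = f 0 \<and> cminor M f h > 0 \<and> round_step n w h g)"
    proof -
      have "config n h \<and> h 0 = b 0 \<and> g 0 = b 0" if "config n b" "reach n w b h" "reach n w b g" for b h
        using reach_config[OF that(2,1) 0] reach_config[OF that(3,1) 0] by simp
      then show ?thesis unfolding round_step_def using g by (auto; blast)
    qed
    finally show "cminor (M * U\<^sup>T * D * U) f g > 0 \<longleftrightarrow>
      (\<exists>h. config n h \<and> h 0 = f 0 \<and> cminor M f h > 0 \<and> round_step n w h g)" .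
  qed
qed

lemma round_step_config:
  assumes "round_step n w f g" "0 \<notin> set w"
  shows "config n f \<and> config n g \<and> g 0 = f 0"
proof -
  obtain b where b: "config n b" "reach n w b f" "reach n w b g" using assms(1) by (auto simp: round_step_def)
  show ?thesis using reach_config[OF b(2,1) assms(2)] reach_config[OF b(3,1) assms(2)] by simp
qed

lemma rounds_config:
  assumes "(round_step n w ^^ m) f g" "0 \<notin> set w" "config n f"
  shows "config n g \<and> g 0 = f 0"
  using assms(1)
proof (induction m arbitrary: g)
  case (Suc m)
  then obtain h where h: "(round_step n w ^^ m) f h" "round_step n w h g" by auto
  from round_step_config[OF h(2) assms(2)] Suc.IH[OF h(1)] show ?case by simp
qed (use assms(3) in simp)

theorem cminor_power:
  assumes "factored n w A" "config n f"
  shows "nn_row n (A ^\<^sub>m m) f \<and> (\<forall>g. config n g \<longrightarrow> g 0 = f 0 \<longrightarrow>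
    (cminor (A ^\<^sub>m m) f g > 0 \<longleftrightarrow> (round_step n w ^^ m) f g))"
proof (induction m)
  case 0
  have "cminor (1\<^sub>m n) f g = (if f = g then 1 else 0)" if "config n g" "g 0 = f 0" for g
    unfolding cminor_def using that assms(2)
    by (subst minor_one) (auto simp: card_occ occ_inj dest: occ_subset)
  then show ?case using factored_carrier[OF assms(1)] assms(2) by (auto simp: nn_row_def)
next
  case (Suc m)
  have 0: "0 \<notin> set w" using assms(1) by (auto simp: factored_def)
  note * = cminor_factored_mult[OF conjunct1[OF Suc] assms(1)]
  show ?case
  proof (intro conjI allI impI)
    show "nn_row n (A ^\<^sub>m Suc m) f" using * by simp
    fix g assume g: "config n g" "g 0 = f 0"
    have "cminor (A ^\<^sub>m Suc m) f g > 0 \<longleftrightarrow>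
        (\<exists>h. config n h \<and> h 0 = f 0 \<and> cminor (A ^\<^sub>m m) f h > 0 \<and> round_step n w h g)"
      using conjunct2[OF *, rule_format, OF g] by simp
    also have "\<dots> \<longleftrightarrow> (\<exists>h. (round_step n w ^^ m) f h \<and> round_step n w h g)"
      using conjunct2[OF Suc] rounds_config[OF _ 0 assms(2), of m] by blast
    finally show "cminor (A ^\<^sub>m Suc m) f g > 0 \<longleftrightarrow> (round_step n w ^^ Suc m) f g"
      by (simp add: OO_def)
  qed
qed

text \<open>Positivity of all order \<open>k\<close> minors of the \<open>m\<close>-th power at the
  level of words (see \<open>minors_power_pos_iff\<close>); parameters and diagonal no longer
  occur.\<close>

definition mixed :: "nat \<Rightarrow> nat list \<Rightarrow> nat \<Rightarrow> nat \<Rightarrow> bool" where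
  "mixed n w k m \<longleftrightarrow>
     (\<forall>f g. config n f \<longrightarrow> config n g \<longrightarrow> f 0 = k \<longrightarrow> g 0 = k \<longrightarrow> (round_step n w ^^ m) f g)"

lemma minors_eq_cminor:
  assumes "M \<in> carrier_mat n n"
  shows "minors k M = {cminor M f g | f g. config n f \<and> config n g \<and> f 0 = k \<and> g 0 = k}"
proof (intro equalityI subsetI)
  fix x assume "x \<in> minors k M"
  then obtain I J where IJ: "I \<subseteq> {..<n}" "J \<subseteq> {..<n}" "card I = k" "card J = k"
    "x = det (submatrix M I J)"
    using assms by (auto simp: minors_def)
  then have fin: "finite I" "finite J" using finite_subset by blast+
  have "x = cminor M (count_from I) (count_from J)"
    using minor_submatrix[OF assms IJ(1,2)] IJ(3-5) by (simp add: cminor_def occ_count_from fin)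
  moreover have "config n (count_from I)" "config n (count_from J)" "count_from I 0 = k" "count_from J 0 = k"
    using IJ by (simp_all add: config_count_from count_from_0)
  ultimately show "x \<in> {cminor M f g | f g. config n f \<and> config n g \<and> f 0 = k \<and> g 0 = k}"
    by blast
next
  fix x assume "x \<in> {cminor M f g | f g. config n f \<and> config n g \<and> f 0 = k \<and> g 0 = k}"
  then obtain f g where fg: "config n f" "config n g" "f 0 = k" "g 0 = k" "x = cminor M f g" by auto
  have "x = det (submatrix M (occ f) (occ g))"
    using minor_submatrix[OF assms occ_subset[OF fg(1)] occ_subset[OF fg(2)]]
    by (simp add: cminor_def card_occ[OF fg(1)] card_occ[OF fg(2)] fg(3-5))
  moreover have "occ f \<subseteq> {..<dim_row M}" "occ g \<subseteq> {..<dim_col M}"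
    using assms occ_subset fg by auto
  moreover have "card (occ f) = k" "card (occ g) = k" using fg by (simp_all add: card_occ)
  ultimately show "x \<in> minors k M" unfolding minors_def by blast
qed

lemma minors_power_pos_iff:
  assumes "factored n w A"
  shows "(\<forall>x\<in>minors k (A ^\<^sub>m m). x > 0) \<longleftrightarrow> mixed n w k m"
proof -
  have c: "A ^\<^sub>m m \<in> carrier_mat n n" using factored_carrier[OF assms] by simp
  show ?thesis
  proof -
    have "cminor (A ^\<^sub>m m) f g > 0 \<longleftrightarrow> (round_step n w ^^ m) f g"
      if "config n f" "config n g" "f 0 = k" "g 0 = k" for f g
      using cminor_power[OF assms that(1)] that by simp
    then show ?thesis using c unfolding mixed_def by (simp add: minors_eq_cminor) blast
  qed
qed

lemma factored_TN:
  assumes "factored n w A"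
  shows "totally_nonnegative A"
proof -
  have "A ^\<^sub>m 1 = A" using factored_carrier[OF assms] by simp
  then have "cminor A f g \<ge> 0" if "config n f" "config n g" "f 0 = k" "g 0 = k" for f g k
    using conjunct1[OF cminor_power[OF assms that(1), of 1]] that unfolding nn_row_def by simp
  then show ?thesis
    unfolding totally_nonnegative_def minors_eq_cminor[OF factored_carrier[OF assms]] by blast
qed

lemma totally_nonnegative_TN:
  assumes "totally_nonnegative A" "A \<in> carrier_mat n n"
  shows "TN n A"
  unfolding TN_def
proof (intro conjI allI impI)
  fix k r c assume rc: "idx n k r" "idx n k c"
  show "mdet A k r c \<ge> 0"
  proof (cases "k = 0")
    case False
    have "det (submatrix A (r ` {..<k}) (c ` {..<k})) = mdet A k r c"
      using rc minor_submatrix[OF assms(2), of "r ` {..<k}" "c ` {..<k}"]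
      by (simp add: minor_image card_image_idx) (auto simp: idx_def)
    moreover have "det (submatrix A (r ` {..<k}) (c ` {..<k})) \<in> minors k A"
    proof -
      have "r ` {..<k} \<subseteq> {..<dim_row A}" "c ` {..<k} \<subseteq> {..<dim_col A}"
        using rc assms(2) by (auto simp: idx_def)
      then show ?thesis using card_image_idx[OF rc(1)] card_image_idx[OF rc(2)]
        unfolding minors_def by blast
    qed
    moreover have "k \<ge> 1" using False by simp
    ultimately show ?thesis using assms(1) unfolding totally_nonnegative_def by metis
  qed (simp add: mdet_def)
qed (rule assms(2))

subsection \<open>Bounds for the number of rounds\<close>

lemma reach_append: "reach n (v @ w) f g \<longleftrightarrow> (\<exists>h. reach n v f h \<and> reach n w h g)"
  by (induction v arbitrary: f) auto

lemma reach_refl: "reach n w f f"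
  by (induction w) auto

lemma reach_subseq: "subseq v w \<Longrightarrow> reach n v f g \<Longrightarrow> reach n w f g"
  by (induction arbitrary: f rule: list_emb.induct) (auto simp: reach_refl)

lemma reach_mono: "reach n w f g \<Longrightarrow> f l \<le> g l"
proof (induction w arbitrary: f)
  case (Cons i w)
  then show ?case by (auto split: if_splits) (metis (mono_tags, lifting) Suc_leD fun_upd_apply)
qed simp

lemma reach_notin: "reach n w f g \<Longrightarrow> l \<notin> set w \<Longrightarrow> g l = f l"
  by (induction w arbitrary: f) auto

lemma config_max:
  assumes "config n f" "config n g"
  shows "config n (\<lambda>l. max (f l) (g l))"
  using assms unfolding config_def by (auto simp: max_def) (metis le_trans nat_le_linear not_less_eq_eq)+

lemma config_ge_packed_low: "config n f \<Longrightarrow> f 0 - l \<le> f l"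
proof (induction l)
  case (Suc l)
  then show ?case using config_Suc[of n f l] by auto
qed simp

lemma config_le_0: "config n f \<Longrightarrow> f l \<le> f 0"
proof (induction l)
  case (Suc l)
  then show ?case using config_Suc[of n f l] by auto
qed simp

lemma config_le_diff:
  assumes "config n f" "l \<le> n"
  shows "f l \<le> n - l"
  using assms(2)
proof (induction rule: inc_induct)
  case base
  then show ?case using assms(1) by (simp add: config_zero)
next
  case (step l)
  then show ?case using config_Suc[OF assms(1), of l] by auto
qed

text \<open>A stationary background \<open>g\<close> may be overlaid on a climb: where
  \<open>g\<close> already reaches the raised value the letter is skipped, otherwise the same hop is
  legal for the maximum.\<close>

lemma reach_max:
  assumes "reach n w f f'" "config n f" "config n g"
  shows "reach n w (\<lambda>l. max (f l) (g l)) (\<lambda>l. max (f' l) (g l))"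
  using assms(1,2)
proof (induction w arbitrary: f)
  case (Cons i w)
  show ?case
  proof (cases "reach n w f f'")
    case True
    then show ?thesis using Cons by simp
  next
    case False
    define h where "h = f(i := Suc (f i))"
    have h: "config n h" "reach n w h f'" using Cons.prems(1) False by (auto simp: h_def)
    note IH = Cons.IH[OF h(2,1)]
    show ?thesis
    proof (cases "Suc (f i) \<le> g i")
      case True
      then have "(\<lambda>l. max (h l) (g l)) = (\<lambda>l. max (f l) (g l))" by (auto simp: h_def)
      then show ?thesis using IH by simp
    next
      case False
      then have "(\<lambda>l. max (h l) (g l)) = (\<lambda>l. max (f l) (g l))(i := Suc (max (f i) (g i)))"
        by (auto simp: h_def)
      then show ?thesis using IH config_max[OF h(1) assms(3)] by simp
    qed
  qed
qed simp

text \<open>Undo a climb to \<open>f\<close> while performing a climb to \<open>g\<close>: pointwise maxima of configurations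
  are configurations, so both motions can be superposed.\<close>

lemma rounds_from_reaches:
  assumes "(reach n w ^^ m) f0 f" "(reach n w ^^ m) g0 g" "config n f0" "config n g0" "0 \<notin> set w"
  shows "(round_step n w ^^ m) (\<lambda>l. max (f l) (g0 l)) (\<lambda>l. max (f0 l) (g l))"
  using assms(1-4)
proof (induction m arbitrary: f g0)
  case (Suc m)
  have c: "config n f'" if "(reach n w ^^ m) f0 f'" for f' m
    using that
  proof (induction m arbitrary: f')
    case (Suc m)
    then show ?case using reach_config[OF _ _ assms(5)] by auto
  qed (use assms(3) in simp)
  obtain f1 where f1: "(reach n w ^^ m) f0 f1" "reach n w f1 f" using Suc.prems(1) by auto
  obtain g1 where g1: "reach n w g0 g1" "(reach n w ^^ m) g1 g"
    using Suc.prems(2) by (metis relpowp_Suc_D2)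
  have cf: "config n f1" using c f1 by blast
  have cg: "config n g1" using reach_config[OF g1(1) Suc.prems(4) assms(5)] by simp
  \<comment> \<open>One round undoes the last climb towards \<open>f\<close> and performs the first
    climb from \<open>g0\<close>; its low point is the maximum of \<open>f1\<close> and
    \<open>g0\<close>.\<close>
  have "round_step n w (\<lambda>l. max (f l) (g0 l)) (\<lambda>l. max (f1 l) (g1 l))"
    unfolding round_step_def
  proof (intro exI conjI)
    show "config n (\<lambda>l. max (f1 l) (g0 l))" by (rule config_max[OF cf Suc.prems(4)])
    show "reach n w (\<lambda>l. max (f1 l) (g0 l)) (\<lambda>l. max (f l) (g0 l))"
      by (rule reach_max[OF f1(2) cf Suc.prems(4)])
    show "reach n w (\<lambda>l. max (f1 l) (g0 l)) (\<lambda>l. max (f1 l) (g1 l))"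
      using reach_max[OF g1(1) Suc.prems(4) cf] by (simp add: max.commute)
  qed
  then show ?case using Suc.IH[OF f1(1) g1(2) Suc.prems(3) cg] by (metis relpowp_Suc_I2)
qed simp

section \<open>Greedy climbing and upper bounds\<close>

definition packed_low :: "nat \<Rightarrow> nat \<Rightarrow> nat" where
  "packed_low k = (\<lambda>l. k - l)"

definition packed_high :: "nat \<Rightarrow> nat \<Rightarrow> nat \<Rightarrow> nat" where
  "packed_high n k = (\<lambda>l. min k (n - l))"

lemma config_packed_low: "k \<le> n \<Longrightarrow> config n (packed_low k)"
  by (auto simp: config_def packed_low_def)

lemma config_packed_high: "k \<le> n \<Longrightarrow> config n (packed_high n k)"
  by (auto simp: config_def packed_high_def)

text \<open>Here \<open>u l\<close> tells whether the letter \<open>l\<close> is used before \<open>l - 1\<close>, so that a particle moved by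
  \<open>l - 1\<close> has to wait for the next round before it is moved by \<open>l\<close>.\<close>

definition delay :: "(nat \<Rightarrow> bool) \<Rightarrow> nat \<Rightarrow> nat" where
  "delay u l = card {i \<in> {2..l}. u i}"

lemma delay_Suc: "delay u (Suc l) = delay u l + (if u (Suc l) \<and> 1 \<le> l then 1 else 0)"
proof -
  have "{i \<in> {2..Suc l}. u i} = {i \<in> {2..l}. u i} \<union> (if u (Suc l) \<and> 1 \<le> l then {Suc l} else {})"
    by (auto simp: le_Suc_eq)
  then show ?thesis by (simp add: delay_def card_Un_disjoint)
qed

lemma delay_diff:
  assumes "l \<le> l'" "1 \<le> l"
  shows "delay u l' = delay u l + card {i \<in> {l<..l'}. u i}"
proof -
  have "{i \<in> {2..l'}. u i} = {i \<in> {2..l}. u i} \<union> {i \<in> {l<..l'}. u i}"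
    using assms by auto
  then show ?thesis unfolding delay_def
    by (subst card_Un_disjoint[symmetric]) auto
qed

lemma delay_mono: "l \<le> l' \<Longrightarrow> delay u l \<le> delay u l'"
  unfolding delay_def by (rule card_mono) auto

lemma delay_le: "l \<le> l' \<Longrightarrow> delay u l' \<le> delay u l + (l' - l)"
proof (induction l' rule: dec_induct)
  case (step l')
  then show ?case by (auto simp: delay_Suc)
qed simp

definition occurrences :: "nat \<Rightarrow> nat list \<Rightarrow> (nat \<Rightarrow> nat) \<Rightarrow> bool" where
  "occurrences n w pos \<longleftrightarrow> set w \<subseteq> {1..<n} \<and> (\<forall>l\<in>{1..<n}. pos l < length w \<and> w ! pos l = l)"

text \<open>All moves allowed by the word are made as long as the configuration stays below the target \<open>F\<close>.
  The lower bound \<open>m + H - delay u l\<close> at \<open>l\<close> improves by one when the chosen occurrence of \<open>l\<close> is processed,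
  because a blocked letter has a neighbour that already satisfies the corresponding bound.\<close>

lemma greedy_pass:
  assumes pos: "occurrences n w pos" and f: "config n f" "config n F" "F 0 = f 0" "\<And>l. f l \<le> F l"
    and lower: "\<And>l. l \<in> {1..<n} \<Longrightarrow> F l \<le> f l \<or> m + H \<le> f l + delay u l"
    and u: "\<And>l. u l \<longleftrightarrow> pos l < pos (l - 1)"
  obtains g where "reach n w f g" "config n g" "g 0 = f 0" "\<And>l. g l \<le> F l"
    "\<And>l. l \<in> {1..<n} \<Longrightarrow> F l \<le> g l \<or> Suc m + H \<le> g l + delay u l"
proof -
  \<comment> \<open>Invariant for prefixes of the word: the gain of one is granted at
    \<open>l\<close> as soon as the chosen occurrence \<open>pos l\<close> has been read. Other
    occurrences may move particles too, but no gain is claimed for them.\<close>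
  let ?P = "\<lambda>t g. reach n (take t w) f g \<and> config n g \<and> (\<forall>l. g l \<le> F l) \<and>
    (\<forall>l\<in>{1..<n}. F l \<le> g l \<or> m + H + (if pos l < t then 1 else 0) \<le> g l + delay u l)"
  have 0: "0 \<notin> set w" using pos by (auto simp: occurrences_def)
  have "\<exists>g. ?P t g" if "t \<le> length w" for t
    using that
  proof (induction t)
    case 0
    then show ?case using f lower by (intro exI[of _ f]) auto
  next
    case (Suc t)
    then obtain g where g: "reach n (take t w) f g" "config n g" "\<And>l. g l \<le> F l"
      "\<And>l. l \<in> {1..<n} \<Longrightarrow> F l \<le> g l \<or> m + H + (if pos l < t then 1 else 0) \<le> g l + delay u l"
      by auto
    define i where "i = w ! t"
    have i: "i \<in> {1..<n}" using pos Suc.prems unfolding occurrences_def i_def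
      by (metis Suc_le_lessD nth_mem subsetD)
    have tk: "take (Suc t) w = take t w @ [i]" using Suc.prems by (simp add: take_Suc_conv_app_nth i_def)
    have neq: "pos l \<noteq> t" if "l \<in> {1..<n}" "l \<noteq> i" for l
      using that pos by (auto simp: occurrences_def i_def)
    have g0: "g 0 = F 0" using reach_config[OF g(1) f(1)] 0 f(3) by (metis in_set_takeD)
    show ?case
    proof (cases "g i < F i \<and> config n (g(i := Suc (g i)))")
      case True
      define g' where "g' = g(i := Suc (g i))"
      have "reach n (take (Suc t) w) f g'" using g(1) True unfolding tk reach_append g'_def by auto
      moreover have "F l \<le> g' l \<or> m + H + (if pos l < Suc t then 1 else 0) \<le> g' l + delay u l"
        if "l \<in> {1..<n}" for l
        using g(4)[OF that] neq[OF that] by (cases "l = i") (auto simp: g'_def)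
      moreover have "config n g'" "\<forall>l. g' l \<le> F l" using True g(3) by (auto simp: g'_def)
      ultimately show ?thesis by blast
    next
      case False
      have r: "reach n (take (Suc t) w) f g" using g(1) unfolding tk reach_append by auto
      have "F i \<le> g i \<or> m + H + (if pos i < Suc t then 1 else 0) \<le> g i + delay u i"
      proof (cases "pos i = t")
        case False
        then show ?thesis using g(4)[OF i] by auto
      next
        case pt: True
        show ?thesis
        proof (cases "F i \<le> g i")
          case False
          with \<open>\<not> (g i < F i \<and> config n (g(i := Suc (g i))))\<close>
          have "\<not> config n (g(i := Suc (g i)))" by simp
          \<comment> \<open>Empty source: \<open>g (i - 1) = g i\<close>, and either
            \<open>i - 1\<close> already has its gain or \<open>delay\<close> grows at
            \<open>i\<close>. Occupied target: \<open>g i = Suc (g (Suc i))\<close>, and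
            \<open>delay\<close> grows at \<open>Suc i\<close> only if \<open>Suc i\<close> was read
            before and has its gain.\<close>
          then consider "i - 1 \<notin> occ g" | "i \<in> occ g"
            using config_raise_iff[OF g(2), of i] i by auto
          then show ?thesis
          proof cases
            case 1
            then have e: "g (i - 1) = g i"
              using i config_Suc[OF g(2), of "i - 1"] by (auto simp: occ_def)
            show ?thesis
            proof (cases "i = 1")
              case True
              then show ?thesis using e g0 config_le_0[OF f(2), of i] by simp
            next
              case ni: False
              then have i1: "i - 1 \<in> {1..<n}" using i by auto
              have pi: "pos (i - 1) < t \<longleftrightarrow> \<not> u i"
                using u[of i] neq[OF i1] ni i1 pt by (cases "i - 1 = i") (auto simp: not_less_iff_gr_or_eq)
              have "F i \<le> F (i - 1)" using config_Suc[OF f(2), of "i - 1"] i by auto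
              moreover have "delay u i = delay u (i - 1) + (if u i then 1 else 0)"
                using delay_Suc[of u "i - 1"] ni i1 by auto
              ultimately show ?thesis using g(4)[OF i1] pi e pt by (auto split: if_splits)
            qed
          next
            case 2
            then have e: "g i = Suc (g (Suc i))"
              using config_Suc[OF g(2), of i] by (auto simp: occ_def)
            have Fi: "F i \<le> Suc (F (Suc i))" using config_Suc[OF f(2), of i] by auto
            show ?thesis
            proof (cases "Suc i = n")
              case True
              then show ?thesis using Fi e f(2) by (simp add: config_zero)
            next
              case ni: False
              then have i1: "Suc i \<in> {1..<n}" using i by auto
              have pi: "pos (Suc i) < t \<longleftrightarrow> u (Suc i)"
                using u[of "Suc i"] pt by auto
              then show ?thesis using g(4)[OF i1] Fi e pt i by (auto simp: delay_Suc split: if_splits)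
            qed
          qed
        qed simp
      qed
      moreover have "F l \<le> g l \<or> m + H + (if pos l < Suc t then 1 else 0) \<le> g l + delay u l"
        if "l \<in> {1..<n}" "l \<noteq> i" for l
        using g(4)[OF that(1)] neq[OF that] by auto
      ultimately show ?thesis using r g(2,3) by (intro exI[of _ g]) blast
    qed
  qed
  from this[of "length w"] obtain g where g: "?P (length w) g" by auto
  show thesis
  proof (rule that[of g])
    show "reach n w f g" "config n g" using g by auto
    then show "g 0 = f 0" using reach_config[OF _ f(1) 0] by blast
    show "g l \<le> F l" for l using g by auto
    show "F l \<le> g l \<or> Suc m + H \<le> g l + delay u l" if "l \<in> {1..<n}" for l
      using g that pos by (auto simp: occurrences_def)
  qed
qed

lemma greedy_passes:
  assumes pos: "occurrences n w pos" and F: "config n F" "F 0 = k" and k: "1 \<le> k" "k < n"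
    and u: "\<And>l. u l \<longleftrightarrow> pos l < pos (l - 1)"
  shows "\<exists>g. (reach n w ^^ m) (packed_low k) g \<and> config n g \<and> g 0 = k \<and> (\<forall>l. g l \<le> F l) \<and>
    (\<forall>l\<in>{1..<n}. F l \<le> g l \<or> m + delay u k \<le> g l + delay u l)"
proof (induction m)
  case 0
  \<comment> \<open>\<open>delay\<close> grows by at most one per position, so the packed start
    satisfies the bound with \<open>delay u k\<close> in the role of \<open>H\<close>.\<close>
  have "delay u k \<le> packed_low k l + delay u l" for l
    using delay_le[of l k u] delay_mono[of k l u] by (cases "l \<le> k") (auto simp: packed_low_def)
  moreover have "packed_low k l \<le> F l" for l using config_ge_packed_low[OF F(1), of l] F(2) by (simp add: packed_low_def)
  moreover have "config n (packed_low k)" "packed_low k 0 = k" using k by (simp add: config_packed_low) (simp add: packed_low_def)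
  ultimately show ?case by (intro exI[of _ "packed_low k"]) simp
next
  case (Suc m)
  then obtain g where g: "(reach n w ^^ m) (packed_low k) g" "config n g" "g 0 = k" "\<And>l. g l \<le> F l"
    "\<And>l. l \<in> {1..<n} \<Longrightarrow> F l \<le> g l \<or> m + delay u k \<le> g l + delay u l" by auto
  have "F 0 = g 0" using F(2) g(3) by simp
  from greedy_pass[OF pos g(2) F(1) this g(4,5) u] obtain g' where
    "reach n w g g'" "config n g'" "g' 0 = g 0" "\<And>l. g' l \<le> F l"
    "\<And>l. l \<in> {1..<n} \<Longrightarrow> F l \<le> g' l \<or> Suc m + delay u k \<le> g' l + delay u l" by metis
  then show ?case using g(1,3) by (intro exI[of _ g']) auto
qed

text \<open>A target satisfies \<open>F l \<le> min k (n - l)\<close>, and the two caps meet at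
  \<open>l = n - k\<close>. There the hypothesis on \<open>m\<close> suffices, and elsewhere it does
  because \<open>delay\<close> is monotone with increments at most one. Arbitrary pairs of
  configurations follow by superposing two climbs from the packed start.\<close>

lemma mixed_if:
  assumes pos: "occurrences n w pos" and k: "1 \<le> k" "k < n"
    and u: "\<And>l. u l \<longleftrightarrow> pos l < pos (l - 1)"
    and m: "k + delay u (n - k) \<le> m + delay u k"
  shows "mixed n w k m"
  unfolding mixed_def
proof (intro allI impI)
  have up: "(reach n w ^^ m) (packed_low k) F" if F: "config n F" "F 0 = k" for F
  proof -
    obtain g where g: "(reach n w ^^ m) (packed_low k) g" "config n g" "g 0 = k" "\<And>l. g l \<le> F l"
      "\<And>l. l \<in> {1..<n} \<Longrightarrow> F l \<le> g l \<or> m + delay u k \<le> g l + delay u l"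
      using greedy_passes[OF pos F k u] by metis
    have "F l \<le> g l" for l
    proof -
      consider "l = 0" | "l \<ge> n" | "l \<in> {1..<n}" by fastforce
      then show ?thesis
      proof cases
        case 3
        have "F l \<le> k" "F l \<le> n - l" using config_le_0[OF F(1), of l] F(2) config_le_diff[OF F(1), of l] 3 by auto
        then show ?thesis
          using g(5)[OF 3] m delay_mono[of l "n - k" u] delay_le[of "n - k" l u] k 3
          by (cases "l \<le> n - k") auto
      qed (use F g in \<open>auto simp: config_zero\<close>)
    qed
    with g(4) have "g = F" by (auto intro: order_antisym)
    with g(1) show ?thesis by simp
  qed
  fix f g assume f: "config n f" "f 0 = k" and g: "config n g" "g 0 = k"
  have "0 \<notin> set w" using pos by (auto simp: occurrences_def)
  from rounds_from_reaches[OF up[OF f] up[OF g] _ _ this]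
  have "(round_step n w ^^ m) (\<lambda>l. max (f l) (packed_low k l)) (\<lambda>l. max (packed_low k l) (g l))"
    using k by (simp add: config_packed_low)
  moreover have "(\<lambda>l. max (f l) (packed_low k l)) = f" "(\<lambda>l. max (packed_low k l) (g l)) = g"
    using config_ge_packed_low[OF f(1)] config_ge_packed_low[OF g(1)] f(2) g(2)
    by (auto simp: packed_low_def max_def intro!: ext le_antisym)
  ultimately show "(round_step n w ^^ m) f g" by simp
qed


section \<open>Invariants and lower bounds\<close>

lemma reach_letter:
  assumes "reach n (xs @ l # ys) f g" "config n f" "0 < l" "l < n" "l \<notin> set xs" "l \<notin> set ys"
    "0 \<notin> set xs"
  shows "g l = f l \<or> g l = Suc (f l) \<and>
    (l - 1 \<notin> set xs \<longrightarrow> g l = f (l - 1)) \<and> (l - 1 \<notin> set ys \<longrightarrow> g l = g (l - 1)) \<and>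
    (Suc l \<notin> set xs \<longrightarrow> g l = Suc (f (Suc l))) \<and> (Suc l \<notin> set ys \<longrightarrow> g l = Suc (g (Suc l)))"
proof -
  obtain h where h: "reach n xs f h" "reach n (l # ys) h g" using assms(1) by (auto simp: reach_append)
  have ch: "config n h" using reach_config[OF h(1) assms(2,7)] by simp
  have hl: "h l = f l" by (rule reach_notin[OF h(1) assms(5)])
  show ?thesis
  proof (cases "reach n ys h g")
    case True
    then show ?thesis using reach_notin[OF True assms(6)] hl by simp
  next
    case False
    define h' where "h' = h(l := Suc (h l))"
    have h': "config n h'" "reach n ys h' g" using h(2) False by (auto simp: h'_def)
    have gl: "g l = Suc (h l)" using reach_notin[OF h'(2) assms(6)] by (simp add: h'_def)
    \<comment> \<open>Legality of the only hop at \<open>l\<close> fixes both neighbouring values at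
      that moment. If the letter of a neighbour is missing from \<open>xs\<close>, that value is the
      initial one; if it is missing from \<open>ys\<close>, the final one.\<close>
    have "l - 1 \<in> occ h \<and> l \<notin> occ h"
      using config_raise_iff[OF ch assms(3,4)] h'(1) by (simp add: h'_def)
    then have e: "h (l - 1) = Suc (h l)" "h (Suc l) = h l"
      using config_Suc[OF ch, of "l - 1"] config_Suc[OF ch, of l] assms(3) by (auto simp: occ_def)
    have 1: "f i = h i" if "i \<notin> set xs" for i using reach_notin[OF h(1) that] by simp
    have 2: "g i = h i" if "i \<notin> set ys" "i \<noteq> l" for i
      using reach_notin[OF h'(2) that(1)] that(2) by (simp add: h'_def)
    show ?thesis using gl hl e 1[of "l - 1"] 1[of "Suc l"] 2[of "l - 1"] 2[of "Suc l"] assms(3) by auto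
  qed
qed

text \<open>The descending half of a round only lowers values, so a downward closed \<open>P\<close>
  has to be checked for climbs alone. The passage from the lowest to the highest packing then turns
  \<open>mixed\<close> into a bound on \<open>m\<close>.\<close>

lemma rounds_invariant:
  assumes step: "\<And>m b g. P m b \<Longrightarrow> config n b \<Longrightarrow> b 0 = k \<Longrightarrow> reach n w b g \<Longrightarrow> P (Suc m) g"
    and down: "\<And>m f b. P m f \<Longrightarrow> (\<And>l. b l \<le> f l) \<Longrightarrow> P m b"
    and base: "P 0 (packed_low k)" and w: "0 \<notin> set w" and k: "k \<le> n" and mixed: "mixed n w k m"
  shows "P m (packed_high n k)"
proof -
  have "P m g \<and> config n g \<and> g 0 = k" if "(round_step n w ^^ m) (packed_low k) g" for g
    using that
  proof (induction m arbitrary: g)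
    case 0
    then show ?case using base k by (auto simp: config_packed_low) (simp add: packed_low_def)
  next
    case (Suc m)
    then obtain h where h: "(round_step n w ^^ m) (packed_low k) h" "round_step n w h g" by auto
    then obtain b where b: "config n b" "reach n w b h" "reach n w b g" by (auto simp: round_step_def)
    from Suc.IH[OF h(1)] have P: "P m h" "h 0 = k" by auto
    have "b 0 = k" using reach_config[OF b(2,1) w] P(2) by simp
    moreover have "P m b" by (rule down[OF P(1) reach_mono[OF b(2)]])
    ultimately show ?case using step b reach_config[OF b(3,1) w] by auto
  qed
  moreover have "(round_step n w ^^ m) (packed_low k) (packed_high n k)"
  proof -
    have "packed_low k 0 = k" "packed_high n k 0 = k" using k by (auto simp: packed_low_def packed_high_def)
    then show ?thesis using mixed config_packed_low[OF k] config_packed_high[OF k] unfolding mixed_def by blast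
  qed
  ultimately show ?thesis by blast
qed

text \<open>Every letter occurs once. Up to exchanging commuting letters, such a word is determined
  by which of \<open>l\<close> and \<open>l - 1\<close> comes first, and \<open>u l\<close> says
  that \<open>l\<close> does.\<close>

fun coxeter_word :: "(nat \<Rightarrow> bool) \<Rightarrow> nat \<Rightarrow> nat list" where
  "coxeter_word u 0 = []"
| "coxeter_word u (Suc l) = (if u (Suc l) then Suc l # coxeter_word u l else coxeter_word u l @ [Suc l])"

lemma set_coxeter_word: "set (coxeter_word u N) = {1..N}"
  by (induction N) (auto simp: le_Suc_eq)

lemma coxeter_word_split:
  assumes "1 \<le> l" "l \<le> N"
  shows "\<exists>xs ys. coxeter_word u N = xs @ l # ys \<and> l \<notin> set xs \<and> l \<notin> set ys \<and>
    (u l \<longrightarrow> l - 1 \<notin> set xs) \<and> (\<not> u l \<longrightarrow> l - 1 \<notin> set ys) \<and>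
    (u (Suc l) \<longrightarrow> Suc l \<notin> set ys) \<and> (\<not> u (Suc l) \<longrightarrow> Suc l \<notin> set xs)"
  using assms
proof (induction N)
  case (Suc N)
  show ?case
  proof (cases "l = Suc N")
    case True
    show ?thesis
    proof (cases "u (Suc N)")
      case u: True
      show ?thesis
        by (rule exI[of _ "[]"], rule exI[of _ "coxeter_word u N"])
          (use True u in \<open>auto simp: set_coxeter_word\<close>)
    next
      case u: False
      show ?thesis
        by (rule exI[of _ "coxeter_word u N"], rule exI[of _ "[]"])
          (use True u in \<open>auto simp: set_coxeter_word\<close>)
    qed
  next
    case False
    with Suc obtain xs ys where IH: "coxeter_word u N = xs @ l # ys" "l \<notin> set xs" "l \<notin> set ys"
      "u l \<longrightarrow> l - 1 \<notin> set xs" "\<not> u l \<longrightarrow> l - 1 \<notin> set ys"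
      "u (Suc l) \<longrightarrow> Suc l \<notin> set ys" "\<not> u (Suc l) \<longrightarrow> Suc l \<notin> set xs" by auto
    have N: "Suc N \<notin> set xs" "Suc N \<notin> set ys"
    proof -
      have "Suc N \<notin> set (coxeter_word u N)" by (simp add: set_coxeter_word)
      then show "Suc N \<notin> set xs" "Suc N \<notin> set ys" unfolding IH(1) by auto
    qed
    have l: "l \<le> N" using False Suc.prems by simp
    show ?thesis
    proof (cases "u (Suc N)")
      case u: True
      show ?thesis
        by (rule exI[of _ "Suc N # xs"], rule exI[of _ ys]) (use u IH N l in auto)
    next
      case u: False
      show ?thesis
        by (rule exI[of _ xs], rule exI[of _ "ys @ [Suc N]"]) (use u IH N l in auto)
    qed
  qed
qed simp

text \<open>With a single occurrence per letter the greedy estimate is exact: the invariant caps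
  every value by its packed start or by the greedy bound. It is anchored at \<open>l = k\<close>,
  where the start is 0 and a round adds at most one, and spreads outwards from there.\<close>

lemma coxeter_lower_bound:
  assumes k: "1 \<le> k" "k < n" and mixed: "mixed n (coxeter_word u (n - 1)) k m"
  shows "k + delay u (n - k) \<le> m + delay u k"
proof -
  let ?w = "coxeter_word u (n - 1)"
  let ?P = "\<lambda>m (f :: nat \<Rightarrow> nat). \<forall>l\<in>{1..<n}. f l \<le> k - l \<or> f l + delay u l \<le> m + delay u k"
  have w: "set ?w = {1..<n}" using k by (auto simp: set_coxeter_word)
  have "?P m (packed_high n k)"
  proof (rule rounds_invariant[where P = ?P, OF _ _ _ _ _ mixed])
    fix m b g assume P: "?P m b" and b: "config n b" "b 0 = k" and r: "reach n ?w b g"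
    have letter: "g l = b l \<or> g l = Suc (b l) \<and> (u l \<longrightarrow> g l = b (l - 1)) \<and>
      (\<not> u l \<longrightarrow> g l = g (l - 1)) \<and> (\<not> u (Suc l) \<longrightarrow> g l = Suc (b (Suc l))) \<and>
      (u (Suc l) \<longrightarrow> g l = Suc (g (Suc l)))" if l: "l \<in> {1..<n}" for l
    proof -
      obtain xs ys where s: "?w = xs @ l # ys" "l \<notin> set xs" "l \<notin> set ys"
        "u l \<longrightarrow> l - 1 \<notin> set xs" "\<not> u l \<longrightarrow> l - 1 \<notin> set ys"
        "u (Suc l) \<longrightarrow> Suc l \<notin> set ys" "\<not> u (Suc l) \<longrightarrow> Suc l \<notin> set xs"
      proof -
        have "1 \<le> l" "l \<le> n - 1" using l by auto
        from coxeter_word_split[OF this, of u] show ?thesis using that by blast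
      qed
      have "0 \<notin> set ?w" using w by simp
      then have "0 \<notin> set xs" unfolding s(1) by simp
      from reach_letter[OF r[unfolded s(1)] b(1) _ _ s(2,3) this] l s(4-7) show ?thesis by auto
    qed
    have mid: "g k + delay u k \<le> Suc m + delay u k"
    proof -
      have "b k \<le> m" using bspec[OF P, of k] k by auto
      then show ?thesis using letter[of k] k by auto
    qed
    \<comment> \<open>To the right of \<open>k\<close> a raise at \<open>Suc l\<close> copies the
      value at \<open>l\<close>, taken before or after the climb according to
      \<open>u (Suc l)\<close>; the lost round is exactly the increment of
      \<open>delay\<close>.\<close>
    have up: "l < n \<Longrightarrow> g l \<le> k - l \<or> g l + delay u l \<le> Suc m + delay u k" if "k \<le> l" for l
      using that
    proof (induction rule: dec_induct)
      case (step l)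
      show ?case
      proof (cases "g (Suc l) = b (Suc l)")
        case True
        then show ?thesis using bspec[OF P, of "Suc l"] step k by auto
      next
        case False
        have Bl: "b l \<le> k - l \<or> b l + delay u l \<le> m + delay u k" using bspec[OF P, of l] step k by auto
        have d: "delay u (Suc l) = delay u l + (if u (Suc l) then 1 else 0)"
          using step k by (simp add: delay_Suc)
        show ?thesis
          using letter[of "Suc l"] False step Bl d by (cases "u (Suc l)") auto
      qed
    qed (use mid in simp)
    have down: "1 \<le> l \<Longrightarrow> g l \<le> k - l \<or> g l + delay u l \<le> Suc m + delay u k" if "l \<le> k" for l
      using that
    proof (induction rule: inc_induct)
      case (step l)
      show ?case
      proof (cases "g l = b l")
        case True
        then show ?thesis using bspec[OF P, of l] step k by auto
      next
        case False
        have Bl: "b (Suc l) \<le> k - Suc l \<or> b (Suc l) + delay u (Suc l) \<le> m + delay u k"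
          using bspec[OF P, of "Suc l"] step k by auto
        have d: "delay u (Suc l) = delay u l + (if u (Suc l) then 1 else 0)"
          using step k by (simp add: delay_Suc)
        show ?thesis
          using letter[of l] False step Bl d k by (cases "u (Suc l)") auto
      qed
    qed (use mid in simp)
    show "?P (Suc m) g"
    proof
      fix l assume "l \<in> {1..<n}"
      then show "g l \<le> k - l \<or> g l + delay u l \<le> Suc m + delay u k"
        using up[of l] down[of l] by (cases "k \<le> l") auto
    qed
  next
    fix m and f b :: "nat \<Rightarrow> nat" assume P: "?P m f" and le: "\<And>l. b l \<le> f l"
    show "?P m b"
    proof
      fix l assume "l \<in> {1..<n}"
      with P have "f l \<le> k - l \<or> f l + delay u l \<le> m + delay u k" by blast
      with le[of l] show "b l \<le> k - l \<or> b l + delay u l \<le> m + delay u k" by linarith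
    qed
  qed (use k w in \<open>auto simp: packed_low_def\<close>)
  from bspec[OF this, of "n - k"]
  have "packed_high n k (n - k) \<le> k - (n - k) \<or> packed_high n k (n - k) + delay u (n - k) \<le> m + delay u k"
    using k by auto
  moreover have "packed_high n k (n - k) = k" using k by (simp add: packed_high_def)
  ultimately show ?thesis using k by auto
qed

text \<open>In a descending block letter \<open>l\<close> is read after \<open>l + 1\<close> and
  before \<open>l - 1\<close>, so a raise sees the old value on the left and the new one on the
  right: particles advance at most one step.\<close>

lemma descending_pass:
  assumes r: "reach n (rev [c..<n]) b h" and b: "config n b" and c: "1 \<le> c" and l: "1 \<le> l"
  shows "h l = b l \<or> c \<le> l \<and> h l = Suc (b l) \<and> h l = b (l - 1) \<and> h l = Suc (h (Suc l))"
proof (cases "c \<le> l \<and> l < n")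
  case True
  then have "[c..<n] = [c..<l] @ l # [Suc l..<n]"
    by (metis le_add_diff_inverse less_imp_le upt_add_eq_append upt_conv_Cons)
  then have s: "rev [c..<n] = rev [Suc l..<n] @ l # rev [c..<l]" by simp
  from reach_letter[OF r[unfolded s] b] l True c show ?thesis by auto
next
  case False
  then have "l \<notin> set (rev [c..<n])" by auto
  from reach_notin[OF r this] show ?thesis by simp
qed

lemma ascending_pass:
  assumes r: "reach n [1..<p + 1] h g" and h: "config n h" and p: "p < n" and l: "1 \<le> l"
  shows "g l = h l \<or> l \<le> p \<and> g l = Suc (h l) \<and> g l = Suc (h (Suc l))"
proof (cases "l \<le> p")
  case True
  then have s: "[1..<p + 1] = [1..<l] @ l # [Suc l..<p + 1]" using l
    using upt_add_eq_append[of 1 l "p + 1 - l"] by (simp add: upt_conv_Cons)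
  from reach_letter[OF r[unfolded s] h] l True p show ?thesis by auto
next
  case False
  then have "l \<notin> set [1..<p + 1]" by auto
  from reach_notin[OF r this] show ?thesis by simp
qed

lemma set_extremal_word:
  assumes "p < n" "q < n"
  shows "set (extremal_word n p q) \<subseteq> {1..<n}" "0 \<notin> set (extremal_word n p q)"
  using assms by (auto simp: extremal_word_def)

lemma extremal_lower_bound:
  assumes p: "1 \<le> p" "p < n" and q: "1 \<le> q" "q < n" and pq: "n \<le> p + q"
    and k: "1 \<le> k" "k < n" and mixed: "mixed n (extremal_word n p q) k m"
  shows "min (max k (n - p)) (max (n - k) (n - q)) \<le> m"
proof -
  let ?w = "extremal_word n p q"
  define c where "c = n - q + 1"
  have c: "1 \<le> c" "c \<le> n" using q by (auto simp: c_def)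
  have step: "\<exists>h. config n h \<and> (\<forall>l\<ge>1. h l = b l \<or> c \<le> l \<and> h l = Suc (b l) \<and> h l = b (l - 1) \<and> h l = Suc (h (Suc l))) \<and>
      (\<forall>l\<ge>1. g l = h l \<or> l \<le> p \<and> g l = Suc (h l) \<and> g l = Suc (h (Suc l)))"
    if b: "config n b" and r: "reach n ?w b g" for b g
  proof -
    obtain h where h: "reach n (rev [c..<n]) b h" "reach n [1..<p + 1] h g"
      using r by (auto simp: extremal_word_def reach_append c_def)
    have "config n h" using reach_config[OF h(1) b] c by simp
    then show ?thesis
      using descending_pass[OF h(1) b c(1)] ascending_pass[OF h(2) _ p(2)] by blast
  qed
  note w0 = set_extremal_word(2)[OF p(2) q(2)]
  have 1: "n - max p k \<le> m"
  proof -
    \<comment> \<open>Letters beyond \<open>p\<close> occur only in the descending block, where the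
      front advances one step; \<open>max p k\<close> absorbs the initial packing and the ascending
      block.\<close>
    let ?P = "\<lambda>m (f :: nat \<Rightarrow> nat). \<forall>l\<ge>max p k + m. f l = 0"
    have "?P m (packed_high n k)"
    proof (rule rounds_invariant[where P = ?P, OF _ _ _ w0 _ mixed])
      fix m b g assume P: "?P m b" and b: "config n b" "b 0 = k" "reach n ?w b g"
      obtain h where h: "\<And>l. l\<ge>1 \<Longrightarrow> h l = b l \<or> c \<le> l \<and> h l = Suc (b l) \<and> h l = b (l - 1) \<and> h l = Suc (h (Suc l))"
        "\<And>l. l\<ge>1 \<Longrightarrow> g l = h l \<or> l \<le> p \<and> g l = Suc (h l) \<and> g l = Suc (h (Suc l))"
        using step[OF b(1,3)] by blast
      show "?P (Suc m) g"
      proof (intro allI impI)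
        fix l assume l: "max p k + Suc m \<le> l"
        then have "g l = h l" "b l = 0" "b (l - 1) = 0" using h(2)[of l] P by auto
        then show "g l = 0" using h(1)[of l] l by auto
      qed
    next
      fix m and f b :: "nat \<Rightarrow> nat" assume P: "?P m f" and le: "\<And>l. b l \<le> f l"
      show "?P m b" using P le by (metis le_zero_eq)
    qed (use k in \<open>auto simp: packed_low_def\<close>)
    then have "\<not> max p k + m \<le> n - 1" using k by (auto simp: packed_high_def)
    then show ?thesis by linarith
  qed
  have 2: "min (n - q) k \<le> m"
  proof (rule ccontr)
    assume m: "\<not> ?thesis"
    \<comment> \<open>Below \<open>c\<close> only the ascending block acts, where \<open>l\<close>
      is read before \<open>l + 1\<close>; so a hole moves down by one per round, and the lowest
      positions stay packed until it arrives.\<close>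
    let ?P = "\<lambda>m (f :: nat \<Rightarrow> nat). \<forall>l. l + m \<le> min (n - q) k \<longrightarrow> f l \<le> k - l"
    have "?P m (packed_high n k)"
    proof (rule rounds_invariant[where P = ?P, OF _ _ _ w0 _ mixed])
      fix m b g assume P: "?P m b" and b: "config n b" "b 0 = k" "reach n ?w b g"
      obtain h where h: "\<And>l. l\<ge>1 \<Longrightarrow> h l = b l \<or> c \<le> l \<and> h l = Suc (b l) \<and> h l = b (l - 1) \<and> h l = Suc (h (Suc l))"
        "\<And>l. l\<ge>1 \<Longrightarrow> g l = h l \<or> l \<le> p \<and> g l = Suc (h l) \<and> g l = Suc (h (Suc l))"
        using step[OF b(1,3)] by blast
      have g0: "g 0 = k" using reach_config[OF b(3,1) w0] b(2) by simp
      show "?P (Suc m) g"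
      proof (intro allI impI)
        fix l assume l: "l + Suc m \<le> min (n - q) k"
        show "g l \<le> k - l"
        proof (cases "l = 0")
          case False
          then have "h l = b l" "h (Suc l) = b (Suc l)" using h(1)[of l] h(1)[of "Suc l"] l by (auto simp: c_def)
          moreover have "b l \<le> k - l" "b (Suc l) \<le> k - Suc l" using P l by auto
          ultimately show ?thesis using h(2)[of l] False l by auto
        qed (use g0 in simp)
      qed
    next
      fix m and f b :: "nat \<Rightarrow> nat" assume P: "?P m f" and le: "\<And>l. b l \<le> f l"
      show "?P m b" using P le by (meson le_trans)
    qed (use k in \<open>auto simp: packed_low_def\<close>)
    from this[rule_format, of 1] have "packed_high n k 1 \<le> k - 1"
      using m by (auto simp: min_le_iff_disj)
    then show False using k by (auto simp: packed_high_def)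
  qed
  have 3: "min k (n - k) \<le> m"
  proof -
    \<comment> \<open>The letter \<open>k\<close> may occur in both blocks. After acting in the
      descending block it leaves position \<open>k\<close> occupied, and in the ascending block it
      is read before \<open>k + 1\<close>, so it is blocked.\<close>
    let ?P = "\<lambda>m (f :: nat \<Rightarrow> nat). f k \<le> m"
    have "?P m (packed_high n k)"
    proof (rule rounds_invariant[where P = ?P, OF _ _ _ w0 _ mixed])
      fix m b g assume P: "?P m b" and b: "config n b" "b 0 = k" "reach n ?w b g"
      obtain h where h: "\<And>l. l\<ge>1 \<Longrightarrow> h l = b l \<or> c \<le> l \<and> h l = Suc (b l) \<and> h l = b (l - 1) \<and> h l = Suc (h (Suc l))"
        "\<And>l. l\<ge>1 \<Longrightarrow> g l = h l \<or> l \<le> p \<and> g l = Suc (h l) \<and> g l = Suc (h (Suc l))"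
        using step[OF b(1,3)] by blast
      show "?P (Suc m) g" using h(1)[OF k(1)] h(2)[OF k(1)] P by auto
    next
      fix m and f b :: "nat \<Rightarrow> nat" assume P: "?P m f" and le: "\<And>l. b l \<le> f l"
      show "?P m b" using P le[of k] by simp
    qed (use k in \<open>auto simp: packed_low_def\<close>)
    then show ?thesis by (simp add: packed_high_def)
  qed
  \<comment> \<open>The minimum is the largest of four pairwise minima. Three are the bounds above,
    and \<open>min (n - p) (n - q)\<close> is dominated by one of them since
    \<open>(n - p) + (n - q) \<le> k + (n - k)\<close>.\<close>
  show ?thesis using 1 2 3 pq k p q by (auto simp: min_def max_def split: if_splits)
qed

section \<open>Single particles, single holes and runs of letters\<close>

definition ascends :: "nat list \<Rightarrow> nat \<Rightarrow> nat \<Rightarrow> bool" where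
  "ascends w x y \<longleftrightarrow> (\<exists>pos. (\<forall>l\<in>{x<..y}. pos l < length w \<and> w ! pos l = l) \<and>
     (\<forall>l\<in>{x<..<y}. pos l < pos (Suc l)))"

text \<open>A lone particle climbs from \<open>x\<close> to \<open>y\<close> through the letters
  \<open>x + 1, ..., y\<close> (\<open>ascends\<close>), whereas climbing particles push a lone hole
  down from \<open>x\<close> to \<open>y\<close> through \<open>x, ..., y + 1\<close>. The witness
  is a choice of occurrences, as letters may repeat.\<close>

definition descends :: "nat list \<Rightarrow> nat \<Rightarrow> nat \<Rightarrow> bool" where
  "descends w x y \<longleftrightarrow> (\<exists>pos. (\<forall>l\<in>{y<..x}. pos l < length w \<and> w ! pos l = l) \<and>
     (\<forall>l\<in>{y<..<x}. pos (Suc l) < pos l))"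

definition particle :: "nat \<Rightarrow> nat \<Rightarrow> nat" where
  "particle x = count_from {x}"

definition hole :: "nat \<Rightarrow> nat \<Rightarrow> nat \<Rightarrow> nat" where
  "hole n x = count_from ({..<n} - {x})"

lemma particle_props:
  assumes "x < n"
  shows "config n (particle x)" "occ (particle x) = {x}" "particle x 0 = 1"
  using assms by (auto simp: particle_def config_count_from occ_count_from count_from_0)

lemma hole_props:
  assumes "x < n"
  shows "config n (hole n x)" "occ (hole n x) = {..<n} - {x}" "hole n x 0 = n - 1"
  using assms by (auto simp: hole_def config_count_from occ_count_from count_from_0)

lemma config_1_particle:
  assumes "config n f" "f 0 = 1"
  obtains x where "x < n" "f = particle x"
proof -
  have "card (occ f) = 1" using assms by (simp add: card_occ)
  then obtain x where x: "occ f = {x}" by (rule card_1_singletonE)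
  then have "x < n" using occ_subset[OF assms(1)] by auto
  with x count_from_occ[OF assms(1)] that show thesis by (simp add: particle_def)
qed

lemma config_hole:
  assumes "config n f" "f 0 = n - 1" "1 \<le> n"
  obtains x where "x < n" "f = hole n x"
proof -
  have "card ({..<n} - occ f) = 1" using assms occ_subset[OF assms(1)]
    by (subst card_Diff_subset) (auto simp: card_occ finite_subset)
  then obtain x where x: "{..<n} - occ f = {x}" by (rule card_1_singletonE)
  then have "x < n" "occ f = {..<n} - {x}" using occ_subset[OF assms(1)] by auto
  with count_from_occ[OF assms(1)] that show thesis by (simp add: hole_def)
qed

lemma raise_particle:
  assumes "x < n" "0 < i" "i < n"
  shows "config n ((particle x)(i := Suc (particle x i))) \<longleftrightarrow> i = Suc x"
    and "i = Suc x \<Longrightarrow> (particle x)(i := Suc (particle x i)) = particle i"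
proof -
  note p = particle_props[OF assms(1)]
  have "i - 1 \<in> {x} \<and> i \<notin> {x} \<longleftrightarrow> i = Suc x" using assms(2) by auto
  then show 1: "config n ((particle x)(i := Suc (particle x i))) \<longleftrightarrow> i = Suc x"
    unfolding config_raise_iff[OF p(1) assms(2,3)] p(2) .
  assume i: "i = Suc x"
  have c: "config n ((particle x)(i := Suc (particle x i)))" unfolding 1 by (rule i)
  have "occ ((particle x)(i := Suc (particle x i))) = insert i ({x} - {i - 1})"
    using occ_raise[OF p(1) assms(2,3) c] unfolding p(2) .
  also have "\<dots> = {i}" using i by auto
  finally have "count_from (occ ((particle x)(i := Suc (particle x i)))) = particle i" by (simp only: particle_def)
  then show "(particle x)(i := Suc (particle x i)) = particle i" unfolding count_from_occ[OF c] .
qed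

lemma raise_hole:
  assumes "x < n" "0 < i" "i < n"
  shows "config n ((hole n x)(i := Suc (hole n x i))) \<longleftrightarrow> i = x"
    and "i = x \<Longrightarrow> (hole n x)(i := Suc (hole n x i)) = hole n (x - 1)"
proof -
  note p = hole_props[OF assms(1)]
  have "i - 1 \<in> {..<n} - {x} \<and> i \<notin> {..<n} - {x} \<longleftrightarrow> i = x" using assms by auto
  then show 1: "config n ((hole n x)(i := Suc (hole n x i))) \<longleftrightarrow> i = x"
    unfolding config_raise_iff[OF p(1) assms(2,3)] p(2) .
  assume i: "i = x"
  have c: "config n ((hole n x)(i := Suc (hole n x i)))" unfolding 1 by (rule i)
  have "occ ((hole n x)(i := Suc (hole n x i))) = insert i (({..<n} - {x}) - {i - 1})"
    using occ_raise[OF p(1) assms(2,3) c] unfolding p(2) .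
  also have "\<dots> = {..<n} - {x - 1}" using i assms by auto
  finally have "count_from (occ ((hole n x)(i := Suc (hole n x i)))) = hole n (x - 1)"
    by (simp only: hole_def)
  then show "(hole n x)(i := Suc (hole n x i)) = hole n (x - 1)" unfolding count_from_occ[OF c] .
qed

lemma reach_particle:
  assumes "set w \<subseteq> {1..<n}" "x < n" "reach n w (particle x) g"
  shows "\<exists>y. g = particle y \<and> x \<le> y \<and> y < n \<and> ascends w x y"
  using assms
proof (induction w arbitrary: x)
  case Nil
  then show ?case by (auto simp: ascends_def intro!: exI[of _ x])
next
  case (Cons i w)
  have i: "0 < i" "i < n" using Cons.prems(1) by auto
  show ?case
  proof (cases "reach n w (particle x) g")
    case True
    from Cons.IH[OF _ Cons.prems(2) True] Cons.prems(1)
    obtain y pos where y: "g = particle y" "x \<le> y" "y < n"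
      "\<forall>l\<in>{x<..y}. pos l < length w \<and> w ! pos l = l" "\<forall>l\<in>{x<..<y}. pos l < pos (Suc l)"
      unfolding ascends_def by auto
    then show ?thesis unfolding ascends_def
      by (intro exI[of _ y] conjI exI[of _ "\<lambda>l. Suc (pos l)"]) auto
  next
    case False
    with Cons.prems raise_particle[OF Cons.prems(2) i] have i': "i = Suc x" "reach n w (particle i) g" by auto
    from Cons.IH[OF _ i(2) i'(2)] Cons.prems(1) obtain y pos where y: "g = particle y" "i \<le> y" "y < n"
      "\<forall>l\<in>{i<..y}. pos l < length w \<and> w ! pos l = l" "\<forall>l\<in>{i<..<y}. pos l < pos (Suc l)"
      unfolding ascends_def by auto
    define pos' where "pos' l = (if l = i then 0 else Suc (pos l))" for l
    have "\<forall>l\<in>{x<..y}. pos' l < length (i # w) \<and> (i # w) ! pos' l = l"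
      using y(4) i'(1) by (auto simp: pos'_def)
    moreover have "\<forall>l\<in>{x<..<y}. pos' l < pos' (Suc l)"
      using y(5) i'(1) by (auto simp: pos'_def)
    ultimately show ?thesis unfolding ascends_def using y i'
      by (intro exI[of _ y] conjI exI[of _ pos']) auto
  qed
qed

lemma reach_hole:
  assumes "set w \<subseteq> {1..<n}" "x < n" "reach n w (hole n x) g"
  shows "\<exists>y. g = hole n y \<and> y \<le> x \<and> descends w x y"
  using assms
proof (induction w arbitrary: x)
  case Nil
  then show ?case by (auto simp: descends_def intro!: exI[of _ x])
next
  case (Cons i w)
  have i: "0 < i" "i < n" using Cons.prems(1) by auto
  show ?case
  proof (cases "reach n w (hole n x) g")
    case True
    from Cons.IH[OF _ Cons.prems(2) True] Cons.prems(1)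
    obtain y pos where y: "g = hole n y" "y \<le> x"
      "\<forall>l\<in>{y<..x}. pos l < length w \<and> w ! pos l = l" "\<forall>l\<in>{y<..<x}. pos (Suc l) < pos l"
      unfolding descends_def by auto
    then show ?thesis unfolding descends_def
      by (intro exI[of _ y] conjI exI[of _ "\<lambda>l. Suc (pos l)"]) auto
  next
    case False
    with Cons.prems raise_hole[OF Cons.prems(2) i] have i': "i = x" "reach n w (hole n (x - 1)) g" by auto
    have "x - 1 < n" using Cons.prems(2) by simp
    from Cons.IH[OF _ this i'(2)] Cons.prems(1) obtain y pos where y: "g = hole n y" "y \<le> x - 1"
      "\<forall>l\<in>{y<..x - 1}. pos l < length w \<and> w ! pos l = l" "\<forall>l\<in>{y<..<x - 1}. pos (Suc l) < pos l"
      unfolding descends_def by auto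
    define pos' where "pos' l = (if l = i then 0 else Suc (pos l))" for l
    have "\<forall>l\<in>{y<..x}. pos' l < length (i # w) \<and> (i # w) ! pos' l = l"
      using y(3) i'(1) by (auto simp: pos'_def)
    moreover have "\<forall>l\<in>{y<..<x}. pos' (Suc l) < pos' l"
      using y(4) i'(1) by (auto simp: pos'_def)
    ultimately show ?thesis unfolding descends_def using y i'
      by (intro exI[of _ y] conjI exI[of _ pos']) auto
  qed
qed

lemma reach_ascending:
  assumes "y < n" "x \<le> y" "subseq [x + 1..<y + 1] w"
  shows "reach n w (particle x) (particle y)"
proof (rule reach_subseq[OF assms(3)])
  show "reach n [x + 1..<y + 1] (particle x) (particle y)"
    using assms(2)
  proof (induction rule: inc_induct)
    case (step x)
    have "[x + 1..<y + 1] = Suc x # [Suc x + 1..<y + 1]"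
      using step by (simp add: upt_conv_Cons)
    moreover have "config n ((particle x)(Suc x := Suc (particle x (Suc x))))"
      "(particle x)(Suc x := Suc (particle x (Suc x))) = particle (Suc x)"
      using raise_particle[of x n "Suc x"] step assms(1) by auto
    ultimately show ?case using step by simp
  qed simp
qed

lemma reach_descending:
  assumes "x < n" "y \<le> x" "subseq (rev [y + 1..<x + 1]) w"
  shows "reach n w (hole n x) (hole n y)"
proof (rule reach_subseq[OF assms(3)])
  show "reach n (rev [y + 1..<x + 1]) (hole n x) (hole n y)"
    using assms(2,1)
  proof (induction rule: dec_induct)
    case (step x)
    have "rev [y + 1..<Suc x + 1] = Suc x # rev [y + 1..<x + 1]"
      using step by simp
    moreover have "config n ((hole n (Suc x))(Suc x := Suc (hole n (Suc x) (Suc x))))"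
      "(hole n (Suc x))(Suc x := Suc (hole n (Suc x) (Suc x))) = hole n x"
      using raise_hole[of "Suc x" n "Suc x"] step by auto
    ultimately show ?case using step by simp
  qed simp
qed

text \<open>Occurrences are pinned on a run and arbitrary elsewhere; this is how a bandwidth
  influences \<open>delay\<close>.\<close>

lemma occurrences_extend:
  assumes "set w = {1..<n}" "\<And>l. l \<in> S \<Longrightarrow> pos l < length w \<and> w ! pos l = l"
  obtains pos' where "occurrences n w pos'" "\<And>l. l \<in> S \<Longrightarrow> pos' l = pos l"
proof -
  define pos' where "pos' l = (if l \<in> S then pos l else (SOME i. i < length w \<and> w ! i = l))" for l
  have "pos' l < length w \<and> w ! pos' l = l" if "l \<in> {1..<n}" for l
  proof (cases "l \<in> S")
    case False
    have "\<exists>i. i < length w \<and> w ! i = l" using that assms(1) by (metis in_set_conv_nth)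
    then have "(SOME i. i < length w \<and> w ! i = l) < length w \<and> w ! (SOME i. i < length w \<and> w ! i = l) = l"
      by (rule someI_ex)
    with False show ?thesis by (simp add: pos'_def)
  qed (use assms(2) in \<open>simp add: pos'_def\<close>)
  then have "occurrences n w pos'" using assms(1) by (simp add: occurrences_def)
  moreover have "pos' l = pos l" if "l \<in> S" for l using that by (simp add: pos'_def)
  ultimately show thesis by (rule that)
qed

text \<open>Choosing the occurrences of the run makes \<open>u\<close> false at
  \<open>x + 2, ..., x + p\<close>, so these letters add nothing to \<open>delay\<close> between
  \<open>k\<close> and \<open>n - k\<close>. For \<open>n - k \<le> k\<close> monotonicity of
  \<open>delay\<close> alone gives the bound \<open>k\<close>.\<close>

lemma mixed_ascends:
  assumes w: "set w = {1..<n}" and a: "ascends w x (x + p)" "x + p < n" "1 \<le> p"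
    and k: "1 \<le> k" "k < n" and m: "max k (n - p) \<le> m"
  shows "mixed n w k m"
proof -
  obtain pos where pos: "\<And>l. l \<in> {x<..x + p} \<Longrightarrow> pos l < length w \<and> w ! pos l = l"
    "\<And>l. l \<in> {x<..<x + p} \<Longrightarrow> pos l < pos (Suc l)"
    using a(1) unfolding ascends_def by blast
  obtain pos' where pos': "occurrences n w pos'" "\<And>l. l \<in> {x<..x + p} \<Longrightarrow> pos' l = pos l"
    using occurrences_extend[OF w pos(1)] by metis
  define u where "u l \<longleftrightarrow> pos' l < pos' (l - 1)" for l
  have u: "\<not> u l" if l: "l \<in> {x + 1<..x + p}" for l
    using l pos(2)[of "l - 1"] pos'(2)[of l] pos'(2)[of "l - 1"] by (cases l) (auto simp: u_def)
  show ?thesis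
  proof (rule mixed_if[OF pos'(1) k u_def])
    show "k + delay u (n - k) \<le> m + delay u k"
    proof (cases "n - k \<le> k")
      case True
      then show ?thesis using delay_mono[of "n - k" k u] m by simp
    next
      case False
      then have d: "delay u (n - k) = delay u k + card {i \<in> {k<..n - k}. u i}"
        using k by (intro delay_diff) auto
      have "{i \<in> {k<..n - k}. u i} \<subseteq> {k<..n - k} - {max k (x + 1)<..min (n - k) (x + p)}"
        using u by auto
      then have "card {i \<in> {k<..n - k}. u i} \<le>
          card ({k<..n - k} - {max k (x + 1)<..min (n - k) (x + p)})"
        by (intro card_mono) auto
      also have "\<dots> = (n - k - k) - (min (n - k) (x + p) - max k (x + 1))"
        by (subst card_Diff_subset) auto
      finally have C: "card {i \<in> {k<..n - k}. u i} \<le> (n - k - k) - (min (n - k) (x + p) - max k (x + 1))" .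
      \<comment> \<open>The run covers the window \<open>{k<..n - k}\<close> or meets it in at least
        \<open>p - k\<close> letters; the orientation lost at the start of the run is made up for by
        \<open>1 \<le> k\<close> or \<open>x + p < n\<close>.\<close>
      have "n - k - k \<le> min (n - k) (x + p) - max k (x + 1) \<or> p \<le> (min (n - k) (x + p) - max k (x + 1)) + k"
        using a k False unfolding min_def max_def by auto
      then have "k + card {i \<in> {k<..n - k}. u i} \<le> k \<or> k + card {i \<in> {k<..n - k}. u i} \<le> n - p"
        using C False by linarith
      moreover have "k \<le> m" "n - p \<le> m" using m by auto
      ultimately show ?thesis using d by linarith
    qed
  qed
qed

text \<open>Here \<open>u\<close> holds along the run, which lowers the bound when
  \<open>n - k < k\<close>, because then the letters between \<open>n - k\<close> and
  \<open>k\<close> count negatively. For \<open>k \<le> n - k\<close> the increments of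
  \<open>delay\<close>, being at most one, give \<open>n - k\<close>.\<close>

lemma mixed_descends:
  assumes w: "set w = {1..<n}" and a: "descends w (y + q) y" "y + q < n" "1 \<le> q"
    and k: "1 \<le> k" "k < n" and m: "max (n - k) (n - q) \<le> m"
  shows "mixed n w k m"
proof -
  obtain pos where pos: "\<And>l. l \<in> {y<..y + q} \<Longrightarrow> pos l < length w \<and> w ! pos l = l"
    "\<And>l. l \<in> {y<..<y + q} \<Longrightarrow> pos (Suc l) < pos l"
    using a(1) unfolding descends_def by blast
  obtain pos' where pos': "occurrences n w pos'" "\<And>l. l \<in> {y<..y + q} \<Longrightarrow> pos' l = pos l"
    using occurrences_extend[OF w pos(1)] by metis
  define u where "u l \<longleftrightarrow> pos' l < pos' (l - 1)" for l
  have u: "u l" if l: "l \<in> {y + 1<..y + q}" for l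
    using l pos(2)[of "l - 1"] pos'(2)[of l] pos'(2)[of "l - 1"] by (cases l) (auto simp: u_def)
  show ?thesis
  proof (rule mixed_if[OF pos'(1) k u_def])
    show "k + delay u (n - k) \<le> m + delay u k"
    proof (cases "k \<le> n - k")
      case True
      then have "k + (n - k - k) = n - k" by simp
      moreover have "n - k \<le> m" using m by simp
      ultimately show ?thesis using delay_le[OF True, of u] by linarith
    next
      case False
      then have d: "delay u k = delay u (n - k) + card {i \<in> {n - k<..k}. u i}"
        using k by (intro delay_diff) auto
      have "{max (n - k) (y + 1)<..min k (y + q)} \<subseteq> {i \<in> {n - k<..k}. u i}"
        using u by auto
      then have "card {max (n - k) (y + 1)<..min k (y + q)} \<le> card {i \<in> {n - k<..k}. u i}"
        by (intro card_mono) auto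
      then have C: "min k (y + q) - max (n - k) (y + 1) \<le> card {i \<in> {n - k<..k}. u i}" by simp
      have "k - (n - k) \<le> min k (y + q) - max (n - k) (y + 1) \<or> q \<le> (min k (y + q) - max (n - k) (y + 1)) + (n - k)"
        using a k False unfolding min_def max_def by auto
      then have "k \<le> (n - k) + card {i \<in> {n - k<..k}. u i} \<or> k \<le> (n - q) + card {i \<in> {n - k<..k}. u i}"
        using C k a(2) by linarith
      moreover have "n - k \<le> m" "n - q \<le> m" using m by auto
      ultimately show ?thesis using d by linarith
    qed
  qed
qed

section \<open>Summation over the orders of the minors\<close>

lemma sum_reverse:
  fixes f :: "nat \<Rightarrow> nat"
  shows "(\<Sum>k = 1..n - 1. f (n - k)) = (\<Sum>k = 1..n - 1. f k)"
  by (rule sum.reindex_bij_witness[of _ "\<lambda>k. n - k" "\<lambda>k. n - k"]) auto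

lemma sum_truncated_diff:
  assumes "a \<le> Suc N"
  shows "(\<Sum>k = 1..N. a - k) = a choose 2"
  using assms
proof (induction a)
  case (Suc a)
  have "(\<Sum>k = 1..N. Suc a - k) = (\<Sum>k = 1..N. (a - k) + (if k \<in> {1..a} then 1 else 0))"
    by (intro sum.cong) auto
  also have "\<dots> = (a choose 2) + card ({1..N} \<inter> {1..a})"
    using Suc by (simp add: sum.distrib sum.If_cases Collect_conj_eq del: atLeastAtMost_iff)
  also have "{1..N} \<inter> {1..a} = {1..a}" using Suc by auto
  finally show ?case by (simp add: numeral_2_eq_2)
qed simp

lemma twice_choose_two: "2 * (a choose 2) = a * (a - 1)" for a :: nat
  by (cases a) (auto simp: choose_two intro!: dvd_mult_div_cancel)

lemma sum_id_choose_two: "(\<Sum>k = 1..n - 1. k) = n choose 2"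
proof -
  have "(\<Sum>k = 1..n - 1. k) = (\<Sum>k = 1..n - 1. n - k)" by (rule sum_reverse[symmetric])
  also have "\<dots> = n choose 2" by (rule sum_truncated_diff) simp
  finally show ?thesis .
qed

lemma sum_delay_formula:
  fixes e H :: "nat \<Rightarrow> nat"
  assumes "\<And>k. k \<in> {1..n - 1} \<Longrightarrow> e k + H k = k + H (n - k)"
  shows "(\<Sum>k = 1..n - 1. e k) = n choose 2"
proof -
  have "(\<Sum>k = 1..n - 1. e k) + (\<Sum>k = 1..n - 1. H k) = (\<Sum>k = 1..n - 1. k + H (n - k))"
    unfolding sum.distrib[symmetric] by (intro sum.cong) (auto simp: assms)
  also have "\<dots> = (n choose 2) + (\<Sum>k = 1..n - 1. H k)"
    unfolding sum.distrib sum_reverse[of H n] sum_id_choose_two ..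
  finally show ?thesis by simp
qed

text \<open>Used with \<open>a = n - p\<close>, \<open>b = n - q\<close>, \<open>j = n - k\<close>.
  At most one of the truncated corrections is nonzero, as \<open>a > k\<close> and
  \<open>b > j\<close> would contradict \<open>a + b \<le> k + j\<close>.\<close>

lemma min_max_balanced:
  fixes a b k j :: nat
  assumes "2 * a \<le> k + j" "2 * b \<le> k + j"
  shows "min (max k a) (max j b) = min k j + (a - k) + (b - j)"
proof -
  consider "k \<le> a" "b \<le> j" "k \<le> j" "a \<le> j" | "a \<le> k" "j \<le> b" "j \<le> k" "b \<le> k" | "a \<le> k" "b \<le> j"
    using assms by linarith
  then show ?thesis by cases auto
qed

lemma min_half: "min k j + ((k + j) div 2 - k) + ((k + j) div 2 - j) = (k + j) div 2" for k j :: nat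
  by (cases "k \<le> j") auto

text \<open>Here \<open>a\<close> is at least half of \<open>k + j\<close> and takes over the role
  of \<open>k\<close> in the main term.\<close>

lemma min_max_skew:
  fixes a b k j :: nat
  assumes "a + b \<le> k + j" "k + j \<le> 2 * a"
  shows "min (max k a) (max j b) = min a j + (b - j)"
proof -
  consider "a \<le> j" "k \<le> a" "b \<le> j" | "j \<le> a" "b \<le> j" "a \<le> k" | "j \<le> a" "b \<le> j" "k \<le> a" | "j \<le> b" "b \<le> k" "a \<le> k" "b \<le> a"
    using assms by linarith
  then show ?thesis by cases (use assms in auto)
qed

lemma mult_split:
  fixes h n :: nat
  assumes "h \<le> n"
  shows "(n - 1) * h = h * (n - h) + h * (h - 1)"
proof (cases "h = 0")
  case False
  then have "n - 1 = (n - h) + (h - 1)" using assms by linarith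
  then show ?thesis by (metis distrib_left mult.commute)
qed simp

text \<open>The cases follow which of \<open>n div 2\<close>, \<open>n - p\<close>,
  \<open>n - q\<close> is \<open>h\<close>. In each, the minimum splits pointwise into a main term
  and truncated differences, whose sums are binomial coefficients; for \<open>h = n - p\<close> or
  \<open>h = n - q\<close> one of the two binomials comes out of the main term.\<close>

lemma sum_min_max:
  assumes p: "1 \<le> p" "p < n" and q: "1 \<le> q" "q < n" and pq: "n \<le> p + q"
    and h: "h = max (n div 2) (n - min p q)"
  shows "(\<Sum>k = 1..n - 1. min (max k (n - p)) (max (n - k) (n - q))) =
    h * (n - h) + ((n - p) choose 2) + ((n - q) choose 2)"
proof -
  have S: "(\<Sum>k = 1..n - 1. a - k) = a choose 2" "(\<Sum>k = 1..n - 1. a - (n - k)) = a choose 2"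
    if "a \<le> n" for a
  proof -
    show "(\<Sum>k = 1..n - 1. a - k) = a choose 2" by (rule sum_truncated_diff) (use that in simp)
    then show "(\<Sum>k = 1..n - 1. a - (n - k)) = a choose 2"
      using sum_reverse[of "\<lambda>k. a - k" n] by metis
  qed
  have min_sum: "(\<Sum>k = 1..n - 1. min a k) = a * (n - a) + (a choose 2)" if "a \<le> n" "1 \<le> a" for a
  proof -
    have "(\<Sum>k = 1..n - 1. min a k) + (\<Sum>k = 1..n - 1. a - k) = (\<Sum>k = 1..n - 1. a)"
      unfolding sum.distrib[symmetric] by (intro sum.cong) auto
    then have "(\<Sum>k = 1..n - 1. min a k) + (a choose 2) = (n - 1) * a"
      unfolding S(1)[OF that(1)] by simp
    moreover have "(n - 1) * a = a * (n - a) + a * (a - 1)"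
      using that by (intro mult_split) auto
    ultimately show ?thesis using twice_choose_two[of a] by linarith
  qed
  consider "n - p \<le> n div 2" "n - q \<le> n div 2" | "n - p > n div 2" | "n - q > n div 2" by linarith
  then show ?thesis
  proof cases
    case 1
    then have hn: "h = n div 2" using h by (auto simp: min_def max_def split: if_splits)
    have "(\<Sum>k = 1..n - 1. min k (n - k)) + (\<Sum>k = 1..n - 1. h - k) + (\<Sum>k = 1..n - 1. h - (n - k)) =
        (\<Sum>k = 1..n - 1. h)"
      unfolding sum.distrib[symmetric]
    proof (intro sum.cong refl)
      fix k assume "k \<in> {1..n - 1}"
      then have "k + (n - k) = n" using p by auto
      then show "min k (n - k) + (h - k) + (h - (n - k)) = h"
        using hn min_half[of k "n - k"] by simp
    qed
    moreover have "(n - 1) * h = h * (n - h) + h * (h - 1)"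
      using hn by (intro mult_split) auto
    moreover have "h \<le> n" using hn by simp
    ultimately have m: "(\<Sum>k = 1..n - 1. min k (n - k)) = h * (n - h)"
      using S[of h] twice_choose_two[of h] by simp
    have "(\<Sum>k = 1..n - 1. min (max k (n - p)) (max (n - k) (n - q))) =
        (\<Sum>k = 1..n - 1. min k (n - k)) + (\<Sum>k = 1..n - 1. (n - p) - k) + (\<Sum>k = 1..n - 1. (n - q) - (n - k))"
      unfolding sum.distrib[symmetric]
    proof (intro sum.cong refl)
      fix k assume "k \<in> {1..n - 1}"
      then have "1 \<le> k" "k < n" using p by auto
      then show "min (max k (n - p)) (max (n - k) (n - q)) = min k (n - k) + (n - p - k) + (n - q - (n - k))"
        using 1 by (intro min_max_balanced) auto
    qed
    then show ?thesis using m S(1)[of "n - p"] S(2)[of "n - q"] by simp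
  next
    case 2
    then have hn: "h = n - p" using h pq by (auto simp: min_def max_def split: if_splits)
    have "(\<Sum>k = 1..n - 1. min (max k (n - p)) (max (n - k) (n - q))) =
        (\<Sum>k = 1..n - 1. min h (n - k)) + (\<Sum>k = 1..n - 1. (n - q) - (n - k))"
      unfolding sum.distrib[symmetric] hn
    proof (intro sum.cong refl)
      fix k assume "k \<in> {1..n - 1}"
      then have "1 \<le> k" "k < n" using p by auto
      then show "min (max k (n - p)) (max (n - k) (n - q)) = min (n - p) (n - k) + (n - q - (n - k))"
        using 2 pq p q by (intro min_max_skew) auto
    qed
    then show ?thesis
      using S(2)[of "n - q"] min_sum[of h] sum_reverse[of "min h" n] hn p by simp
  next
    case 3
    then have hn: "h = n - q" using h pq by (auto simp: min_def max_def split: if_splits)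
    have "(\<Sum>k = 1..n - 1. min (max k (n - p)) (max (n - k) (n - q))) =
        (\<Sum>k = 1..n - 1. min h k) + (\<Sum>k = 1..n - 1. (n - p) - k)"
      unfolding sum.distrib[symmetric] hn
    proof (intro sum.cong refl)
      fix k assume "k \<in> {1..n - 1}"
      then have "1 \<le> k" "k < n" using p by auto
      then show "min (max k (n - p)) (max (n - k) (n - q)) = min (n - q) k + (n - p - k)"
      proof -
        have "(n - q) + (n - p) \<le> (n - k) + k" "(n - k) + k \<le> 2 * (n - q)"
          using 3 pq p q \<open>k < n\<close> by linarith+
        from min_max_skew[OF this] show ?thesis by (simp only: min.commute)
      qed
    qed
    then show ?thesis
      using S(1)[of "n - p"] min_sum[of h] hn q by simp
  qed
qed

subsection \<open>The extremal words\<close>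

lemma extremal_nth:
  assumes "i < length (extremal_word n p q)"
  shows "i < q - 1 \<Longrightarrow> q \<le> n \<Longrightarrow> extremal_word n p q ! i = n - 1 - i"
    and "q - 1 \<le> i \<Longrightarrow> q \<le> n \<Longrightarrow> 1 \<le> q \<Longrightarrow> extremal_word n p q ! i = i + 2 - q"
  using assms by (auto simp: extremal_word_def nth_append rev_nth)

lemma length_extremal:
  assumes "1 \<le> q" "q \<le> n" shows "length (extremal_word n p q) = q - 1 + p"
  using assms by (simp add: extremal_word_def) arith

text \<open>A longer run would end in a letter \<open>y > p\<close>, which occurs only in the
  descending block; nothing smaller precedes it there, so \<open>y - 1\<close> cannot come
  first.\<close>

lemma ascends_extremal:
  assumes p: "1 \<le> p" "p < n" and q: "1 \<le> q" "q < n"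
    and a: "ascends (extremal_word n p q) x y"
  shows "y \<le> x + p"
proof (rule ccontr)
  assume xy: "\<not> ?thesis"
  let ?w = "extremal_word n p q"
  obtain pos where pos: "\<And>l. l \<in> {x<..y} \<Longrightarrow> pos l < length ?w \<and> ?w ! pos l = l"
    "\<And>l. l \<in> {x<..<y} \<Longrightarrow> pos l < pos (Suc l)"
    using a unfolding ascends_def by blast
  have y: "pos y < length ?w" "?w ! pos y = y" using pos(1)[of y] xy by auto
  have y1: "pos (y - 1) < length ?w" "?w ! pos (y - 1) = y - 1" "pos (y - 1) < pos y"
    using pos(1)[of "y - 1"] pos(2)[of "y - 1"] xy p by auto
  have len: "length ?w = q - 1 + p" using q by (simp add: length_extremal)
  have "pos y < q - 1"
  proof (rule ccontr)
    assume "\<not> pos y < q - 1"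
    then have "y = pos y + 2 - q" using extremal_nth(2)[OF y(1)] y(2) q by simp
    with y(1) len xy q p show False by linarith
  qed
  then have "y = n - 1 - pos y" "y - 1 = n - 1 - pos (y - 1)"
    using extremal_nth(1)[OF y(1)] extremal_nth(1)[OF y1(1)] y y1 q by simp_all
  with y1(3) \<open>pos y < q - 1\<close> q xy show False by linarith
qed

text \<open>A longer run would contain \<open>y + 1\<close> and \<open>y + 2\<close>, both at most
  \<open>n - q\<close> and hence only in the ascending block, where they come in increasing
  order.\<close>

lemma descends_extremal:
  assumes p: "1 \<le> p" "p < n" and q: "1 \<le> q" "q < n" and x: "x < n"
    and a: "descends (extremal_word n p q) x y"
  shows "x \<le> y + q"
proof (rule ccontr)
  assume xy: "\<not> ?thesis"
  let ?w = "extremal_word n p q"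
  obtain pos where pos: "\<And>l. l \<in> {y<..x} \<Longrightarrow> pos l < length ?w \<and> ?w ! pos l = l"
    "\<And>l. l \<in> {y<..<x} \<Longrightarrow> pos (Suc l) < pos l"
    using a unfolding descends_def by blast
  have y: "pos (y + 1) < length ?w" "?w ! pos (y + 1) = y + 1" using pos(1)[of "y + 1"] xy by auto
  have y2: "pos (y + 2) < length ?w" "?w ! pos (y + 2) = y + 2" "pos (y + 2) < pos (y + 1)"
    using pos(1)[of "y + 2"] pos(2)[of "y + 1"] xy q by auto
  have late: "q - 1 \<le> pos l" if "pos l < length ?w" "?w ! pos l = l" "l \<le> n - q" for l
  proof (rule ccontr)
    assume c: "\<not> ?thesis"
    then have "l = n - 1 - pos l" using extremal_nth(1)[OF that(1)] that(2) q by simp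
    with that(3) c q show False by linarith
  qed
  have "y + 2 \<le> n - q" "y + 1 \<le> n - q" using xy x q by linarith+
  then have l: "q - 1 \<le> pos (y + 1)" "q - 1 \<le> pos (y + 2)" using late y y2 by auto
  then have "y + 1 = pos (y + 1) + 2 - q" "y + 2 = pos (y + 2) + 2 - q"
    using extremal_nth(2)[OF y(1)] extremal_nth(2)[OF y2(1)] y y2 q by simp_all
  with y2(3) l q show False by linarith
qed

lemma subseq_extremal:
  assumes p: "1 \<le> p" "p < n" and q: "1 \<le> q" "q < n" and pq: "n \<le> p + q"
  shows "subseq [0 + 1..<p + 1] (extremal_word n p q)"
    and "subseq (rev [n - 1 - q + 1..<(n - 1) + 1]) (extremal_word n p q)"
proof -
  show "subseq [0 + 1..<p + 1] (extremal_word n p q)"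
    unfolding extremal_word_def by (simp add: list_emb_append2)
  have "n - 1 - q + 1 = n - q" "n - 1 + 1 = n" using q by auto
  then have "[n - 1 - q + 1..<(n - 1) + 1] = (n - q) # [n - q + 1..<n]"
    using q by (simp only: upt_conv_Cons Suc_eq_plus1)
  then have e: "rev [n - 1 - q + 1..<(n - 1) + 1] = rev [n - q + 1..<n] @ [n - q]" by simp
  \<comment> \<open>The descending block stops at \<open>n - q + 1\<close>; the last letter of the
    run is borrowed from the ascending block, and this is where \<open>n \<le> p + q\<close>
    enters.\<close>
  have "n - q \<in> set [1..<p + 1]" using p q pq by auto
  then have "subseq [n - q] [1..<p + 1]" by (simp add: subseq_singleton_left del: set_upt)
  then show "subseq (rev [n - 1 - q + 1..<(n - 1) + 1]) (extremal_word n p q)"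
    unfolding e extremal_word_def by (intro list_emb_append_mono) auto
qed

lemma set_extremal_word_eq:
  assumes p: "1 \<le> p" "p < n" and q: "1 \<le> q" "q < n" and pq: "n \<le> p + q"
  shows "set (extremal_word n p q) = {1..<n}"
  using assms by (auto simp: extremal_word_def)

section \<open>Coxeter words with prescribed longest runs\<close>

lemma coxeter_word_positions:
  assumes "i < length (coxeter_word u N)" "j < length (coxeter_word u N)"
    "coxeter_word u N ! i = l" "coxeter_word u N ! j = Suc l" "1 \<le> l"
  shows "i < j \<longleftrightarrow> \<not> u (Suc l)"
proof -
  let ?w = "coxeter_word u N"
  have "Suc l \<in> set ?w" using assms(2,4) by (metis nth_mem)
  then have "1 \<le> Suc l" "Suc l \<le> N" by (auto simp: set_coxeter_word)
  from coxeter_word_split[OF this, of u] obtain xs ys where s: "?w = xs @ Suc l # ys"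
    "Suc l \<notin> set xs" "Suc l \<notin> set ys" "u (Suc l) \<longrightarrow> l \<notin> set xs" "\<not> u (Suc l) \<longrightarrow> l \<notin> set ys"
    by auto
  have j: "j = length xs"
  proof (cases j "length xs" rule: linorder_cases)
    case less
    then show ?thesis using assms(4) s(1,2) by (metis nth_append nth_mem)
  next
    case greater
    then obtain d where "j = length xs + Suc d" by (metis less_iff_Suc_add add_Suc_right)
    then have "Suc l \<in> set ys" using assms(2,4) s(1)
      by (auto simp: nth_append in_set_conv_nth)
    with s(3) show ?thesis by simp
  qed
  have "i \<noteq> j" using assms(3,4) by auto
  show ?thesis
  proof (cases i "length xs" rule: linorder_cases)
    case less
    then have "l \<in> set xs" using assms(3) s(1) by (metis nth_append nth_mem)
    with less j s(4) show ?thesis by auto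
  next
    case greater
    then obtain d where "i = length xs + Suc d" by (metis less_iff_Suc_add add_Suc_right)
    then have "l \<in> set ys" using assms(1,3) s(1) by (auto simp: nth_append)
    with greater j s(5) show ?thesis by auto
  qed (use \<open>i \<noteq> j\<close> j in simp)
qed

lemma ascends_coxeter:
  assumes "ascends (coxeter_word u N) x y" "x < l" "l < y"
  shows "\<not> u (Suc l)"
proof -
  obtain pos where pos: "\<And>l. l \<in> {x<..y} \<Longrightarrow> pos l < length (coxeter_word u N) \<and> coxeter_word u N ! pos l = l"
    "\<And>l. l \<in> {x<..<y} \<Longrightarrow> pos l < pos (Suc l)"
    using assms(1) unfolding ascends_def by blast
  show ?thesis
    using coxeter_word_positions[of "pos l" u N "pos (Suc l)" l] pos(1)[of l] pos(1)[of "Suc l"]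
      pos(2)[of l] assms(2,3) by auto
qed

lemma descends_coxeter:
  assumes "descends (coxeter_word u N) x y" "y < l" "l < x"
  shows "u (Suc l)"
proof -
  obtain pos where pos: "\<And>l. l \<in> {y<..x} \<Longrightarrow> pos l < length (coxeter_word u N) \<and> coxeter_word u N ! pos l = l"
    "\<And>l. l \<in> {y<..<x} \<Longrightarrow> pos (Suc l) < pos l"
    using assms(1) unfolding descends_def by blast
  show ?thesis
    using coxeter_word_positions[of "pos l" u N "pos (Suc l)" l] pos(1)[of l] pos(1)[of "Suc l"]
      pos(2)[of l] assms(2,3) by auto
qed

text \<open>The orientation of a Coxeter word with one ascending run of length \<open>p\<close>, one descending run of
  length \<open>q\<close>, and alternating orientations afterwards.\<close>

definition staircase :: "nat \<Rightarrow> nat \<Rightarrow> nat \<Rightarrow> bool" where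
  "staircase p q l \<longleftrightarrow> p < l \<and> (l < p + q \<or> odd (l - (p + q)))"

text \<open>Beyond \<open>p\<close> an ascending orientation occurs only from \<open>p + q\<close>
  on, and each one there follows a descending one, so runs ending there have at most two letters.
  For \<open>p = 1\<close> or \<open>q = 1\<close> the set of pairs gives \<open>p + q = n\<close>,
  and this tail is empty.\<close>

lemma staircase_ascends:
  assumes pq: "(p, q) \<in> bandwidth_pairs n" "p + q \<le> n" "2 \<le> n"
    and a: "ascends (coxeter_word (staircase p q) (n - 1)) x y" "y < n"
  shows "y \<le> x + p"
proof (rule ccontr)
  assume xy: "\<not> ?thesis"
  have c: "p = 1 \<and> q = n - 1 \<or> p = n - 1 \<and> q = 1 \<or> 2 \<le> p \<and> 2 \<le> q"
    using pq(1) by (auto simp: bandwidth_pairs_def)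
  then have "x < y - 1" "y - 1 < y" using xy pq by auto
  from ascends_coxeter[OF a(1) this] have 1: "\<not> staircase p q y" using xy by auto
  then have "p + q \<le> y" "even (y - (p + q))" using xy by (auto simp: staircase_def)
  with c a(2) pq have pq2: "2 \<le> p" "2 \<le> q" by auto
  then have "x < y - 2" "y - 2 < y" using xy by auto
  from ascends_coxeter[OF a(1) this] have "\<not> staircase p q (y - 1)"
    using xy pq2 by (auto simp: numeral_2_eq_2 Suc_diff_Suc)
  moreover have "staircase p q (y - 1)"
  proof (cases "y = p + q")
    case False
    then have "y - (p + q) = Suc (y - 1 - (p + q))" using \<open>p + q \<le> y\<close> by simp
    with \<open>even (y - (p + q))\<close> show ?thesis using pq2 \<open>p + q \<le> y\<close> by (auto simp: staircase_def)
  qed (use pq2 in \<open>auto simp: staircase_def\<close>)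
  ultimately show False by simp
qed

text \<open>Below \<open>p + q\<close> the descending orientations start at \<open>p + 1\<close>, so
  a run uses at most the \<open>q\<close> letters \<open>p, ..., p + q - 1\<close>; in the
  alternating tail it has at most two letters.\<close>

lemma staircase_descends:
  assumes pq: "(p, q) \<in> bandwidth_pairs n" "p + q \<le> n" "2 \<le> n"
    and a: "descends (coxeter_word (staircase p q) (n - 1)) x y" "x < n"
  shows "x \<le> y + q"
proof (rule ccontr)
  assume xy: "\<not> ?thesis"
  have c: "p = 1 \<and> q = n - 1 \<or> p = n - 1 \<and> q = 1 \<or> 2 \<le> p \<and> 2 \<le> q"
    using pq(1) by (auto simp: bandwidth_pairs_def)
  have u: "staircase p q (Suc l)" if "y < l" "l < x" for l
    by (rule descends_coxeter[OF a(1) that])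
  have q1: "1 \<le> q" using c pq by auto
  have x1: "staircase p q x" using u[of "x - 1"] xy q1 by (cases x) auto
  show False
  proof (cases "x < p + q")
    case True
    have "staircase p q (Suc (y + 1))" using xy q1 by (intro u) auto
    then have "p < y + 2" by (simp add: staircase_def)
    with True xy show False by simp
  next
    case False
    with c a(2) pq have pq2: "2 \<le> p" "2 \<le> q" by auto
    have o: "odd (x - (p + q))" using x1 False by (simp add: staircase_def)
    have "staircase p q (Suc (x - 2))" using xy pq2 by (intro u) auto
    moreover have "Suc (x - 2) = x - 1" using xy pq2 by simp
    moreover have "x \<noteq> p + q" using o by auto
    then have "x - (p + q) = Suc (x - 1 - (p + q))" "\<not> x - 1 < p + q" using False by simp_all
    ultimately show False using o by (auto simp: staircase_def)
  qed
qed

lemma coxeter_word_subseq: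
  assumes "M \<le> N" shows "subseq (coxeter_word u M) (coxeter_word u N)"
  using assms
proof (induction rule: dec_induct)
  case (step N)
  then show ?case by (auto intro: subseq_order.trans)
qed simp

lemma staircase_initial:
  "j < q \<or> j = 0 \<Longrightarrow> coxeter_word (staircase p q) (p + j) = rev [p + 1..<p + j + 1] @ [1..<p + 1]"
proof (induction j)
  case 0
  have "coxeter_word (staircase p q) i = [1..<i + 1]" if "i \<le> p" for i
    using that by (induction i) (auto simp: staircase_def)
  then show ?case by simp
next
  case (Suc j)
  then show ?case by (auto simp: staircase_def)
qed

lemma staircase_subseqs:
  assumes "1 \<le> p" "1 \<le> q" "p + q \<le> n"
  shows "subseq [0 + 1..<p + 1] (coxeter_word (staircase p q) (n - 1))"
    and "subseq (rev [p - 1 + 1..<p + q - 1 + 1]) (coxeter_word (staircase p q) (n - 1))"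
proof -
  have "subseq (coxeter_word (staircase p q) (p + 0)) (coxeter_word (staircase p q) (n - 1))"
    using assms by (intro coxeter_word_subseq) auto
  then show "subseq [0 + 1..<p + 1] (coxeter_word (staircase p q) (n - 1))"
    by (subst (asm) staircase_initial) auto
  have "subseq (coxeter_word (staircase p q) (p + (q - 1))) (coxeter_word (staircase p q) (n - 1))"
    using assms by (intro coxeter_word_subseq) auto
  moreover have "coxeter_word (staircase p q) (p + (q - 1)) = rev [p + 1..<p + q] @ [1..<p + 1]"
    using staircase_initial[of "q - 1" q p] assms by auto
  \<comment> \<open>The \<open>q\<close>-th letter of the descending run is \<open>p\<close>, shared
    with the end of the ascending run.\<close>
  moreover have "rev [p - 1 + 1..<p + q - 1 + 1] = rev [p + 1..<p + q] @ [p]"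
    using assms by (simp add: upt_conv_Cons)
  moreover have "subseq [p] [1..<p + 1]" using assms by (simp add: subseq_singleton_left)
  ultimately show "subseq (rev [p - 1 + 1..<p + q - 1 + 1]) (coxeter_word (staircase p q) (n - 1))"
    by (metis list_emb_append_mono subseq_order.order_refl subseq_order.trans)
qed

subsection \<open>Bandwidths\<close>

lemma cminor_nonzero_iff:
  assumes "factored n w A" "config n f" "config n g" "g 0 = f 0"
  shows "cminor A f g \<noteq> 0 \<longleftrightarrow> round_step n w f g"
proof -
  have A: "A ^\<^sub>m 1 = A" using factored_carrier[OF assms(1)] by simp
  have "cminor A f g \<ge> 0" "cminor A f g > 0 \<longleftrightarrow> round_step n w f g"
    using cminor_power[OF assms(1,2), of 1] assms(3,4) unfolding A by (auto simp: nn_row_def)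
  then show ?thesis by auto
qed

lemma index_cminor:
  assumes "i < n" "j < n"
  shows "M $$ (i, j) = cminor M (particle i) (particle j)"
proof -
  have "minor M ((\<lambda>_. i) ` {..<1 :: nat}) ((\<lambda>_. j) ` {..<1 :: nat}) = mdet M 1 (\<lambda>_. i) (\<lambda>_. j)"
    by (rule minor_image[of n]) (use assms in \<open>auto intro!: idxI\<close>)
  also have "\<dots> = M $$ (i, j)" by (simp add: mdet_def det_single)
  finally show ?thesis using assms by (simp add: cminor_def particle_props lessThan_Suc)
qed

lemma insert_index_range:
  assumes "i < n"
  shows "insert_index i ` {..<n - 1} = {..<n} - {i}"
proof (intro equalityI subsetI)
  fix x assume "x \<in> {..<n} - {i}"
  then have "delete_index i x \<in> {..<n - 1}" "insert_index i (delete_index i x) = x"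
    using assms by (auto simp: delete_index_def insert_index_def)
  then show "x \<in> insert_index i ` {..<n - 1}" by (metis imageI)
qed (use assms in \<open>auto simp: insert_index_def\<close>)

lemma cminor_hole:
  assumes "M \<in> carrier_mat n n" "i < n" "j < n"
  shows "cminor M (hole n i) (hole n j) = det (mat_delete M i j)"
proof -
  have idx: "idx n (n - 1) (insert_index x)" for x
    by (rule idxI) (auto simp: insert_index_def)
  have "cminor M (hole n i) (hole n j) = mdet M (n - 1) (insert_index i) (insert_index j)"
    using minor_image[OF idx idx, of M i j]
    unfolding insert_index_range[OF assms(2)] insert_index_range[OF assms(3)]
    by (simp add: cminor_def hole_props assms(2,3))
  also have "\<dots> = det (mat_delete M i j)"
    unfolding mdet_def by (rule arg_cong[where f = det])
      (use assms in \<open>auto simp: mat_delete_def insert_index_def\<close>)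
  finally show ?thesis .
qed

text \<open>Through the adjugate, the zero pattern of the inverse is that of the minors of order
  \<open>n - 1\<close>, with the indices exchanged; this links its bandwidth to single
  holes.\<close>

lemma mat_inverse_nonzero_iff:
  assumes A: "A \<in> carrier_mat n n" "det A \<noteq> 0"
  shows "the (mat_inverse A) \<in> carrier_mat n n"
    and "i < n \<Longrightarrow> j < n \<Longrightarrow> the (mat_inverse A) $$ (i, j) \<noteq> 0 \<longleftrightarrow> det (mat_delete A j i) \<noteq> 0"
proof -
  have "mat_inverse A \<noteq> None"
    using mat_inverse(1)[OF A(1), of "()"] det_non_zero_imp_unit[OF A, of "()"] by auto
  then obtain B where B: "mat_inverse A = Some B" by auto
  from mat_inverse(2)[OF A(1) B] have I: "A * B = 1\<^sub>m n" "B \<in> carrier_mat n n" by auto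
  then show "the (mat_inverse A) \<in> carrier_mat n n" by (simp add: B)
  note adj = adj_mat[OF A(1)]
  have "adj_mat A = adj_mat A * (A * B)" using adj(1) I by simp
  also have "\<dots> = (adj_mat A * A) * B" using adj(1) A(1) I(2) by (simp add: assoc_mult_mat[of _ n n _ n _ n])
  also have "\<dots> = det A \<cdot>\<^sub>m B" unfolding adj(3) using I(2) by (simp add: mult_smult_assoc_mat[of _ n n _ n])
  finally have e: "adj_mat A = det A \<cdot>\<^sub>m B" .
  assume ij: "i < n" "j < n"
  have "adj_mat A $$ (i, j) = det A * B $$ (i, j)" unfolding e using I(2) ij by simp
  moreover have "adj_mat A $$ (i, j) = (- 1) ^ (j + i) * det (mat_delete A j i)"
    using A(1) ij by (simp add: adj_mat_def cofactor_def)
  ultimately show "the (mat_inverse A) $$ (i, j) \<noteq> 0 \<longleftrightarrow> det (mat_delete A j i) \<noteq> 0"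
    using A(2) B by auto
qed

lemma finite_band:
  "finite ({0} \<union> {nat \<bar>int i - int j\<bar> | i j. i < dim_row M \<and> j < dim_col M \<and> M $$ (i, j) \<noteq> 0})"
proof -
  have "{nat \<bar>int i - int j\<bar> | i j. i < dim_row M \<and> j < dim_col M \<and> M $$ (i, j) \<noteq> 0} \<subseteq>
    (\<lambda>(i, j). nat \<bar>int i - int j\<bar>) ` ({..<dim_row M} \<times> {..<dim_col M})" by auto
  then show ?thesis by (simp add: finite_subset)
qed

lemma bandwidth_eqI:
  assumes "M \<in> carrier_mat n n"
    and "\<And>i j. i < n \<Longrightarrow> j < n \<Longrightarrow> M $$ (i, j) \<noteq> 0 \<Longrightarrow> i \<le> j + p \<and> j \<le> i + p"
    and "a < n" "b < n" "M $$ (a, b) \<noteq> 0" "a = b + p \<or> b = a + p"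
  shows "bandwidth M = p"
  unfolding bandwidth_def
proof (rule Max_eqI[OF finite_band])
  fix y assume "y \<in> {0} \<union> {nat \<bar>int i - int j\<bar> | i j. i < dim_row M \<and> j < dim_col M \<and> M $$ (i, j) \<noteq> 0}"
  then consider "y = 0" | i j where "y = nat \<bar>int i - int j\<bar>" "i < n" "j < n" "M $$ (i, j) \<noteq> 0"
    using assms(1) by auto
  then show "y \<le> p"
  proof cases
    case 2
    from assms(2)[OF 2(2-4)] 2(1) show ?thesis by linarith
  qed simp
next
  have "p = nat \<bar>int a - int b\<bar>" using assms(6) by auto
  then show "p \<in> {0} \<union> {nat \<bar>int i - int j\<bar> | i j. i < dim_row M \<and> j < dim_col M \<and> M $$ (i, j) \<noteq> 0}"
    using assms(1,3-5) by auto
qed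

lemma bandwidth_witness:
  assumes "M \<in> carrier_mat n n" "bandwidth M = p" "1 \<le> p"
  obtains a b where "a < n" "b < n" "M $$ (a, b) \<noteq> 0" "a = b + p \<or> b = a + p"
proof -
  have "p \<in> {0} \<union> {nat \<bar>int i - int j\<bar> | i j. i < dim_row M \<and> j < dim_col M \<and> M $$ (i, j) \<noteq> 0}"
    unfolding assms(2)[symmetric] bandwidth_def by (rule Max_in[OF finite_band]) auto
  then obtain a b where ab: "p = nat \<bar>int a - int b\<bar>" "a < n" "b < n" "M $$ (a, b) \<noteq> 0"
    using assms(1,3) by auto
  from ab(1) have "a = b + p \<or> b = a + p" by linarith
  with ab that show thesis by blast
qed

lemma particle_inj:
  assumes "i < n" "j < n" "particle i = particle j"
  shows "i = j"
proof -
  have "{i} = occ (particle j)" unfolding assms(3)[symmetric] by (rule particle_props(2)[OF assms(1), symmetric])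
  also have "\<dots> = {j}" by (rule particle_props(2)[OF assms(2)])
  finally show ?thesis by (rule singleton_inject)
qed

lemma hole_inj:
  assumes "i < n" "j < n" "hole n i = hole n j"
  shows "i = j"
proof -
  have "{..<n} - {i} = occ (hole n j)"
    unfolding assms(3)[symmetric] by (rule hole_props(2)[OF assms(1), symmetric])
  also have "\<dots> = {..<n} - {j}" by (rule hole_props(2)[OF assms(2)])
  finally have "i \<in> {..<n} - {j} \<longleftrightarrow> i \<in> {..<n} - {i}" by simp
  with assms(1) show ?thesis by simp
qed

text \<open>\<open>z\<close> is the position between the two halves of the round: a nonzero entry
  \<open>(i, j)\<close> needs climbs from one common \<open>z\<close>.\<close>

lemma round_step_particle:
  assumes w: "set w \<subseteq> {1..<n}" and ij: "i < n" "j < n" and r: "round_step n w (particle i) (particle j)"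
  obtains z where "z \<le> i" "z \<le> j" "ascends w z i" "ascends w z j"
proof -
  have 0: "0 \<notin> set w" using w by auto
  obtain b where b: "config n b" "reach n w b (particle i)" "reach n w b (particle j)"
    using r by (auto simp: round_step_def)
  have "b 0 = 1" using reach_config[OF b(2,1) 0] particle_props(3)[OF ij(1)] by simp
  with b(1) obtain z where z: "z < n" "b = particle z" by (rule config_1_particle)
  obtain y where y: "particle i = particle y" "z \<le> y" "y < n" "ascends w z y"
    using reach_particle[OF w z(1) b(2)[unfolded z(2)]] by blast
  obtain y' where y': "particle j = particle y'" "z \<le> y'" "y' < n" "ascends w z y'"
    using reach_particle[OF w z(1) b(3)[unfolded z(2)]] by blast
  show thesis using particle_inj[OF ij(1) y(3,1)] particle_inj[OF ij(2) y'(3,1)] y y' that by simp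
qed

lemma round_step_hole:
  assumes w: "set w \<subseteq> {1..<n}" and ij: "i < n" "j < n" and r: "round_step n w (hole n i) (hole n j)"
  obtains z where "z < n" "i \<le> z" "j \<le> z" "descends w z i" "descends w z j"
proof -
  have 0: "0 \<notin> set w" using w by auto
  obtain b where b: "config n b" "reach n w b (hole n i)" "reach n w b (hole n j)"
    using r by (auto simp: round_step_def)
  have "b 0 = n - 1" using reach_config[OF b(2,1) 0] hole_props(3)[OF ij(1)] by simp
  moreover have "1 \<le> n" using ij by simp
  ultimately obtain z where z: "z < n" "b = hole n z" by (rule config_hole[OF b(1)])
  obtain y where y: "hole n i = hole n y" "y \<le> z" "descends w z y"
    using reach_hole[OF w z(1) b(2)[unfolded z(2)]] by blast
  obtain y' where y': "hole n j = hole n y'" "y' \<le> z" "descends w z y'"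
    using reach_hole[OF w z(1) b(3)[unfolded z(2)]] by blast
  have "i = y" "j = y'"
    using hole_inj[OF ij(1) _ y(1)] hole_inj[OF ij(2) _ y'(1)] y(2) y'(2) z(1) by auto
  then show thesis using z(1) y y' that by simp
qed

lemma cminor_full:
  assumes "M \<in> carrier_mat n n"
  shows "cminor M (count_from {..<n}) (count_from {..<n}) = det M"
proof -
  have "cminor M (count_from {..<n}) (count_from {..<n}) = minor M (id ` {..<n}) (id ` {..<n})"
    by (simp add: cminor_def occ_count_from)
  also have "\<dots> = mdet M n id id" by (rule minor_image[of n]) (auto intro!: idxI)
  also have "\<dots> = det M"
    unfolding mdet_def using assms by (auto intro!: arg_cong[where f = det])
  finally show ?thesis .
qed

lemma factored_det:
  assumes "factored n w A"
  shows "det A \<noteq> 0"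
proof -
  have c: "config n (count_from {..<n})" by (rule config_count_from) simp
  have "round_step n w (count_from {..<n}) (count_from {..<n})"
    unfolding round_step_def using c reach_refl by blast
  then show ?thesis
    using cminor_nonzero_iff[OF assms c c] cminor_full[OF factored_carrier[OF assms]] by simp
qed

lemma factored_bandwidth:
  assumes A: "factored n w A" and a: "\<And>x y. y < n \<Longrightarrow> ascends w x y \<Longrightarrow> y \<le> x + p"
    and r: "x + p < n" "reach n w (particle x) (particle (x + p))"
  shows "bandwidth A = p"
proof (rule bandwidth_eqI[OF factored_carrier[OF A]])
  have w: "set w \<subseteq> {1..<n}" using A by (simp add: factored_def)
  have nz: "A $$ (i, j) \<noteq> 0 \<longleftrightarrow> round_step n w (particle i) (particle j)" if "i < n" "j < n" for i j
    using cminor_nonzero_iff[OF A] that by (simp add: index_cminor particle_props)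
  show "i \<le> j + p \<and> j \<le> i + p" if ij: "i < n" "j < n" and "A $$ (i, j) \<noteq> 0" for i j
  proof -
    have "round_step n w (particle i) (particle j)" using that nz by simp
    then obtain z where "z \<le> i" "z \<le> j" "ascends w z i" "ascends w z j" by (rule round_step_particle[OF w ij])
    with a[OF ij(1), of z] a[OF ij(2), of z] show ?thesis by linarith
  qed
  show "x < n" "x + p < n" using r by auto
  show "A $$ (x, x + p) \<noteq> 0"
    using nz[of x "x + p"] r particle_props(1)[of x n] reach_refl by (auto simp: round_step_def)
qed simp

lemma factored_bandwidth_inverse:
  assumes A: "factored n w A" and a: "\<And>x y. x < n \<Longrightarrow> descends w x y \<Longrightarrow> x \<le> y + q"
    and r: "y + q < n" "reach n w (hole n (y + q)) (hole n y)"
  shows "bandwidth (the (mat_inverse A)) = q"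
proof -
  note cA = factored_carrier[OF A]
  note inv = mat_inverse_nonzero_iff[OF cA factored_det[OF A]]
  have w: "set w \<subseteq> {1..<n}" using A by (simp add: factored_def)
  have nz: "the (mat_inverse A) $$ (i, j) \<noteq> 0 \<longleftrightarrow> round_step n w (hole n j) (hole n i)"
    if "i < n" "j < n" for i j
    using cminor_nonzero_iff[OF A] that by (simp add: inv(2) cminor_hole[OF cA, symmetric] hole_props)
  show ?thesis
  proof (rule bandwidth_eqI[OF inv(1)])
    show "i \<le> j + q \<and> j \<le> i + q" if ij: "i < n" "j < n" and "the (mat_inverse A) $$ (i, j) \<noteq> 0" for i j
    proof -
      have "round_step n w (hole n j) (hole n i)" using that nz by simp
      then obtain z where "z < n" "j \<le> z" "i \<le> z" "descends w z j" "descends w z i"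
        by (rule round_step_hole[OF w ij(2,1)])
      with a[of z i] a[of z j] show ?thesis by linarith
    qed
    show "y < n" "y + q < n" using r by auto
    show "the (mat_inverse A) $$ (y, y + q) \<noteq> 0"
      using nz[of y "y + q"] r hole_props(1)[of "y + q" n] reach_refl by (auto simp: round_step_def)
  qed simp
qed

text \<open>Of the two climbs behind an entry at distance \<open>p\<close>, the longer one starts at
  or below the smaller index; its upper part is the required run.\<close>

lemma factored_ascends:
  assumes A: "factored n w A" and p: "bandwidth A = p" "1 \<le> p"
  obtains x where "x + p < n" "ascends w x (x + p)"
proof -
  have w: "set w \<subseteq> {1..<n}" using A by (simp add: factored_def)
  obtain a b where ab: "a < n" "b < n" "A $$ (a, b) \<noteq> 0" "a = b + p \<or> b = a + p"
    using bandwidth_witness[OF factored_carrier[OF A] p] .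
  have "round_step n w (particle a) (particle b)"
    using cminor_nonzero_iff[OF A, of "particle a" "particle b"] ab by (simp add: index_cminor particle_props)
  then obtain z where z: "z \<le> a" "z \<le> b" "ascends w z a" "ascends w z b"
    by (rule round_step_particle[OF w ab(1,2)])
  define x where "x = min a b"
  have x: "z \<le> x" "x + p < n" "ascends w z (x + p)" using ab z by (auto simp: x_def min_def split: if_splits)
  obtain pos where pos: "\<forall>l\<in>{z<..x + p}. pos l < length w \<and> w ! pos l = l"
    "\<forall>l\<in>{z<..<x + p}. pos l < pos (Suc l)"
    using x(3) unfolding ascends_def by blast
  have "ascends w x (x + p)" unfolding ascends_def
    by (rule exI[of _ pos]) (use pos x(1) in simp)
  with x(2) show thesis by (rule that)
qed

lemma factored_descends:
  assumes A: "factored n w A" and q: "bandwidth (the (mat_inverse A)) = q" "1 \<le> q"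
  obtains y where "y + q < n" "descends w (y + q) y"
proof -
  note cA = factored_carrier[OF A]
  note inv = mat_inverse_nonzero_iff[OF cA factored_det[OF A]]
  have w: "set w \<subseteq> {1..<n}" using A by (simp add: factored_def)
  obtain a b where ab: "a < n" "b < n" "the (mat_inverse A) $$ (a, b) \<noteq> 0" "a = b + q \<or> b = a + q"
    using bandwidth_witness[OF inv(1) q] .
  have "round_step n w (hole n b) (hole n a)"
    using cminor_nonzero_iff[OF A, of "hole n b" "hole n a"] ab
    by (simp add: inv(2) cminor_hole[OF cA, symmetric] hole_props)
  then obtain z where z: "z < n" "b \<le> z" "a \<le> z" "descends w z b" "descends w z a"
    by (rule round_step_hole[OF w ab(2,1)])
  define y where "y = min a b"
  have y: "y + q \<le> z" "y + q < n" "descends w z y" using ab z by (auto simp: y_def min_def split: if_splits)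
  obtain pos where pos: "\<forall>l\<in>{y<..z}. pos l < length w \<and> w ! pos l = l"
    "\<forall>l\<in>{y<..<z}. pos (Suc l) < pos l"
    using y(3) unfolding descends_def by blast
  have "descends w (y + q) y" unfolding descends_def
    by (rule exI[of _ pos]) (use pos y(1) in simp)
  with y(2) show thesis by (rule that)
qed

subsection \<open>The maxima\<close>

text \<open>There is one configuration of \<open>n\<close> particles and none of more, so
  \<open>totally_positive\<close>, which ranges over all orders, is decided by the orders below
  \<open>n\<close>.\<close>

lemma mixed_ge:
  assumes "n \<le> k"
  shows "mixed n w k m"
  unfolding mixed_def
proof (intro allI impI)
  fix f g assume f: "config n f" "f 0 = k" and g: "config n g" "g 0 = k"
  have full: "h l = n - l" if "config n h" "h 0 = k" for h l
    using config_le_diff[OF that(1), of l] config_ge_packed_low[OF that(1), of l] that(2) assms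
      config_zero[OF that(1), of l] by (cases "l \<le> n") auto
  have "f = g" using full[OF f] full[OF g] by auto
  moreover have "round_step n w f f" unfolding round_step_def using f(1) reach_refl by blast
  then have "(round_step n w ^^ m) f f" by (induction m) auto
  ultimately show "(round_step n w ^^ m) f g" by simp
qed

text \<open>A missing letter \<open>l\<close> freezes the value at \<open>l\<close>, so a single
  particle can never get from 0 to \<open>n - 1\<close>.\<close>

lemma mixed_letters:
  assumes "mixed n w 1 m" "set w \<subseteq> {1..<n}"
  shows "set w = {1..<n}"
proof (rule ccontr)
  assume "\<not> ?thesis"
  then obtain l where l: "l \<in> {1..<n}" "l \<notin> set w" using assms(2) by blast
  have inv: "g l = f l" if "round_step n w f g" for f g
    using that reach_notin[OF _ l(2)] unfolding round_step_def by metis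
  have "g l = f l" if "(round_step n w ^^ m) f g" for f g
    using that by (induction m arbitrary: g) (auto dest: inv)
  moreover have "(round_step n w ^^ m) (particle 0) (particle (n - 1))"
    using assms(1) particle_props[of 0 n] particle_props[of "n - 1" n] l(1) unfolding mixed_def by auto
  ultimately have "particle (n - 1) l = particle 0 l" by blast
  moreover have "particle x l = (if l \<le> x then 1 else 0)" for x
  proof -
    have "{y \<in> {x}. l \<le> y} = (if l \<le> x then {x} else {})" by auto
    then show ?thesis by (simp add: particle_def count_from_def)
  qed
  ultimately show False using l(1) by (auto split: if_splits)
qed

lemma totally_positive_power_iff:
  assumes "factored n w A"
  shows "totally_positive (A ^\<^sub>m m) \<longleftrightarrow> (\<forall>k\<ge>1. mixed n w k m)"
  unfolding totally_positive_def using minors_power_pos_iff[OF assms] by simp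

lemma minor_exponent_alt:
  assumes "factored n w A"
  shows "minor_exponent k A = (LEAST m. m \<ge> 1 \<and> mixed n w k m)"
  unfolding minor_exponent_def minors_power_pos_iff[OF assms] ..

lemma exponent_alt:
  assumes "factored n w A"
  shows "exponent A = (LEAST m. m \<ge> 1 \<and> (\<forall>k\<ge>1. mixed n w k m))"
  unfolding exponent_def totally_positive_power_iff[OF assms] ..

lemma minor_exponent_le:
  assumes "factored n w A" "mixed n w k m" "1 \<le> m"
  shows "minor_exponent k A \<le> m" "1 \<le> minor_exponent k A" "mixed n w k (minor_exponent k A)"
  unfolding minor_exponent_alt[OF assms(1)]
  using Least_le[of "\<lambda>m. m \<ge> 1 \<and> mixed n w k m" m] LeastI[of "\<lambda>m. m \<ge> 1 \<and> mixed n w k m" m] assms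
  by auto

text \<open>This is all that the upper bounds retain from membership in
  \<open>sym_oscillatory n p q\<close>. Letters may repeat, and longer runs are allowed.\<close>

definition adapted :: "nat \<Rightarrow> nat \<Rightarrow> nat \<Rightarrow> nat list \<Rightarrow> bool" where
  "adapted n p q w \<longleftrightarrow> set w = {1..<n} \<and> (\<exists>x. x + p < n \<and> ascends w x (x + p)) \<and>
     (\<exists>y. y + q < n \<and> descends w (y + q) y)"

context
  fixes n p q w A
  assumes A: "factored n w A" and w: "adapted n p q w" and pq: "1 \<le> p" "1 \<le> q" and n: "2 \<le> n"
begin

lemma adapted_mixed:
  assumes "1 \<le> k" "k < n" "min (max k (n - p)) (max (n - k) (n - q)) \<le> m"
  shows "mixed n w k m"
proof -
  obtain x y where xy: "set w = {1..<n}" "x + p < n" "ascends w x (x + p)" "y + q < n" "descends w (y + q) y"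
    using w by (auto simp: adapted_def)
  show ?thesis
    using assms(3) mixed_ascends[OF xy(1,3,2) pq(1) assms(1,2), of m]
      mixed_descends[OF xy(1,5,4) pq(2) assms(1,2), of m] by (auto simp: min_le_iff_disj)
qed

lemma adapted_minor_exponent_le:
  assumes "1 \<le> k" "k < n"
  shows "minor_exponent k A \<le> min (max k (n - p)) (max (n - k) (n - q))"
    and "mixed n w k (minor_exponent k A)"
proof -
  have "mixed n w k (min (max k (n - p)) (max (n - k) (n - q)))"
    by (rule adapted_mixed[OF assms order_refl])
  moreover have "1 \<le> min (max k (n - p)) (max (n - k) (n - q))" using assms by auto
  ultimately show "minor_exponent k A \<le> min (max k (n - p)) (max (n - k) (n - q))"
    and "mixed n w k (minor_exponent k A)"
    using minor_exponent_le[OF A] by blast+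
qed

lemma adapted_exponent_le:
  shows "exponent A \<le> max (n div 2) (n - min p q)"
    and "1 \<le> k \<Longrightarrow> mixed n w k (exponent A)"
    and "\<exists>m\<ge>1. totally_positive (A ^\<^sub>m m)"
proof -
  let ?h = "max (n div 2) (n - min p q)"
  have "mixed n w k ?h" if "1 \<le> k" for k
  proof (cases "k < n")
    case True
    show ?thesis
    proof (rule adapted_mixed[OF that True])
      show "min (max k (n - p)) (max (n - k) (n - q)) \<le> ?h"
      \<comment> \<open>The ascending run serves the orders up to half of \<open>n\<close>, the
        descending run the others.\<close>
      proof (cases "k \<le> n div 2")
        case True
        then have "max k (n - p) \<le> ?h" by auto
        then show ?thesis by (rule min.coboundedI1)
      next
        case False
        then have "n - k \<le> n div 2" by linarith
        then have "max (n - k) (n - q) \<le> ?h" by auto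
        then show ?thesis by (rule min.coboundedI2)
      qed
    qed
  qed (simp add: mixed_ge)
  moreover have h: "1 \<le> ?h" using n by auto
  ultimately have m: "1 \<le> ?h \<and> (\<forall>k\<ge>1. mixed n w k ?h)" by blast
  then show "\<exists>m\<ge>1. totally_positive (A ^\<^sub>m m)"
    unfolding totally_positive_power_iff[OF A] by blast
  show "exponent A \<le> ?h"
    unfolding exponent_alt[OF A] by (rule Least_le) (rule m)
  have "1 \<le> exponent A \<and> (\<forall>k\<ge>1. mixed n w k (exponent A))"
    unfolding exponent_alt[OF A] by (rule LeastI) (rule m)
  then show "1 \<le> k \<Longrightarrow> mixed n w k (exponent A)" by blast
qed

lemma dim_row_A: "dim_row A = n"
  using factored_carrier[OF A] by simp

lemma adapted_exponent_sum_le: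
  "exponent_sum A \<le> (\<Sum>k = 1..n - 1. min (max k (n - p)) (max (n - k) (n - q)))"
  unfolding exponent_sum_def dim_row_A
  by (rule sum_mono) (use n in \<open>auto intro!: adapted_minor_exponent_le(1)[unfolded min_le_iff_disj]
      simp: adapted_minor_exponent_le(1) simp del: min.bounded_iff\<close>)

lemma adapted_exponent_sum_le_choose: "exponent_sum A \<le> n choose 2"
proof -
  have sw: "set w = {1..<n}" using w by (simp add: adapted_def)
  obtain pos where pos: "occurrences n w pos"
    using occurrences_extend[OF sw, of "{}"] by blast
  define u where "u l \<longleftrightarrow> pos l < pos (l - 1)" for l
  define e where "e k = k + delay u (n - k) - delay u k" for k
  have e: "e k + delay u k = k + delay u (n - k)" "1 \<le> e k" if "k \<in> {1..n - 1}" for k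
  proof -
    \<comment> \<open>Exponents are at least 1 by definition, so the bound must be positive; this
      also makes the subtraction in \<open>e\<close> exact.\<close>
    have "delay u k < k + delay u (n - k)"
    proof (cases "k \<le> n - k")
      case True
      then show ?thesis using delay_mono[OF True, of u] that by auto
    next
      case False
      then have "n - k \<le> k" by simp
      from delay_le[OF this, of u] show ?thesis using that by auto
    qed
    then show "e k + delay u k = k + delay u (n - k)" "1 \<le> e k" by (auto simp: e_def)
  qed
  have "minor_exponent k A \<le> e k" if "k \<in> {1..n - 1}" for k
  proof (rule minor_exponent_le(1)[OF A _ e(2)[OF that]])
    show "mixed n w k (e k)"
      by (rule mixed_if[OF pos _ _ u_def]) (use that e(1)[OF that] in auto)
  qed
  then have "exponent_sum A \<le> (\<Sum>k = 1..n - 1. e k)"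
    unfolding exponent_sum_def dim_row_A by (rule sum_mono)
  also have "\<dots> = n choose 2" by (rule sum_delay_formula[OF e(1)])
  finally show ?thesis .
qed

end

text \<open>The order \<open>n\<close> minor of a totally positive power gives
  \<open>det A \<noteq> 0\<close>, which makes the factorization available; its order 1 minors force
  every letter to occur, and the bandwidths provide the runs.\<close>

lemma sym_oscillatory_adapted:
  assumes A: "A \<in> sym_oscillatory n p q" and n: "2 \<le> n" and pq: "1 \<le> p" "1 \<le> q"
  obtains w where "factored n w A" "adapted n p q w"
proof -
  have cA: "A \<in> carrier_mat n n" and sym: "A\<^sup>T = A" and osc: "oscillatory A"
    and bw: "bandwidth A = p" "bandwidth (the (mat_inverse A)) = q"
    using A by (auto simp: sym_oscillatory_def)
  obtain m where m: "m \<ge> 1" "totally_positive (A ^\<^sub>m m)" and tn: "totally_nonnegative A"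
    using osc by (auto simp: oscillatory_def)
  have cP: "A ^\<^sub>m m \<in> carrier_mat n n" using cA by simp
  have "config n (count_from {..<n})" "count_from {..<n} 0 = n" by (auto simp: config_count_from count_from_0)
  then have "det (A ^\<^sub>m m) \<in> minors n (A ^\<^sub>m m)"
    unfolding minors_eq_cminor[OF cP] cminor_full[OF cP, symmetric] by blast
  moreover have "1 \<le> n" using n by simp
  ultimately have "det (A ^\<^sub>m m) > 0" using m(2) unfolding totally_positive_def by blast
  moreover have "A ^\<^sub>m m = A ^\<^sub>m (m - 1) * A" using m(1) by (cases m) auto
  ultimately have d: "det A \<noteq> 0"
    using det_mult[of "A ^\<^sub>m (m - 1)" n A] cA by auto
  obtain w as D where w: "set w \<subseteq> {1..<n}" "length as = length w" "\<forall>a\<in>set as. a > 0"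
    "positive_diagonal n D" "A = (word_upper n w as)\<^sup>T * D * word_upper n w as"
    by (rule symmetric_TN_factorization[OF totally_nonnegative_TN[OF tn cA] sym d])
  have f: "factored n w A" unfolding factored_def using w by blast
  have "mixed n w 1 m" using m(2) unfolding totally_positive_power_iff[OF f] by simp
  then have "set w = {1..<n}" by (rule mixed_letters[OF _ w(1)])
  moreover obtain x where "x + p < n" "ascends w x (x + p)" by (rule factored_ascends[OF f bw(1) pq(1)])
  moreover obtain y where "y + q < n" "descends w (y + q) y" by (rule factored_descends[OF f bw(2) pq(2)])
  ultimately have "adapted n p q w" by (auto simp: adapted_def)
  with f show thesis by (rule that)
qed

text \<open>The two subsequences realise the extreme entries of the matrix and of its inverse, and
  the bounds on all runs keep every other nonzero entry within the band. Oscillation follows from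
  the upper bound for adapted words.\<close>

lemma sym_oscillatoryI:
  assumes n: "2 \<le> n" and pq: "1 \<le> p" "1 \<le> q"
    and w: "set w = {1..<n}" and as: "length as = length w" "\<forall>a\<in>set as. a > 0" and D: "positive_diagonal n D"
    and x: "x + p < n" "subseq [x + 1..<x + p + 1] w"
    and y: "y + q < n" "subseq (rev [y + 1..<y + q + 1]) w"
    and a: "\<And>x y. y < n \<Longrightarrow> ascends w x y \<Longrightarrow> y \<le> x + p"
    and d: "\<And>x y. x < n \<Longrightarrow> descends w x y \<Longrightarrow> x \<le> y + q"
    and A: "A = (word_upper n w as)\<^sup>T * D * word_upper n w as"
  shows "factored n w A" "adapted n p q w" "A \<in> sym_oscillatory n p q"
proof -
  show f: "factored n w A" unfolding factored_def using w as D A by blast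
  have rx: "reach n w (particle x) (particle (x + p))" by (rule reach_ascending[OF x(1) _ x(2)]) simp
  have ry: "reach n w (hole n (y + q)) (hole n y)" by (rule reach_descending[OF y(1) _ y(2)]) simp
  have sw: "set w \<subseteq> {1..<n}" using w by simp
  have xn: "x < n" and yn: "y < n" using x y by auto
  obtain x' where x': "particle (x + p) = particle x'" "x' < n" "ascends w x x'"
    using reach_particle[OF sw xn rx] by blast
  obtain y' where y': "hole n y = hole n y'" "y' \<le> y + q" "descends w (y + q) y'"
    using reach_hole[OF sw y(1) ry] by blast
  have "x + p = x'" by (rule particle_inj[OF x(1) x'(2,1)])
  moreover have "y' < n" using y'(2) y(1) by simp
  then have "y = y'" by (rule hole_inj[OF yn _ y'(1)])
  ultimately show ad: "adapted n p q w"
    using w x(1) x'(3) y(1) y'(3) by (auto simp: adapted_def)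
  have cD: "D \<in> carrier_mat n n" using D by (simp add: positive_diagonal_def)
  have "D\<^sup>T = D"
  proof (rule eq_matI)
    fix i j assume "i < dim_row D" "j < dim_col D"
    then show "D\<^sup>T $$ (i, j) = D $$ (i, j)"
      using D cD by (cases "i = j") (auto simp: positive_diagonal_def diagonal_mat_def)
  qed (use cD in auto)
  then have "A\<^sup>T = A"
    unfolding A using cD transpose_carrier_mat
    by (simp add: transpose_mult[of _ n n _ n] assoc_mult_mat[of _ n n _ n _ n])
  moreover have "oscillatory A"
    unfolding oscillatory_def
    using factored_carrier[OF f] factored_TN[OF f] adapted_exponent_le(3)[OF f ad pq n] by simp
  moreover have "bandwidth A = p" by (rule factored_bandwidth[OF f a x(1) rx])
  moreover have "bandwidth (the (mat_inverse A)) = q" by (rule factored_bandwidth_inverse[OF f d y(1) ry])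
  ultimately show "A \<in> sym_oscillatory n p q"
    using factored_carrier[OF f] by (simp add: sym_oscillatory_def)
qed

section \<open>Examples attaining the maxima\<close>

definition int_mat :: "nat \<Rightarrow> real mat \<Rightarrow> bool" where
  "int_mat n M \<longleftrightarrow> M \<in> carrier_mat n n \<and> (\<forall>i<n. \<forall>j<n. M $$ (i, j) \<in> \<int>)"

lemma int_mat_mult:
  assumes "int_mat n M" "int_mat n N"
  shows "int_mat n (M * N)"
  using assms by (auto simp: int_mat_def scalar_prod_def intro!: Ints_sum Ints_mult)

lemma int_word_upper:
  "set w \<subseteq> {1..<n} \<Longrightarrow> int_mat n (word_upper n w (replicate (length w) 1)) \<and>
     det (word_upper n w (replicate (length w) 1)) = 1"
proof (induction w)
  case (Cons i w)
  have "int_mat n (elem_upper n i 1)" "det (elem_upper n i 1) = 1"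
    using Cons.prems by (auto simp: elem_upper_eadd det_eadd) (auto simp: int_mat_def eadd_def)
  with Cons show ?case
    by (auto simp: int_mat_mult det_mult[of _ n])
qed (auto simp: int_mat_def)

lemma int_example:
  fixes n w
  defines "U \<equiv> word_upper n w (replicate (length w) 1)"
  assumes "set w \<subseteq> {1..<n}"
  shows "elements_mat (U\<^sup>T * 1\<^sub>m n * U) \<subseteq> \<int>" "det (U\<^sup>T * 1\<^sub>m n * U) = 1"
proof -
  have U: "int_mat n U" "det U = 1" "U \<in> carrier_mat n n" using int_word_upper[OF assms(2)] by (auto simp: U_def)
  then have "int_mat n U\<^sup>T" by (auto simp: int_mat_def)
  then have "int_mat n (U\<^sup>T * 1\<^sub>m n * U)" using U(1,3) by (simp add: int_mat_mult)
  then show "elements_mat (U\<^sup>T * 1\<^sub>m n * U) \<subseteq> \<int>"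
    by (auto simp: int_mat_def dest!: elements_matD)
  show "det (U\<^sup>T * 1\<^sub>m n * U) = 1"
    using U(2,3) by (simp add: det_mult[of _ n] det_transpose[of _ n])
qed

lemma positive_diagonal_one: "positive_diagonal n (1\<^sub>m n)"
  by (auto simp: positive_diagonal_def diagonal_mat_def)


lemma staircase_example:
  assumes n: "2 \<le> n" and pq: "(p, q) \<in> bandwidth_pairs n" and le: "p + q \<le> n"
  obtains A where "A \<in> sym_oscillatory n p q" "elements_mat A \<subseteq> \<int>" "det A = 1"
    "exponent_sum A = n choose 2"
proof -
  have p: "1 \<le> p" "1 \<le> q" using pq n by (auto simp: bandwidth_pairs_def)
  define u where "u = staircase p q"
  define w where "w = coxeter_word u (n - 1)"
  define U where "U = word_upper n w (replicate (length w) 1)"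
  define A where "A = U\<^sup>T * 1\<^sub>m n * U"
  have w: "set w = {1..<n}" using n by (auto simp: w_def set_coxeter_word)
  have x: "0 + p < n" "subseq [0 + 1..<0 + p + 1] w"
    using staircase_subseqs(1)[OF p le] le p by (simp_all add: w_def u_def del: upt_Suc)
  have y: "p - 1 + q < n" "subseq (rev [p - 1 + 1..<p - 1 + q + 1]) w"
    using staircase_subseqs(2)[OF p le] le p by (simp_all add: w_def u_def del: upt_Suc)
  have asc: "y \<le> x + p" if "y < n" "ascends w x y" for x y
    using staircase_ascends[OF pq le n] that by (simp add: w_def u_def)
  have desc: "x \<le> y + q" if "x < n" "descends w x y" for x y
    using staircase_descends[OF pq le n] that by (simp add: w_def u_def)
  have A: "factored n w A" "adapted n p q w" "A \<in> sym_oscillatory n p q"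
    using sym_oscillatoryI[OF n p w _ _ positive_diagonal_one x y asc desc, of "replicate (length w) 1" A]
    by (simp_all add: A_def U_def)
  have int: "elements_mat A \<subseteq> \<int>" "det A = 1"
    using int_example[of w n] w by (simp_all add: A_def U_def)
  define e where "e k = k + delay u (n - k) - delay u k" for k
  have lower: "k + delay u (n - k) \<le> minor_exponent k A + delay u k" if "k \<in> {1..n - 1}" for k
    using coxeter_lower_bound[of k n u "minor_exponent k A"]
      adapted_minor_exponent_le(2)[OF A(1,2) p n, of k] that by (auto simp: w_def)
  \<comment> \<open>Summed over \<open>k\<close>, the \<open>delay\<close> terms cancel by
    reflection, so the lower bounds add up to \<open>n choose 2\<close> and meet the general upper
    bound.\<close>
  have "(\<Sum>k = 1..n - 1. k) + (\<Sum>k = 1..n - 1. delay u (n - k)) \<le>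
      (\<Sum>k = 1..n - 1. minor_exponent k A) + (\<Sum>k = 1..n - 1. delay u k)"
    unfolding sum.distrib[symmetric] by (rule sum_mono) (rule lower)
  moreover have "(\<Sum>k = 1..n - 1. delay u (n - k)) = (\<Sum>k = 1..n - 1. delay u k)"
    by (rule sum_reverse)
  moreover have "exponent_sum A = (\<Sum>k = 1..n - 1. minor_exponent k A)"
    using factored_carrier[OF A(1)] by (simp add: exponent_sum_def)
  ultimately have "n choose 2 \<le> exponent_sum A" using sum_id_choose_two[of n] by linarith
  with adapted_exponent_sum_le_choose[OF A(1,2) p n] have "exponent_sum A = n choose 2" by simp
  with A int show thesis using that by blast
qed

lemma extremal_example:
  assumes n: "2 \<le> n" and pq: "1 \<le> p" "p < n" "1 \<le> q" "q < n" and ge: "n \<le> p + q"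
    and as: "length as = length (extremal_word n p q)" "\<forall>a\<in>set as. a > 0"
    and D: "positive_diagonal n D" and h: "h = max (n div 2) (n - min p q)"
    and A_def: "A = (word_upper n (extremal_word n p q) as)\<^sup>T * D * word_upper n (extremal_word n p q) as"
  shows "A \<in> sym_oscillatory n p q" "exponent A = h"
    "exponent_sum A = h * (n - h) + ((n - p) choose 2) + ((n - q) choose 2)"
proof -
  define w where "w = extremal_word n p q"
  note b = pq ge
  have w: "set w = {1..<n}" using set_extremal_word_eq[OF b] by (simp add: w_def)
  have x: "0 + p < n" "subseq [0 + 1..<0 + p + 1] w"
    using subseq_extremal(1)[OF b] pq by (simp_all add: w_def del: upt_Suc)
  have y: "n - 1 - q + q < n" "subseq (rev [n - 1 - q + 1..<n - 1 - q + q + 1]) w"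
  proof -
    have "n - 1 - q + q = n - 1" using pq by simp
    then show "n - 1 - q + q < n" "subseq (rev [n - 1 - q + 1..<n - 1 - q + q + 1]) w"
      using subseq_extremal(2)[OF b] n by (simp_all add: w_def)
  qed
  have asc: "y \<le> x + p" if "y < n" "ascends w x y" for x y
    using ascends_extremal[OF pq] that by (simp add: w_def)
  have desc: "x \<le> y + q" if "x < n" "descends w x y" for x y
    using descends_extremal[OF pq] that by (simp add: w_def)
  have A: "factored n w A" "adapted n p q w" and A': "A \<in> sym_oscillatory n p q"
    using sym_oscillatoryI[OF n pq(1,3) w as[folded w_def] D x y asc desc A_def[folded w_def]]
    by simp_all
  show "A \<in> sym_oscillatory n p q" by (rule A')
  note adapted = A pq(1,3) n
  have lower: "min (max k (n - p)) (max (n - k) (n - q)) \<le> m"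
    if "1 \<le> k" "k < n" "mixed n w k m" for k m
    using extremal_lower_bound[OF b that(1,2)] that(3) by (simp add: w_def)
  have "minor_exponent k A = min (max k (n - p)) (max (n - k) (n - q))" if "k \<in> {1..n - 1}" for k
  proof -
    have k: "1 \<le> k" "k < n" using that by auto
    show ?thesis
      using adapted_minor_exponent_le[OF adapted k] lower[OF k] by (meson le_antisym)
  qed
  then have "exponent_sum A = (\<Sum>k = 1..n - 1. min (max k (n - p)) (max (n - k) (n - q)))"
    using factored_carrier[OF A(1)] by (simp add: exponent_sum_def)
  then show "exponent_sum A = h * (n - h) + ((n - p) choose 2) + ((n - q) choose 2)"
    unfolding sum_min_max[OF b h] .
  have low: "min (max k (n - p)) (max (n - k) (n - q)) \<le> exponent A" if "1 \<le> k" "k < n" for k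
    using lower[OF that] adapted_exponent_le(2)[OF adapted that(1)] by blast
  \<comment> \<open>The three terms of \<open>h\<close> are forced by the orders \<open>1\<close>,
    \<open>n - 1\<close> and \<open>n div 2\<close>, in this sequence for \<open>n - p\<close>,
    \<open>n - q\<close> and \<open>n div 2\<close>.\<close>
  have "n - p \<le> exponent A" using low[of 1] pq n by (auto simp: min_def max_def split: if_splits)
  moreover have "n - q \<le> exponent A"
  proof -
    have "n - q \<le> n - 1" using pq by simp
    then have "n - q \<le> min (max (n - 1) (n - p)) (max (n - (n - 1)) (n - q))" by auto
    also have "\<dots> \<le> exponent A" using n by (intro low) auto
    finally show ?thesis .
  qed
  moreover have "n div 2 \<le> exponent A"
  proof -
    have "n div 2 \<le> n - n div 2" by simp
    then have "n div 2 \<le> min (max (n div 2) (n - p)) (max (n - n div 2) (n - q))" by auto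
    also have "\<dots> \<le> exponent A" using n by (intro low) auto
    finally show ?thesis .
  qed
  ultimately have "h \<le> exponent A" unfolding h by (auto simp: min_def)
  moreover have "exponent A \<le> h" using adapted_exponent_le(1)[OF adapted] by (simp add: h)
  ultimately show "exponent A = h" by simp
qed

lemma bandwidth_pairs_bounds:
  assumes "2 \<le> n" "(p, q) \<in> bandwidth_pairs n"
  shows "1 \<le> p" "p < n" "1 \<le> q" "q < n"
  using assms by (auto simp: bandwidth_pairs_def)

theorem corollary4p5:
  fixes n p q :: nat
  assumes "n \<ge> 2"
    and "(p, q) \<in> bandwidth_pairs n"
  shows "let \<A> = sym_oscillatory n p q;
             h = max (n div 2) (n - min p q);
             s = h * (n - h) + ((n - p) choose 2) + ((n - q) choose 2)
         in
           (p + q \<le> n \<longrightarrow>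
              is_maximum exponent_sum \<A> (n choose 2) \<and>
              (\<exists>A\<in>\<A>. elements_mat A \<subseteq> \<int> \<and> det A = 1 \<and> exponent_sum A = n choose 2)) \<and>
           (p + q \<ge> n \<longrightarrow>
              is_maximum exponent \<A> h \<and>
              is_maximum exponent_sum \<A> s \<and>
              (\<forall>as D. length as = length (extremal_word n p q) \<and> (\<forall>a\<in>set as. a > 0) \<and>
                 positive_diagonal n D \<longrightarrow>
                 (let U = word_upper n (extremal_word n p q) as; A = U\<^sup>T * D * U
                  in A \<in> \<A> \<and> exponent A = h \<and> exponent_sum A = s)) \<and>
              (\<exists>A\<in>\<A>. elements_mat A \<subseteq> \<int> \<and> det A = 1 \<and> exponent_sum A = s)) \<and>
           (p + q = n \<longrightarrow> n choose 2 = s)"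
proof -
  define \<A> where "\<A> = sym_oscillatory n p q"
  define h where "h = max (n div 2) (n - min p q)"
  define s where "s = h * (n - h) + ((n - p) choose 2) + ((n - q) choose 2)"
  note b = bandwidth_pairs_bounds[OF assms]
  have 1: "is_maximum exponent_sum \<A> (n choose 2) \<and>
      (\<exists>A\<in>\<A>. elements_mat A \<subseteq> \<int> \<and> det A = 1 \<and> exponent_sum A = n choose 2)" if le: "p + q \<le> n"
  proof -
    obtain A where A: "A \<in> \<A>" "elements_mat A \<subseteq> \<int>" "det A = 1" "exponent_sum A = n choose 2"
      unfolding \<A>_def by (rule staircase_example[OF assms le])
    have "exponent_sum B \<le> n choose 2" if B: "B \<in> \<A>" for B
    proof -
      obtain w where "factored n w B" "adapted n p q w"
        by (rule sym_oscillatory_adapted[OF B[unfolded \<A>_def] assms(1) b(1,3)])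
      then show ?thesis by (rule adapted_exponent_sum_le_choose[OF _ _ b(1,3) assms(1)])
    qed
    moreover have "n choose 2 \<in> exponent_sum ` \<A>" using A(1) A(4)[symmetric] by (rule rev_image_eqI)
    ultimately have "is_maximum exponent_sum \<A> (n choose 2)" unfolding is_maximum_def by simp
    with A show ?thesis by blast
  qed
  have 2: "A \<in> \<A> \<and> exponent A = h \<and> exponent_sum A = s"
    if "n \<le> p + q" "length as = length (extremal_word n p q)" "\<forall>a\<in>set as. a > 0" "positive_diagonal n D"
      "A = (word_upper n (extremal_word n p q) as)\<^sup>T * D * word_upper n (extremal_word n p q) as"
    for as D A
    using extremal_example[OF assms(1) b that(1-4) h_def that(5)] by (simp add: \<A>_def s_def)
  have 3: "is_maximum exponent \<A> h \<and> is_maximum exponent_sum \<A> s \<and>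
      (\<exists>A\<in>\<A>. elements_mat A \<subseteq> \<int> \<and> det A = 1 \<and> exponent_sum A = s)" if ge: "n \<le> p + q"
  proof -
    define w where "w = extremal_word n p q"
    define U where "U = word_upper n w (replicate (length w) 1)"
    define A where "A = U\<^sup>T * 1\<^sub>m n * U"
    have as: "length (replicate (length w) (1 :: real)) = length (extremal_word n p q)"
      "\<forall>a\<in>set (replicate (length w) (1 :: real)). a > 0" by (simp_all add: w_def)
    have A: "A \<in> \<A> \<and> exponent A = h \<and> exponent_sum A = s"
      by (rule 2[OF ge as positive_diagonal_one]) (simp add: A_def U_def w_def)
    have int: "elements_mat A \<subseteq> \<int>" "det A = 1"
      using int_example[of w n] set_extremal_word(1)[OF b(2,4)] by (simp_all add: A_def U_def w_def)
    have "exponent B \<le> h \<and> exponent_sum B \<le> s" if B: "B \<in> \<A>" for B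
    proof -
      obtain w where w: "factored n w B" "adapted n p q w"
        by (rule sym_oscillatory_adapted[OF B[unfolded \<A>_def] assms(1) b(1,3)])
      have "exponent B \<le> h"
        unfolding h_def by (rule adapted_exponent_le(1)[OF w b(1,3) assms(1)])
      moreover have "exponent_sum B \<le> s"
        using adapted_exponent_sum_le[OF w b(1,3) assms(1)]
        unfolding sum_min_max[OF b ge h_def] s_def .
      ultimately show ?thesis by (rule conjI)
    qed
    moreover have "h \<in> exponent ` \<A>" "s \<in> exponent_sum ` \<A>"
      using A by (metis imageI)+
    ultimately have "is_maximum exponent \<A> h" "is_maximum exponent_sum \<A> s"
      unfolding is_maximum_def by simp_all
    with A int show ?thesis by blast
  qed
  \<comment> \<open>Both numbers are the maximum of \<open>exponent_sum\<close> over the same set,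
    so no arithmetic is required.\<close>
  have 4: "n choose 2 = s" if e: "p + q = n"
  proof -
    have "is_maximum exponent_sum \<A> (n choose 2)" "is_maximum exponent_sum \<A> s"
      using 1 3 e by auto
    then have "n choose 2 \<le> s" "s \<le> n choose 2" unfolding is_maximum_def by auto
    then show ?thesis by simp
  qed
  show ?thesis
    unfolding Let_def \<A>_def[symmetric] h_def[symmetric] s_def[symmetric]
  proof (intro conjI impI allI)
    fix as :: "real list" and D
    assume "n \<le> p + q"
      and "length as = length (extremal_word n p q) \<and> (\<forall>a\<in>set as. a > 0) \<and> positive_diagonal n D"
    then have "n \<le> p + q" "length as = length (extremal_word n p q)" "\<forall>a\<in>set as. a > 0"
      "positive_diagonal n D" by simp_all
    note 5 = 2[OF this refl]
    show "(word_upper n (extremal_word n p q) as)\<^sup>T * D * word_upper n (extremal_word n p q) as \<in> \<A>"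
      by (rule conjunct1[OF 5])
    show "exponent ((word_upper n (extremal_word n p q) as)\<^sup>T * D * word_upper n (extremal_word n p q) as) = h"
      by (rule conjunct1[OF conjunct2[OF 5]])
    show "exponent_sum ((word_upper n (extremal_word n p q) as)\<^sup>T * D * word_upper n (extremal_word n p q) as) = s"
      by (rule conjunct2[OF conjunct2[OF 5]])
  qed (simp_all only: 1 3 4)
qed

end
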